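(* Let $d\ge1$ be an integer, and let $p_j,q_j\in[1,\infty]$ and $s_j,t_j\in\mathbf R$ for $j=0,1,2$. Assume that at least one of the following statements holds true: (1) the map $(f_1,f_2)\mapsto f_1\cdot f_2$ on $\mathscr S(\mathbf R^d)$ is continuously extendable to a map from $\mathscr FL^{q_1}_{s_1}(\mathbf R^d)\times\mathscr FL^{q_2}_{s_2}(\mathbf R^d)$ to $\mathscr FL^{q_0'}_{-s_0}(\mathbf R^d)$; (2) the map $(f_1,f_2)\mapsto f_1\cdot f_2$ on $\mathscr S(\mathbf R^d)$ is continuously extendable to a map from $M^{p_1,q_1}_{s_1,t_1}(\mathbf R^d)\times M^{p_2,q_2}_{s_2,t_2}(\mathbf R^d)$ to $M^{p_0',q_0'}_{-s_0,-t_0}(\mathbf R^d)$; (3) the map $(f_1,f_2)\mapsto f_1\cdot f_2$ from $\mathscr S(\mathbf R^d)\times\mathscr S(\mathbf R^d)$ to $\mathscr S(\mathbf R^d)$ is continuously extendable to a map from $W^{p_1,q_1}_{s_1,t_1}(\mathbf R^d)\times W^{p_2,q_2}_{s_2,t_2}(\mathbf R^d)$ to $W^{p_0',q_0'}_{-s_0,-t_0}(\mathbf R^d)$. Then $$0\le s_j+s_k\quad\text{for all } j,k\in\{0,1,2\},\ j\neq k,$$ and $$0\le s_0+s_1+s_2-d\cdot\mathsf R(q),\qquad\text{where } \mathsf R(q)=2-\frac1{q_0}-\frac1{q_1}-\frac1{q_2}.$$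
   Context: Write $\langle x\rangle=(1+|x|^2)^{1/2}$, and for $p\in[1,\infty]$ let $p'\in[1,\infty]$ be the conjugate exponent, $1/p+1/p'=1$ (with $1/\infty=0$). The Fourier transform $\mathscr F$ on $\mathscr S'(\mathbf R^d)$ is given by $(\mathscr Ff)(\xi)=\widehat f(\xi)=(2\pi)^{-d/2}\int f(x)e^{-i\langle x,\xi\rangle}\,dx$ for $f\in L^1(\mathbf R^d)$. For $q\in[1,\infty]$, $s\in\mathbf R$, $\mathscr FL^q_s(\mathbf R^d)$ is the space of all $f\in\mathscr S'(\mathbf R^d)$ with $\|f\|_{\mathscr FL^q_s}=\|\widehat f\cdot\langle\cdot\rangle^s\|_{L^q}<\infty$. Fix a window $\phi\in\mathscr S(\mathbf R^d)\setminus\{0\}$. The short-time Fourier transform of $f\in\mathscr S'(\mathbf R^d)$ is $(V_\phi f)(x,\xi)=\mathscr F\big(f\cdot\overline{\phi(\cdot-x)}\big)(\xi)$. For $s,t\in\mathbf R$ and $p,q\in[1,\infty]$, the modulation space $M^{p,q}_{s,t}(\mathbf R^d)$ consists of all $f\in\mathscr S'(\mathbf R^d)$ such that $$\|f\|_{M^{p,q}_{s,t}}=\Big(\int_{\mathbf R^d}\Big(\int_{\mathbf R^d}|V_\phi f(x,\xi)\langle x\rangle^t\langle\xi\rangle^s|^p\,dx\Big)^{q/p}d\xi\Big)^{1/q}<\infty,$$ and $W^{p,q}_{s,t}(\mathbf R^d)$ consists of all $f\in\mathscr S'(\mathbf R^d)$ such that $$\|f\|_{W^{p,q}_{s,t}}=\Big(\int_{\mathbf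 R^d}\Big(\int_{\mathbf R^d}|V_\phi f(x,\xi)\langle x\rangle^t\langle\xi\rangle^s|^q\,d\xi\Big)^{p/q}dx\Big)^{1/p}<\infty,$$ with the obvious modifications when $p=\infty$ or $q=\infty$ (different choices of $\phi$ give equivalent norms). *)

theory Defs
  imports "HOL-Analysis.Analysis" "HOL-Probability.Essential_Supremum"
begin

section \<open>Exponents and Lebesgue norms\<close>

definition conj_exponent :: "ennreal \<Rightarrow> ennreal" where
  "conj_exponent p = 1 / (1 - 1 / p)"

text \<open>In \<^typ>\<open>ennreal\<close>, \<open>1 / \<infinity> = 0\<close> and \<open>1 / 0 = \<infinity>\<close>, so the endpoint exponents need no special case.\<close>

lemma conj_exponent:
  assumes "1 \<le> p"
  shows "1 \<le> conj_exponent p" "1 / p + 1 / conj_exponent p = 1"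
proof -
  have "1 \<le> conj_exponent p \<and> 1 / p + 1 / conj_exponent p = 1"
  proof (cases p)
    case (real r)
    with assms have r: "1 \<le> r" by (simp add: ennreal_1[symmetric] del: ennreal_1)
    show ?thesis
    proof (cases "r = 1")
      case True
      with real show ?thesis by (simp add: conj_exponent_def divide_ennreal_def)
    next
      case False
      with r have r1: "1 < r" by simp
      have inv: "1 / ennreal x = ennreal (1 / x)" if "0 < x" for x :: real
        using that by (simp add: divide_ennreal ennreal_1[symmetric] del: ennreal_1)
      have "1 - 1 / p = ennreal (1 - 1 / r)"
        using r1 real ennreal_minus[of "1 / r" 1] by (simp add: inv)
      then have c: "conj_exponent p = ennreal (1 / (1 - 1 / r))"
        unfolding conj_exponent_def using r1 by (simp add: inv)
      have "1 \<le> 1 / (1 - 1 / r)" using r1 by (simp add: field_simps)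
      moreover have "1 / p + 1 / conj_exponent p = ennreal (1 / r + (1 - 1 / r))"
        unfolding c unfolding real using r1 ennreal_plus[of "1 / r" "1 - 1 / r"] by (simp add: inv)
      ultimately show ?thesis by (simp add: c)
    qed
  next
    case top
    then show ?thesis by (simp add: conj_exponent_def)
  qed
  then show "1 \<le> conj_exponent p" "1 / p + 1 / conj_exponent p = 1" by auto
qed

text \<open>The power \<open>y\<^sup>r\<close> for \<open>y \<in> [0,\<infinity>]\<close> and \<open>r > 0\<close>.\<close>

definition ennreal_powr :: "ennreal \<Rightarrow> real \<Rightarrow> ennreal" where
  "ennreal_powr y r = (if y = \<infinity> then \<infinity> else ennreal (enn2real y powr r))"

definition Lebesgue_norm :: "ennreal \<Rightarrow> ('a::euclidean_space \<Rightarrow> ennreal) \<Rightarrow> ennreal" where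
  "Lebesgue_norm p u =
     (if p = \<infinity> then esssup lborel u
      else ennreal_powr (\<integral>\<^sup>+ x. ennreal_powr (u x) (enn2real p) \<partial>lborel) (1 / enn2real p))"

definition japanese_bracket :: "'a::euclidean_space \<Rightarrow> real" where
  "japanese_bracket x = sqrt (1 + (norm x)\<^sup>2)"

definition R_functional :: "(nat \<Rightarrow> ennreal) \<Rightarrow> real" where
  "R_functional q = 2 - enn2real (1 / q 0) - enn2real (1 / q 1) - enn2real (1 / q 2)"


section \<open>Schwartz functions and tempered distributions\<close>

text \<open>Partial derivatives of arbitrary order; a multi-index is represented by a list of
  basis vectors.\<close>

primrec iterated_deriv :: "'a::euclidean_space list \<Rightarrow> ('a \<Rightarrow> complex) \<Rightarrow> 'a \<Rightarrow> complex" where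
  "iterated_deriv [] f = f"
| "iterated_deriv (v # vs) f = (\<lambda>x. frechet_derivative (iterated_deriv vs f) (at x) v)"

definition schwartz :: "('a::euclidean_space \<Rightarrow> complex) set" where
  "schwartz = {f. \<forall>vs \<in> lists Basis.
     (\<forall>x. iterated_deriv vs f differentiable at x) \<and>
     (\<forall>N::nat. bounded (range (\<lambda>x. (1 + norm x) ^ N *\<^sub>R iterated_deriv vs f x)))}"

definition schwartz_seminorm :: "nat \<Rightarrow> ('a::euclidean_space \<Rightarrow> complex) \<Rightarrow> real" where
  "schwartz_seminorm N f =
     (\<Sum>vs | set vs \<subseteq> Basis \<and> length vs \<le> N.
        SUP x. (1 + norm x) ^ N * norm (iterated_deriv vs f x))"

text \<open>A distribution is a functional on functions that is only meaningful on Schwartz functions. It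
  is normalised to be \<open>0\<close> elsewhere, so that equality of functionals is equality of distributions.\<close>

type_synonym 'a distribution = "('a \<Rightarrow> complex) \<Rightarrow> complex"

definition tempered_distributions :: "'a::euclidean_space distribution set" where
  "tempered_distributions = {u.
     (\<forall>\<psi>. \<psi> \<notin> schwartz \<longrightarrow> u \<psi> = 0) \<and>
     (\<forall>\<psi>\<in>schwartz. \<forall>\<eta>\<in>schwartz. u (\<lambda>x. \<psi> x + \<eta> x) = u \<psi> + u \<eta>) \<and>
     (\<forall>c. \<forall>\<psi>\<in>schwartz. u (\<lambda>x. c * \<psi> x) = c * u \<psi>) \<and>
     (\<exists>C N. \<forall>\<psi>\<in>schwartz. norm (u \<psi>) \<le> C * schwartz_seminorm N \<psi>)}"

definition distr_diff :: "'a distribution \<Rightarrow> 'a distribution \<Rightarrow> 'a distribution" where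
  "distr_diff u v = (\<lambda>\<psi>. u \<psi> - v \<psi>)"

text \<open>The pairing is bilinear (no complex conjugation).\<close>

definition distr_of_fun :: "('a::euclidean_space \<Rightarrow> complex) \<Rightarrow> 'a distribution" where
  "distr_of_fun g = (\<lambda>\<psi>. if \<psi> \<in> schwartz then LINT x|lborel. g x * \<psi> x else 0)"

definition represents :: "('a::euclidean_space \<Rightarrow> complex) \<Rightarrow> 'a distribution \<Rightarrow> bool" where
  "represents g u \<longleftrightarrow> g \<in> borel_measurable borel \<and>
     (\<forall>\<psi>\<in>schwartz. integrable lborel (\<lambda>x. g x * \<psi> x)) \<and> u = distr_of_fun g"

definition distr_mult :: "'a::euclidean_space distribution \<Rightarrow> ('a \<Rightarrow> complex) \<Rightarrow> 'a distribution" where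
  "distr_mult u h = (\<lambda>\<psi>. if \<psi> \<in> schwartz then u (\<lambda>x. h x * \<psi> x) else 0)"

definition fourier :: "('a::euclidean_space \<Rightarrow> complex) \<Rightarrow> 'a \<Rightarrow> complex" where
  "fourier f \<xi> = (2 * pi) powr (- real DIM('a) / 2) *\<^sub>R
     (LINT x|lborel. f x * exp (- \<i> * complex_of_real (x \<bullet> \<xi>)))"

definition distr_fourier :: "'a::euclidean_space distribution \<Rightarrow> 'a distribution" where
  "distr_fourier u = (\<lambda>\<psi>. if \<psi> \<in> schwartz then u (fourier \<psi>) else 0)"


section \<open>Fourier Lebesgue, modulation and Wiener amalgam spaces\<close>

text \<open>All norms are extended-valued on the tempered distributions; the spaces are the sets where
  they are finite.\<close>

text \<open>A function representing \<open>u\<close>'s Fourier transform is unique almost everywhere, so the infimum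
  below is over at most one value; it is \<open>\<infinity>\<close> if the Fourier transform is not a function.\<close>

definition fourier_lebesgue_norm ::
    "ennreal \<Rightarrow> real \<Rightarrow> 'a::euclidean_space distribution \<Rightarrow> ennreal" where
  "fourier_lebesgue_norm q s u =
     (INF g \<in> {g. represents g (distr_fourier u)}.
        Lebesgue_norm q (\<lambda>\<xi>. ennreal (norm (g \<xi>) * japanese_bracket \<xi> powr s)))"

text \<open>For a Schwartz window \<open>\<phi>\<close> the distribution below is a continuous function of the frequency
  variable, which makes its pointwise values meaningful.\<close>

definition stft :: "('a::euclidean_space \<Rightarrow> complex) \<Rightarrow> 'a distribution \<Rightarrow> 'a \<Rightarrow> 'a \<Rightarrow> complex" where
  "stft \<phi> u x = (THE g. continuous_on UNIV g \<and>
     represents g (distr_fourier (distr_mult u (\<lambda>y. cnj (\<phi> (y - x))))))"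

definition weighted_stft ::
    "('a::euclidean_space \<Rightarrow> complex) \<Rightarrow> real \<Rightarrow> real \<Rightarrow> 'a distribution \<Rightarrow> 'a \<Rightarrow> 'a \<Rightarrow> ennreal" where
  "weighted_stft \<phi> s t u x \<xi> =
     ennreal (norm (stft \<phi> u x \<xi>) * japanese_bracket x powr t * japanese_bracket \<xi> powr s)"

definition modulation_norm ::
    "('a::euclidean_space \<Rightarrow> complex) \<Rightarrow> ennreal \<Rightarrow> ennreal \<Rightarrow> real \<Rightarrow> real \<Rightarrow> 'a distribution \<Rightarrow> ennreal" where
  "modulation_norm \<phi> p q s t u =
     Lebesgue_norm q (\<lambda>\<xi>. Lebesgue_norm p (\<lambda>x. weighted_stft \<phi> s t u x \<xi>))"

definition wiener_amalgam_norm ::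
    "('a::euclidean_space \<Rightarrow> complex) \<Rightarrow> ennreal \<Rightarrow> ennreal \<Rightarrow> real \<Rightarrow> real \<Rightarrow> 'a distribution \<Rightarrow> ennreal" where
  "wiener_amalgam_norm \<phi> p q s t u =
     Lebesgue_norm p (\<lambda>x. Lebesgue_norm q (\<lambda>\<xi>. weighted_stft \<phi> s t u x \<xi>))"

definition distr_space :: "('a::euclidean_space distribution \<Rightarrow> ennreal) \<Rightarrow> 'a distribution set" where
  "distr_space n = {u \<in> tempered_distributions. n u < \<infinity>}"

text \<open>The extension is required to be jointly continuous for the norms, but neither bilinear nor
  unique: Schwartz functions need not be dense when an exponent is infinite.\<close>

definition mult_extendable ::
    "('a::euclidean_space distribution \<Rightarrow> ennreal) \<Rightarrow> ('a distribution \<Rightarrow> ennreal) \<Rightarrow>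
     ('a distribution \<Rightarrow> ennreal) \<Rightarrow> bool" where
  "mult_extendable n1 n2 n \<longleftrightarrow> (\<exists>T.
     (\<forall>u1\<in>distr_space n1. \<forall>u2\<in>distr_space n2. T u1 u2 \<in> distr_space n) \<and>
     (\<forall>f1\<in>schwartz. \<forall>f2\<in>schwartz.
        T (distr_of_fun f1) (distr_of_fun f2) = distr_of_fun (\<lambda>x. f1 x * f2 x)) \<and>
     (\<forall>u1\<in>distr_space n1. \<forall>u2\<in>distr_space n2. \<forall>\<epsilon>>0. \<exists>\<delta>>0.
        \<forall>v1\<in>distr_space n1. \<forall>v2\<in>distr_space n2.
          n1 (distr_diff v1 u1) < \<delta> \<and> n2 (distr_diff v2 u2) < \<delta> \<longrightarrow>
          n (distr_diff (T v1 v2) (T u1 u2)) < \<epsilon>))"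

end

theory Submission
  imports Defs "HOL-Probability.Probability"
begin

text \<open>The multiplication is tested on Gaussian wave packets. On the Fourier side such a packet is a bump
  of width \<open>l\<close> around a frequency \<open>a\<close>. In all three scales of spaces its norm has, up to constants, the
  size of the weighted Lebesgue norm of this bump, which is \<open>l\<^bsup>d/q\<^esup>\<close> times the value at \<open>a\<close> of the
  weight \<open>\<langle>\<xi>\<rangle>\<^sup>s\<close>; the parameters \<open>p\<close> and \<open>t\<close> affect only constants, because all packets sit
  at the origin of configuration space. The product of two packets with centres \<open>a\<^sub>1\<close>, \<open>a\<^sub>2\<close> and width \<open>l\<close> is a packet
  with centre \<open>a\<^sub>1 + a\<^sub>2\<close>, width \<open>\<surd>2 l\<close> and an amplitude enlarged by \<open>l\<^sup>d\<close>. A continuous extension has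
  to respect these sizes for all large frequencies.

  Let the frequencies be \<open>0\<close> or of size \<open>N\<close>, and let \<open>l = N\<^sup>\<theta>\<close> with \<open>0 < \<theta> < 1\<close>. Comparing powers of \<open>N\<close>
  gives \<open>\<theta> d R(q) \<le> \<sigma>\<^sub>0 + \<sigma>\<^sub>1 + \<sigma>\<^sub>2\<close> (lemma \<open>exponent_inequality\<close>), where \<open>\<sigma>\<^sub>j = s\<^sub>j\<close> if the corresponding
  frequency is nonzero, and \<open>\<sigma>\<^sub>j = \<theta> |s\<^sub>j|\<close> otherwise. The frequencies \<open>(N, -N)\<close>, \<open>(N, 0)\<close> and \<open>(0, N)\<close> give
  the three conditions on pairs as \<open>\<theta> \<rightarrow> 0\<close>, and \<open>(N, N)\<close> gives the dimensional condition as \<open>\<theta> \<rightarrow> 1\<close>.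
  Widths below \<open>N\<close> are taken because a weight with a negative exponent is much larger near the origin
  than at \<open>a\<close>; for \<open>\<theta> < 1\<close> the Gaussian tails of the bump are smaller there than any power of \<open>N\<close> (lemma \<open>weight_bound\<close>).

  The sizes of the norms are obtained as follows. The short-time Fourier transform of a packet decays
  rapidly in \<open>x\<close> and in \<open>(\<xi> - a) / l\<close> for every Schwartz window (lemma \<open>stft_wave_packet_decay\<close>), which gives
  the upper bounds. For the lower bounds, after rescaling it converges as \<open>l \<rightarrow> \<infinity>\<close> to the reflected
  conjugate window times a Gaussian, and thus it is bounded away from \<open>0\<close> on a fixed ball in \<open>x\<close> times a ball of
  radius comparable to \<open>l\<close> in \<open>\<xi>\<close> (lemma \<open>packet_profile_nonzero\<close>). In the Fourier Lebesgue case the lower bound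
  comes from Hoelder's inequality. The tools are the invariance of
  the Schwartz class under the Fourier transform, the multiplication formula
  \<open>\<integral> F f \<cdot> g = \<integral> f \<cdot> F g\<close>, and the explicit transforms of Gaussians.\<close>

section \<open>The Japanese bracket\<close>

abbreviation jb :: "'a::euclidean_space \<Rightarrow> real" where "jb \<equiv> japanese_bracket"

lemma jb_sq: "(jb x)\<^sup>2 = 1 + (norm x)\<^sup>2"
  by (simp add: japanese_bracket_def add_nonneg_nonneg)

lemma jb_ge_1: "1 \<le> jb x"
  by (simp add: japanese_bracket_def)

lemma jb_pos [simp]: "0 < jb x" "0 \<le> jb x" "jb x \<noteq> 0"
  using jb_ge_1[of x] by linarith+

lemma norm_le_jb: "norm x \<le> jb x"
  by (rule power2_le_imp_le) (simp_all add: jb_sq)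

lemma jb_le: "jb x \<le> 1 + norm x"
  by (rule power2_le_imp_le) (simp_all add: jb_sq power2_sum)

lemma one_plus_norm_le: "1 + norm x \<le> 2 * jb x"
  using jb_ge_1[of x] norm_le_jb[of x] by linarith

lemma jb_minus [simp]: "jb (- x) = jb x"
  by (simp add: japanese_bracket_def)

lemma jb_mono: "norm x \<le> norm y \<Longrightarrow> jb x \<le> jb y"
  by (simp add: japanese_bracket_def power_mono)

text \<open>Peetre's inequality, with a constant that is convenient rather than optimal.\<close>

lemma jb_add: "jb (x + y) \<le> 2 * jb x * jb y"
proof (rule power2_le_imp_le)
  have "(norm (x + y))\<^sup>2 \<le> (norm x + norm y)\<^sup>2" by (intro power_mono norm_triangle_ineq) auto
  also have "\<dots> \<le> 2 * (norm x)\<^sup>2 + 2 * (norm y)\<^sup>2"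
    using zero_le_power2[of "norm x - norm y"] by (simp add: power2_eq_square algebra_simps)
  finally have "(jb (x + y))\<^sup>2 \<le> 1 + 2 * (norm x)\<^sup>2 + 2 * (norm y)\<^sup>2" by (simp add: jb_sq)
  also have "\<dots> \<le> 4 * (1 + (norm x)\<^sup>2) * (1 + (norm y)\<^sup>2)" by (simp add: algebra_simps)
  also have "\<dots> = (2 * jb x * jb y)\<^sup>2" by (simp add: power_mult_distrib jb_sq)
  finally show "(jb (x + y))\<^sup>2 \<le> (2 * jb x * jb y)\<^sup>2" .
qed simp

lemma jb_scale_le: "\<bar>c\<bar> \<le> 1 \<Longrightarrow> jb (c *\<^sub>R x) \<le> jb x"
  by (intro jb_mono) (simp add: mult_left_le_one_le)

lemma jb_scale_ge: "1 \<le> c \<Longrightarrow> jb (c *\<^sub>R x) \<le> c * jb x"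
proof (rule power2_le_imp_le)
  assume c: "1 \<le> c"
  then have "1 \<le> c\<^sup>2" by (simp add: power2_eq_square mult_ge1_I)
  then show "(jb (c *\<^sub>R x))\<^sup>2 \<le> (c * jb x)\<^sup>2"
    by (simp add: power_mult_distrib jb_sq algebra_simps)
qed simp

lemma continuous_on_jb [continuous_intros]: "continuous_on A f \<Longrightarrow> continuous_on A (\<lambda>x. jb (f x))"
  unfolding japanese_bracket_def by (intro continuous_intros)

lemma borel_measurable_jb [measurable]: "jb \<in> borel_measurable borel"
  by (intro borel_measurable_continuous_onI continuous_intros)

text \<open>The exponent \<open>2 d\<close> is chosen so that the integral factorises:
  \<open>(1 + |x|\<^sup>2)\<^sup>d\<close> is at least the product over the coordinates of \<open>1 + x\<^sub>b\<^sup>2\<close>, and each of these factors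
  has an integrable reciprocal on the line.\<close>

lemma integrable_inverse_jb:
  "integrable lborel (\<lambda>x::'a::euclidean_space. 1 / jb x ^ (2 * DIM('a)))"
proof (rule integrableI_nonneg)
  have "(\<integral>\<^sup>+x. ennreal (1 / jb x ^ (2 * DIM('a))) \<partial>(lborel :: 'a measure))
      \<le> (\<integral>\<^sup>+x. (\<Prod>b\<in>Basis. ennreal (1 / (1 + (x \<bullet> b)\<^sup>2))) \<partial>(lborel :: 'a measure))"
  proof (rule nn_integral_mono)
    fix x :: 'a
    have "jb x ^ (2 * DIM('a)) = (\<Prod>b\<in>(Basis::'a set). 1 + (norm x)\<^sup>2)"
      by (simp add: power_mult jb_sq)
    moreover have "(\<Prod>b\<in>Basis. 1 + (x \<bullet> b)\<^sup>2) \<le> (\<Prod>b\<in>(Basis::'a set). 1 + (norm x)\<^sup>2)"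
      by (intro prod_mono) (auto simp: abs_le_square_iff[symmetric] Basis_le_norm)
    moreover have "0 < (\<Prod>b\<in>Basis. 1 + (x \<bullet> b)\<^sup>2)"
      by (intro prod_pos) (auto intro: add_pos_nonneg)
    ultimately have "1 / jb x ^ (2 * DIM('a)) \<le> (\<Prod>b\<in>Basis. 1 / (1 + (x \<bullet> b)\<^sup>2))"
      unfolding prod_dividef by (simp add: frac_le)
    then show "ennreal (1 / jb x ^ (2 * DIM('a))) \<le> (\<Prod>b\<in>Basis. ennreal (1 / (1 + (x \<bullet> b)\<^sup>2)))"
      by (subst prod_ennreal) (auto intro: ennreal_leI add_nonneg_nonneg)
  qed
  also have "\<dots> = (\<Prod>b\<in>(Basis::'a set). \<integral>\<^sup>+x. ennreal (1 / (1 + x\<^sup>2)) \<partial>lborel)"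
    by (rule nn_integral_lborel_prod) auto
  also have "\<dots> < \<infinity>"
  proof -
    have "integrable lborel (\<lambda>x::real. inverse (1 + x\<^sup>2))"
      using integrable_inverse_1_plus_square by (simp add: set_integrable_def)
    then have "(\<integral>\<^sup>+x. ennreal (1 / (1 + x\<^sup>2)) \<partial>lborel) < \<infinity>"
      by (simp add: integrable_iff_bounded inverse_eq_divide add_nonneg_nonneg)
    then show ?thesis by (simp add: power_less_top_ennreal)
  qed
  finally show "(\<integral>\<^sup>+x. ennreal (1 / jb x ^ (2 * DIM('a))) \<partial>(lborel :: 'a measure)) < \<infinity>" .
qed auto

lemma integrable_jb_decay:
  fixes f :: "'a::euclidean_space \<Rightarrow> 'b::{banach, second_countable_topology}"
  assumes "f \<in> borel_measurable borel" and "\<And>x. norm (f x) \<le> C / jb x ^ (2 * DIM('a))"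
  shows "integrable lborel f"
proof (rule Bochner_Integration.integrable_bound)
  show "integrable lborel (\<lambda>x::'a. C * (1 / jb x ^ (2 * DIM('a))))"
    by (intro integrable_mult_right integrable_inverse_jb)
  show "AE x in lborel. norm (f x) \<le> norm (C * (1 / jb x ^ (2 * DIM('a))))"
    using assms(2) by (intro AE_I2) (metis abs_ge_self order_trans real_norm_def times_divide_eq_right mult.right_neutral)
qed (use assms in auto)

lemma nn_integral_lborel_affine:
  fixes f :: "'a::euclidean_space \<Rightarrow> ennreal"
  assumes [measurable]: "f \<in> borel_measurable borel" and "0 < c"
  shows "(\<integral>\<^sup>+x. f x \<partial>lborel) = ennreal (c ^ DIM('a)) * (\<integral>\<^sup>+x. f (t + c *\<^sub>R x) \<partial>lborel)"
  using \<open>0 < c\<close>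
  by (subst lborel_affine[of c t])
     (auto simp: nn_integral_density nn_integral_distr nn_integral_cmult)

lemma integral_lborel_affine:
  fixes f :: "'a::euclidean_space \<Rightarrow> 'b::{banach, second_countable_topology}"
  assumes [measurable]: "f \<in> borel_measurable borel" and "0 < c"
  shows "(LINT x|lborel. f x) = c ^ DIM('a) *\<^sub>R (LINT x|lborel. f (t + c *\<^sub>R x))"
  using \<open>0 < c\<close>
  by (subst lborel_affine[of c t]) (auto simp: integral_density integral_distr)

lemma integral_lborel_translate:
  fixes f :: "'a::euclidean_space \<Rightarrow> 'b::{banach, second_countable_topology}"
  assumes "f \<in> borel_measurable borel"
  shows "(LINT x|lborel. f (t + x)) = (LINT x|lborel. f x)"
  using integral_lborel_affine[OF assms, of 1 t] by simp

section \<open>Lebesgue norms\<close>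

lemma ennreal_powr_ennreal: "0 \<le> a \<Longrightarrow> ennreal_powr (ennreal a) r = ennreal (a powr r)"
  by (simp add: ennreal_powr_def)

lemma ennreal_powr_mono:
  assumes "a \<le> b" and "0 \<le> r"
  shows "ennreal_powr a r \<le> ennreal_powr b r"
proof (cases "b = \<infinity>")
  case False
  with assms have "a \<noteq> \<infinity>" by (auto simp: top_unique)
  moreover have "enn2real a \<le> enn2real b" using assms False by (intro enn2real_mono) (auto simp: less_top)
  ultimately show ?thesis using assms False
    by (auto simp: ennreal_powr_def intro!: ennreal_leI powr_mono2)
qed (simp add: ennreal_powr_def)

lemma borel_measurable_ennreal_powr [measurable]:
  assumes [measurable]: "f \<in> borel_measurable M"
  shows "(\<lambda>x. ennreal_powr (f x) r) \<in> borel_measurable M"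
  unfolding ennreal_powr_def by measurable

abbreviation recip :: "ennreal \<Rightarrow> real" where
  "recip p \<equiv> enn2real (1 / p)"

lemma exponent_cases:
  assumes "1 \<le> p"
  obtains (top) "p = \<infinity>" "recip p = 0"
  | (real) P where "p = ennreal P" "1 \<le> P" "enn2real p = P" "p \<noteq> \<infinity>" "recip p = 1 / P"
proof (cases p)
  case (real P)
  with assms have "1 \<le> P" by (simp add: ennreal_1[symmetric] del: ennreal_1)
  moreover have "1 / ennreal P = ennreal (1 / P)"
    using \<open>1 \<le> P\<close> divide_ennreal[of 1 P] by simp
  ultimately show ?thesis using real that(2)[of P] by simp
next
  case top
  then show ?thesis using that(1) by simp
qed

lemma recip_conj_exponent:
  assumes "1 \<le> p"
  shows "recip (conj_exponent p) = 1 - recip p"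
proof -
  have 1: "1 / p + 1 / conj_exponent p = 1" using conj_exponent[OF assms] by simp
  then have "1 / p \<noteq> \<infinity>" "1 / conj_exponent p \<noteq> \<infinity>" by (auto simp: top_add add_top)
  then have "enn2real (1 / p + 1 / conj_exponent p) = recip p + recip (conj_exponent p)"
    by (intro enn2real_plus) (auto simp: less_top)
  then show ?thesis using 1 by simp
qed

lemma Lebesgue_norm_finite:
  assumes "1 \<le> P"
  shows "Lebesgue_norm (ennreal P) u =
     ennreal_powr (\<integral>\<^sup>+ x. ennreal_powr (u x) P \<partial>lborel) (1 / P)"
  using assms by (simp add: Lebesgue_norm_def)

text \<open>The summand \<open>1\<close> makes the constant uniform in \<open>p\<close>: a \<open>p\<close>-th root of the integral \<open>I\<close> is at most \<open>1 + I\<close>.\<close>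

definition bump_constant :: "'a::euclidean_space itself \<Rightarrow> real" where
  "bump_constant _ = 1 + (LINT x|(lborel :: 'a measure). 1 / jb x ^ (2 * DIM('a)))"

lemma bump_constant_pos: "0 < bump_constant TYPE('a::euclidean_space)"
  unfolding bump_constant_def by (intro add_pos_nonneg integral_nonneg_AE) auto

text \<open>Every upper bound on a norm below comes from this one: for all exponents at once, a bump
  of height \<open>m\<close>, width \<open>c\<close> and polynomial tails has norm \<open>O(m c\<^bsup>d/p\<^esup>)\<close>. The tails may be the same for
  all \<open>p\<close> because raising them to a power \<open>p \<ge> 1\<close> only makes them smaller. Measurability of \<open>u\<close> enters at
  \<open>p = \<infinity>\<close>, where the essential supremum of a nonmeasurable function is \<open>\<infinity>\<close>.\<close>

lemma Lebesgue_norm_bump_le: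
  fixes u :: "'a::euclidean_space \<Rightarrow> ennreal"
  assumes p: "1 \<le> p" and [measurable]: "u \<in> borel_measurable borel" and m: "0 \<le> m" and c: "0 < c"
    and le: "\<And>x. u x \<le> ennreal (m / jb ((1 / c) *\<^sub>R (x - a)) ^ (2 * DIM('a)))"
  shows "Lebesgue_norm p u \<le> ennreal (bump_constant TYPE('a) * m * c powr (real DIM('a) * recip p))"
proof -
  define I where "I = (LINT x|(lborel :: 'a measure). 1 / jb x ^ (2 * DIM('a)))"
  have I0: "0 \<le> I" unfolding I_def by (intro integral_nonneg_AE) auto
  have I: "(\<integral>\<^sup>+x. ennreal (1 / jb x ^ (2 * DIM('a))) \<partial>(lborel :: 'a measure)) = ennreal I"
    unfolding I_def by (intro nn_integral_eq_integral integrable_inverse_jb) auto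
  have K: "bump_constant TYPE('a) = 1 + I" by (simp add: bump_constant_def I_def)
  have "Lebesgue_norm p u \<le> ennreal ((1 + I) * m * c powr (real DIM('a) * recip p))"
    using p
  proof (cases rule: exponent_cases)
    case top
    have "u x \<le> ennreal ((1 + I) * m)" for x
    proof (rule order_trans[OF le ennreal_leI])
      have "m / jb ((1 / c) *\<^sub>R (x - a)) ^ (2 * DIM('a)) \<le> m / 1"
        using m by (intro divide_left_mono one_le_power jb_ge_1) auto
      also have "\<dots> \<le> (1 + I) * m" using m I0 by (simp add: algebra_simps)
      finally show "m / jb ((1 / c) *\<^sub>R (x - a)) ^ (2 * DIM('a)) \<le> (1 + I) * m" .
    qed
    then show ?thesis using top c by (auto simp: Lebesgue_norm_def intro!: esssup_I)
  next
    case (real P)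
    let ?k = "2 * DIM('a)"
    have "(\<integral>\<^sup>+ x. ennreal_powr (u x) P \<partial>lborel) \<le>
      (\<integral>\<^sup>+ x. ennreal (m powr P) * ennreal (1 / jb ((1 / c) *\<^sub>R (x - a)) ^ ?k) \<partial>lborel)"
    proof (rule nn_integral_mono)
      fix x
      let ?j = "jb ((1 / c) *\<^sub>R (x - a)) ^ ?k"
      have j: "1 \<le> ?j" by (intro one_le_power jb_ge_1)
      have "ennreal_powr (u x) P \<le> ennreal_powr (ennreal (m / ?j)) P"
        using real by (intro ennreal_powr_mono le) auto
      also have "\<dots> = ennreal ((m / ?j) powr P)" using m by (simp add: ennreal_powr_ennreal)
      also have "\<dots> \<le> ennreal (m powr P * (1 / ?j))"
      proof (rule ennreal_leI)
        have "?j powr 1 \<le> ?j powr P" using j real by (intro powr_mono) auto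
        then have "m powr P / ?j powr P \<le> m powr P / ?j"
          using j by (intro divide_left_mono) auto
        then show "(m / ?j) powr P \<le> m powr P * (1 / ?j)" using m by (simp add: powr_divide)
      qed
      also have "\<dots> = ennreal (m powr P) * ennreal (1 / ?j)" by (simp add: ennreal_mult[symmetric])
      finally show "ennreal_powr (u x) P \<le> \<dots>" .
    qed
    also have "\<dots> = ennreal (m powr P) * (ennreal (c ^ DIM('a)) * ennreal I)"
    proof -
      have "(\<integral>\<^sup>+ x. ennreal (1 / jb ((1 / c) *\<^sub>R (x - a)) ^ ?k) \<partial>lborel) = ennreal (c ^ DIM('a)) * ennreal I"
        using c by (subst nn_integral_lborel_affine[where c = c and t = a]) (auto simp: I)
      then show ?thesis by (simp add: nn_integral_cmult)
    qed
    also have "\<dots> = ennreal (m powr P * c powr DIM('a) * I)"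
      using c I0 by (simp add: ennreal_mult powr_realpow mult.assoc)
    finally have "Lebesgue_norm p u \<le> ennreal_powr (ennreal (m powr P * c powr DIM('a) * I)) (1 / P)"
      unfolding real(1) Lebesgue_norm_finite[OF real(2)] using real by (intro ennreal_powr_mono) auto
    also have "\<dots> = ennreal ((m powr P * c powr DIM('a) * I) powr (1 / P))"
      using I0 by (intro ennreal_powr_ennreal) auto
    also have "\<dots> \<le> ennreal ((1 + I) * m * c powr (real DIM('a) * recip p))"
    proof (rule ennreal_leI)
      have "I powr (1 / P) \<le> (1 + I) powr (1 / P)" using I0 real by (intro powr_mono2) auto
      also have "\<dots> \<le> (1 + I) powr 1" using I0 real by (intro powr_mono) auto
      finally have "I powr (1 / P) \<le> 1 + I" using I0 by simp
      then have "m * c powr (real DIM('a) / P) * I powr (1 / P) \<le> m * c powr (real DIM('a) / P) * (1 + I)"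
        using m by (intro mult_left_mono) auto
      then show "(m powr P * c powr DIM('a) * I) powr (1 / P)
          \<le> (1 + I) * m * c powr (real DIM('a) * recip p)"
        using m c I0 real by (simp add: powr_mult powr_powr mult_ac)
    qed
    finally show ?thesis .
  qed
  then show ?thesis unfolding K .
qed

text \<open>At \<open>p = \<infinity>\<close> a nonmeasurable \<open>u\<close> has norm \<open>\<infinity>\<close>, and for finite \<open>p\<close> the integral is monotone on
  all functions.\<close>

lemma Lebesgue_norm_ge:
  fixes u :: "'a::euclidean_space \<Rightarrow> ennreal"
  assumes p: "1 \<le> p" and A: "A \<in> sets borel" "0 < measure lborel A" and m: "0 \<le> m"
    and ge: "\<And>x. x \<in> A \<Longrightarrow> ennreal m \<le> u x"
  shows "ennreal (m * measure lborel A powr recip p) \<le> Lebesgue_norm p u"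
  using p
proof (cases rule: exponent_cases)
  case top
  have "ennreal m \<le> esssup lborel u"
  proof (cases "u \<in> borel_measurable borel")
    case True
    show ?thesis
    proof (rule ccontr)
      assume "\<not> ?thesis"
      then have "A \<subseteq> {x. u x > esssup lborel u}" using ge by (auto simp: not_le intro: less_le_trans)
      moreover have "{x. u x > esssup lborel u} \<in> sets borel" using True by measurable
      ultimately have "emeasure lborel A \<le> 0"
        using emeasure_mono[of A "{x. u x > esssup lborel u}" lborel] esssup_zero_measure[of lborel u] by simp
      then show False using A by (simp add: measure_def)
    qed
  qed (simp add: esssup_def)
  then show ?thesis using top A by (simp add: Lebesgue_norm_def)
next
  case (real P)
  have fin: "emeasure lborel A = ennreal (measure lborel A)"
    using A by (intro emeasure_eq_ennreal_measure) (auto simp: measure_def)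
  have "ennreal (m powr P * measure lborel A) = (\<integral>\<^sup>+ x. ennreal (m powr P) * indicator A x \<partial>lborel)"
    using A fin by (simp add: ennreal_mult nn_integral_cmult_indicator)
  also have "\<dots> \<le> (\<integral>\<^sup>+ x. ennreal_powr (u x) P \<partial>lborel)"
  proof (rule nn_integral_mono)
    fix x
    have "x \<in> A \<Longrightarrow> ennreal (m powr P) \<le> ennreal_powr (u x) P"
      using m real ennreal_powr_mono[OF ge, of x P] by (simp add: ennreal_powr_ennreal)
    then show "ennreal (m powr P) * indicator A x \<le> ennreal_powr (u x) P"
      by (auto split: split_indicator)
  qed
  finally have "ennreal_powr (ennreal (m powr P * measure lborel A)) (1 / P) \<le> Lebesgue_norm p u"
    unfolding real(1) Lebesgue_norm_finite[OF real(2)] using real by (intro ennreal_powr_mono) auto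
  then show ?thesis using real m by (simp add: ennreal_powr_ennreal powr_mult powr_powr)
qed

text \<open>Young's inequality for \<open>f / U\<close> and \<open>g / V\<close>, integrated; at the endpoints one factor is
  replaced by its essential supremum. Positive bounds \<open>U\<close> and \<open>V\<close> in place of the norms themselves keep
  vanishing and infinite norms out of the normalisation.\<close>

lemma Hoelder_bound:
  fixes f g :: "'a::euclidean_space \<Rightarrow> real"
  assumes p: "1 \<le> p"
    and [measurable]: "f \<in> borel_measurable borel" "g \<in> borel_measurable borel"
    and nonneg: "\<And>x. 0 \<le> f x" "\<And>x. 0 \<le> g x"
    and U: "Lebesgue_norm (conj_exponent p) (\<lambda>x. ennreal (f x)) \<le> ennreal U" "0 < U"
    and V: "Lebesgue_norm p (\<lambda>x. ennreal (g x)) \<le> ennreal V" "0 < V"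
  shows "(\<integral>\<^sup>+x. ennreal (f x * g x) \<partial>lborel) \<le> ennreal (U * V)"
proof -
  have sup1: "(\<integral>\<^sup>+x. ennreal (f x * g x) \<partial>lborel) \<le> ennreal (U * V)"
    if [measurable]: "f \<in> borel_measurable borel" "g \<in> borel_measurable borel"
    and nonneg: "\<And>x. 0 \<le> f x" "\<And>x. 0 \<le> g x"
    and U: "Lebesgue_norm \<infinity> (\<lambda>x. ennreal (f x)) \<le> ennreal U" "0 < U"
    and V: "Lebesgue_norm 1 (\<lambda>x. ennreal (g x)) \<le> ennreal V" "0 < V"
    for f g :: "'a \<Rightarrow> real" and U V
  proof -
    have "AE x in lborel. ennreal (f x) \<le> ennreal U"
      using esssup_AE[where M = lborel and f = "\<lambda>x. ennreal (f x)"]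
    proof eventually_elim
      case (elim x)
      also have "esssup lborel (\<lambda>x. ennreal (f x)) \<le> ennreal U" using U by (simp add: Lebesgue_norm_def)
      finally show ?case .
    qed
    then have "(\<integral>\<^sup>+x. ennreal (f x * g x) \<partial>lborel) \<le> (\<integral>\<^sup>+x. ennreal U * ennreal (g x) \<partial>lborel)"
      by (intro nn_integral_mono_AE) (auto simp: ennreal_mult nonneg intro!: mult_right_mono)
    also have "\<dots> = ennreal U * (\<integral>\<^sup>+x. ennreal (g x) \<partial>lborel)"
      by (simp add: nn_integral_cmult)
    also have "(\<integral>\<^sup>+x. ennreal (g x) \<partial>lborel) \<le> ennreal V"
    proof -
      have id1: "ennreal_powr y 1 = y" for y
        by (cases y) (auto simp: ennreal_powr_def)
      show ?thesis using V by (simp add: Lebesgue_norm_def id1)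
    qed
    then have "ennreal U * (\<integral>\<^sup>+x. ennreal (g x) \<partial>lborel) \<le> ennreal U * ennreal V"
      by (intro mult_left_mono) auto
    also have "\<dots> = ennreal (U * V)" using U V by (simp add: ennreal_mult)
    finally show ?thesis .
  qed
  have conj_r: "recip (conj_exponent p) = 1 - recip p"
    by (rule recip_conj_exponent[OF p])
  have p': "1 \<le> conj_exponent p" using conj_exponent[OF p] by simp
  from p show ?thesis
  proof (cases rule: exponent_cases)
    case top
    then have "conj_exponent p = 1" by (simp add: conj_exponent_def)
    with top sup1[of g f V U] U V nonneg show ?thesis by (simp add: mult_ac)
  next
    case (real P)
    show ?thesis
    proof (cases "P = 1")
      case True
      then have "conj_exponent p = \<infinity>" using real by (simp add: conj_exponent_def divide_ennreal_def)
      with True real sup1[of f g U V] U V nonneg show ?thesis by simp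
    next
      case False
      with real have P: "1 < P" by simp
      from p' obtain Q where Q: "conj_exponent p = ennreal Q" "1 \<le> Q" "1 / P + 1 / Q = 1"
      proof (cases rule: exponent_cases)
        case top
        with conj_r real P show ?thesis by simp
      next
        case (real Q)
        with conj_r \<open>recip p = 1 / P\<close> that[of Q] show ?thesis by simp
      qed
      from Q P have Q1: "1 < Q" by (cases "Q = 1") auto
      have norm_le: "(\<integral>\<^sup>+x. ennreal ((h x / W) powr r) \<partial>lborel) \<le> 1"
        if [measurable]: "h \<in> borel_measurable borel" and "\<And>x. 0 \<le> h x" and r: "1 \<le> r"
          and W: "0 < W" and le: "Lebesgue_norm (ennreal r) (\<lambda>x. ennreal (h x)) \<le> ennreal W"
        for h :: "'a \<Rightarrow> real" and W r
      proof -
        define J where "J = (\<integral>\<^sup>+x. ennreal (h x powr r) \<partial>lborel)"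
        have J: "ennreal_powr J (1 / r) \<le> ennreal W"
          using le that(2) unfolding Lebesgue_norm_finite[OF r] J_def by (simp add: ennreal_powr_ennreal)
        then have "J \<noteq> \<infinity>" by (auto simp: ennreal_powr_def top_unique)
        then obtain j where j: "J = ennreal j" "0 \<le> j" by (cases J) auto
        with J W have "j powr (1 / r) \<le> W" by (simp add: ennreal_powr_ennreal)
        then have "(j powr (1 / r)) powr r \<le> W powr r" using r by (intro powr_mono2) auto
        then have jW: "j \<le> W powr r" using j r by (simp add: powr_powr)
        have "(\<integral>\<^sup>+x. ennreal ((h x / W) powr r) \<partial>lborel) = (\<integral>\<^sup>+x. ennreal (1 / W powr r) * ennreal (h x powr r) \<partial>lborel)"
          using that(2) W by (intro nn_integral_cong) (simp add: powr_divide ennreal_mult[symmetric])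
        also have "\<dots> = ennreal (1 / W powr r) * J" by (simp add: nn_integral_cmult J_def)
        also have "\<dots> = ennreal (j / W powr r)" using j by (simp add: ennreal_mult[symmetric])
        also have "\<dots> \<le> 1" using jW W by simp
        finally show ?thesis .
      qed
      have "(\<integral>\<^sup>+x. ennreal (f x * g x) \<partial>lborel) \<le>
        (\<integral>\<^sup>+x. ennreal (U * V) * (ennreal (1 / Q) * ennreal ((f x / U) powr Q) + ennreal (1 / P) * ennreal ((g x / V) powr P)) \<partial>lborel)"
      proof (rule nn_integral_mono)
        fix x
        have "(f x / U) * (g x / V) \<le> (f x / U) powr Q / Q + (g x / V) powr P / P"
          using Q Q1 P U V nonneg by (intro Youngs_inequality) (auto simp: add.commute)
        then have "f x * g x \<le> U * V * ((f x / U) powr Q / Q + (g x / V) powr P / P)"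
          using U V by (simp add: field_simps)
        then have "ennreal (f x * g x) \<le> ennreal (U * V * ((f x / U) powr Q / Q + (g x / V) powr P / P))"
          by (rule ennreal_leI)
        also have "\<dots> = ennreal (U * V) * (ennreal (1 / Q) * ennreal ((f x / U) powr Q) + ennreal (1 / P) * ennreal ((g x / V) powr P))"
          using U V Q1 P by (simp add: ennreal_mult[symmetric] ennreal_plus[symmetric] del: ennreal_plus)
        finally show "ennreal (f x * g x) \<le> \<dots>" .
      qed
      also have "\<dots> = ennreal (U * V) * (ennreal (1 / Q) * (\<integral>\<^sup>+x. ennreal ((f x / U) powr Q) \<partial>lborel) + ennreal (1 / P) * (\<integral>\<^sup>+x. ennreal ((g x / V) powr P) \<partial>lborel))"
        by (simp add: nn_integral_cmult nn_integral_add)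
      also have "\<dots> \<le> ennreal (U * V) * (ennreal (1 / Q) * 1 + ennreal (1 / P) * 1)"
        using U V Q Q1 P real nonneg
        by (intro mult_left_mono add_mono norm_le) auto
      also have "\<dots> = ennreal (U * V)"
        using Q Q1 P by (simp add: ennreal_plus[symmetric] add.commute del: ennreal_plus)
      finally show ?thesis .
    qed
  qed
qed

text \<open>Hoelder's inequality read backwards. It bounds the Fourier Lebesgue norm from below without
  any knowledge of the pointwise values of a representing function, which is only given through its
  pairings with Schwartz functions.\<close>

lemma Lebesgue_norm_ge_dual:
  fixes f g :: "'a::euclidean_space \<Rightarrow> real"
  assumes p: "1 \<le> p"
    and "f \<in> borel_measurable borel" "g \<in> borel_measurable borel"
    and nonneg: "\<And>x. 0 \<le> f x" "\<And>x. 0 \<le> g x"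
    and V: "Lebesgue_norm p (\<lambda>x. ennreal (g x)) \<le> ennreal V" "0 < V"
    and A: "ennreal A \<le> (\<integral>\<^sup>+x. ennreal (f x * g x) \<partial>lborel)"
  shows "ennreal (A / V) \<le> Lebesgue_norm (conj_exponent p) (\<lambda>x. ennreal (f x))"
proof (rule ccontr)
  assume "\<not> ?thesis"
  then have "Lebesgue_norm (conj_exponent p) (\<lambda>x. ennreal (f x)) < ennreal (A / V)" by simp
  then obtain U where U: "Lebesgue_norm (conj_exponent p) (\<lambda>x. ennreal (f x)) < ennreal U" "ennreal U < ennreal (A / V)" "0 \<le> U"
    by (metis dense ennreal_cases less_top_ennreal order_less_imp_not_less top.not_eq_extremum)
  from U have U0: "0 < U" by (cases "U = 0") auto
  have "ennreal A \<le> ennreal (U * V)"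
    using A Hoelder_bound[of p f g U V, OF p _ _ nonneg less_imp_le[OF U(1)] U0 V] assms(2,3)
    by (auto intro: order_trans)
  moreover have "U * V < A" using U V by (simp add: ennreal_less_iff pos_less_divide_eq)
  moreover have "0 < U * V" using U0 V by simp
  ultimately show False by (simp add: ennreal_le_iff2)
qed


section \<open>Schwartz functions\<close>

abbreviation partial :: "'a::euclidean_space \<Rightarrow> ('a \<Rightarrow> complex) \<Rightarrow> 'a \<Rightarrow> complex" where
  "partial v f \<equiv> (\<lambda>x. frechet_derivative f (at x) v)"

text \<open>The decay half of the definition of the Schwartz class, for a single function and with the
  bracket as weight, which is submultiplicative up to a constant.\<close>

definition rapid_decay :: "('a::euclidean_space \<Rightarrow> complex) \<Rightarrow> bool" where
  "rapid_decay f \<longleftrightarrow> (\<forall>k. \<exists>C. \<forall>x. norm (f x) \<le> C / jb x ^ k)"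

lemma rapid_decayD:
  assumes "rapid_decay f"
  obtains C where "0 < C" "\<And>x. norm (f x) \<le> C / jb x ^ k"
proof -
  from assms obtain C where C: "\<And>x. norm (f x) \<le> C / jb x ^ k"
    unfolding rapid_decay_def by blast
  have "norm (f x) \<le> (\<bar>C\<bar> + 1) / jb x ^ k" for x
    by (rule order_trans[OF C]) (auto intro!: divide_right_mono)
  then show ?thesis by (intro that[of "\<bar>C\<bar> + 1"]) auto
qed

lemma rapid_decay_iff_bounded:
  "rapid_decay f \<longleftrightarrow> (\<forall>N. bounded (range (\<lambda>x. (1 + norm x) ^ N *\<^sub>R f x)))"
proof
  assume r: "rapid_decay f"
  show "\<forall>N. bounded (range (\<lambda>x. (1 + norm x) ^ N *\<^sub>R f x))"
  proof
    fix N
    obtain C where C: "0 < C" "\<And>x. norm (f x) \<le> C / jb x ^ N"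
      using rapid_decayD[OF r] by metis
    have "norm ((1 + norm x) ^ N *\<^sub>R f x) \<le> 2 ^ N * C" for x
    proof -
      have "(1 + norm x) ^ N \<le> (2 * jb x) ^ N" by (intro power_mono one_plus_norm_le) auto
      then have "(1 + norm x) ^ N * norm (f x) \<le> (2 * jb x) ^ N * (C / jb x ^ N)"
        by (intro mult_mono C) auto
      then show ?thesis by (simp add: power_mult_distrib)
    qed
    then show "bounded (range (\<lambda>x. (1 + norm x) ^ N *\<^sub>R f x))" by (auto simp: bounded_iff)
  qed
next
  assume *: "\<forall>N. bounded (range (\<lambda>x. (1 + norm x) ^ N *\<^sub>R f x))"
  show "rapid_decay f"
    unfolding rapid_decay_def
  proof
    fix N
    from * obtain C where C: "\<And>x. norm ((1 + norm x) ^ N *\<^sub>R f x) \<le> C"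
      unfolding bounded_iff by (meson rangeI)
    have "norm (f x) \<le> C / jb x ^ N" for x
    proof -
      have "jb x ^ N * norm (f x) \<le> (1 + norm x) ^ N * norm (f x)"
        by (intro mult_right_mono power_mono jb_le) auto
      with C[of x] show ?thesis by (simp add: field_simps)
    qed
    then show "\<exists>C. \<forall>x. norm (f x) \<le> C / jb x ^ N" by blast
  qed
qed

text \<open>The Schwartz class is the largest class of differentiable, rapidly decreasing functions that
  is stable under partial differentiation. To prove membership it is therefore enough to find some
  stable class that contains the function; derivatives of higher order never have to be computed.\<close>

lemma schwartz_coinduct:
  assumes "f \<in> S"
    and diff: "\<And>g. g \<in> S \<Longrightarrow> \<exists>g'. (\<forall>x. (g has_derivative g' x) (at x)) \<and> (\<forall>v\<in>Basis. (\<lambda>x. g' x v) \<in> S)"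
    and rapid: "\<And>g. g \<in> S \<Longrightarrow> rapid_decay g"
  shows "f \<in> schwartz"
proof -
  have iter: "iterated_deriv vs f \<in> S" if "vs \<in> lists Basis" for vs
    using that
  proof (induction vs)
    case (Cons v vs)
    then have "iterated_deriv vs f \<in> S" "v \<in> Basis" by auto
    from diff[OF this(1)] obtain g' where
      g': "\<And>x. (iterated_deriv vs f has_derivative g' x) (at x)" "(\<lambda>x. g' x v) \<in> S"
      using \<open>v \<in> Basis\<close> by blast
    have "frechet_derivative (iterated_deriv vs f) (at x) = g' x" for x
      using frechet_derivative_at[OF g'(1)] by simp
    with g'(2) show ?case by simp
  qed (use assms in simp)
  show ?thesis
    unfolding schwartz_def
  proof (intro CollectI ballI conjI)
    fix vs :: "'a list" assume "vs \<in> lists Basis"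
    then have "iterated_deriv vs f \<in> S" by (rule iter)
    with diff rapid show "\<forall>x. iterated_deriv vs f differentiable at x"
      and "\<forall>N. bounded (range (\<lambda>x. (1 + norm x) ^ N *\<^sub>R iterated_deriv vs f x))"
      by (meson differentiableI, simp add: rapid_decay_iff_bounded)
  qed
qed

lemma schwartz_has_derivative:
  assumes "f \<in> schwartz"
  shows "(f has_derivative frechet_derivative f (at x)) (at x)"
proof -
  have "iterated_deriv [] f differentiable at x"
    using assms unfolding schwartz_def by blast
  then show ?thesis by (simp add: frechet_derivative_works)
qed

lemma schwartz_rapid_decay: "f \<in> schwartz \<Longrightarrow> rapid_decay f"
proof -
  assume "f \<in> schwartz"
  then have "\<forall>N. bounded (range (\<lambda>x. (1 + norm x) ^ N *\<^sub>R iterated_deriv [] f x))"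
    unfolding schwartz_def by blast
  then show ?thesis by (simp add: rapid_decay_iff_bounded)
qed

text \<open>In a list of directions the last one is the first to be differentiated along, so
  differentiating first along \<open>v\<close> appends \<open>v\<close> to the list.\<close>

lemma schwartz_partial:
  assumes "f \<in> schwartz" "v \<in> Basis"
  shows "partial v f \<in> schwartz"
proof -
  have *: "iterated_deriv vs (partial v f) = iterated_deriv (vs @ [v]) f" for vs
    by (induction vs) auto
  show ?thesis
    unfolding schwartz_def
  proof (intro CollectI ballI)
    fix vs :: "'a list" assume "vs \<in> lists Basis"
    with assms(2) have "vs @ [v] \<in> lists Basis" by auto
    with assms(1) show "(\<forall>x. iterated_deriv vs (partial v f) differentiable at x) \<and>
       (\<forall>N. bounded (range (\<lambda>x. (1 + norm x) ^ N *\<^sub>R iterated_deriv vs (partial v f) x)))"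
      unfolding schwartz_def * by blast
  qed
qed

lemma rapid_decay_mult_poly:
  assumes f: "rapid_decay f" and g: "\<And>x. norm (g x) \<le> D * jb x ^ m"
  shows "rapid_decay (\<lambda>x. g x * f x)"
  unfolding rapid_decay_def
proof
  fix k
  obtain C where C: "0 < C" "\<And>x. norm (f x) \<le> C / jb x ^ (m + k)"
    using rapid_decayD[OF f] by metis
  have "norm (g x * f x) \<le> D * C / jb x ^ k" for x
  proof -
    have "0 \<le> D * jb x ^ m" using g[of x] by (meson norm_ge_zero order_trans)
    then have "norm (g x * f x) \<le> (D * jb x ^ m) * (C / jb x ^ (m + k))"
      unfolding norm_mult by (intro mult_mono g C) auto
    then show ?thesis by (simp add: power_add field_simps)
  qed
  then show "\<exists>C. \<forall>x. norm (g x * f x) \<le> C / jb x ^ k" by blast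
qed

lemma rapid_decay_add:
  assumes f: "rapid_decay f" and g: "rapid_decay g"
  shows "rapid_decay (\<lambda>x. f x + g x)"
  unfolding rapid_decay_def
proof
  fix k
  obtain C where C: "0 < C" "\<And>x. norm (f x) \<le> C / jb x ^ k"
    using rapid_decayD[OF f] by metis
  obtain D where D: "0 < D" "\<And>x. norm (g x) \<le> D / jb x ^ k"
    using rapid_decayD[OF g] by metis
  have "norm (f x + g x) \<le> (C + D) / jb x ^ k" for x
    using norm_triangle_ineq[of "f x" "g x"] C(2)[of x] D(2)[of x] by (simp add: add_divide_distrib)
  then show "\<exists>C. \<forall>x. norm (f x + g x) \<le> C / jb x ^ k" by blast
qed

lemma schwartz_bounded:
  assumes "f \<in> schwartz"
  obtains C where "0 < C" "\<And>x. norm (f x) \<le> C"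
  using rapid_decayD[OF schwartz_rapid_decay[OF assms], of 0] by auto

lemma schwartz_add:
  assumes "f \<in> schwartz" "g \<in> schwartz"
  shows "(\<lambda>x. f x + g x) \<in> schwartz"
proof (rule schwartz_coinduct[where S = "{(\<lambda>x. f x + g x) | f g. f \<in> schwartz \<and> g \<in> schwartz}"])
  let ?S = "{(\<lambda>x. f x + g x) | f g. f \<in> schwartz \<and> g \<in> schwartz}"
  fix h :: "'a \<Rightarrow> complex" assume "h \<in> ?S"
  then obtain f g where fg: "h = (\<lambda>x. f x + g x)" "f \<in> schwartz" "g \<in> schwartz" by blast
  then show "rapid_decay h"
    by (simp add: rapid_decay_add schwartz_rapid_decay)
  have "(h has_derivative (\<lambda>v. frechet_derivative f (at x) v + frechet_derivative g (at x) v)) (at x)" for x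
    unfolding fg(1) by (intro has_derivative_add schwartz_has_derivative fg)
  moreover have "(\<lambda>x. frechet_derivative f (at x) v + frechet_derivative g (at x) v)
      \<in> ?S" if "v \<in> Basis" for v
    by (intro CollectI exI[of _ "partial v f"] exI[of _ "partial v g"] conjI refl schwartz_partial fg that)
  ultimately show "\<exists>g'. (\<forall>x. (h has_derivative g' x) (at x)) \<and>
     (\<forall>v\<in>Basis. (\<lambda>x. g' x v) \<in> ?S)"
    by (intro exI[of _ "\<lambda>x v. frechet_derivative f (at x) v + frechet_derivative g (at x) v"]) auto
qed (use assms in blast)

text \<open>Finite sums of products of two Schwartz functions form the class to which the coinduction
  principle is applied, since the product rule leaves it invariant.\<close>

inductive_set schwartz_products :: "('a::euclidean_space \<Rightarrow> complex) set" where
  prod: "f \<in> schwartz \<Longrightarrow> g \<in> schwartz \<Longrightarrow> (\<lambda>x. f x * g x) \<in> schwartz_products"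
| add: "f \<in> schwartz_products \<Longrightarrow> g \<in> schwartz_products \<Longrightarrow> (\<lambda>x. f x + g x) \<in> schwartz_products"

lemma schwartz_mult:
  assumes "f \<in> schwartz" "g \<in> schwartz"
  shows "(\<lambda>x. f x * g x) \<in> schwartz"
proof (rule schwartz_coinduct[where S = schwartz_products])
  fix h :: "'a \<Rightarrow> complex" assume "h \<in> schwartz_products"
  then show "rapid_decay h"
  proof induction
    case (prod f g)
    obtain C where C: "\<And>x. norm (f x) \<le> C" using schwartz_bounded[OF prod(1)] by blast
    show ?case
      by (rule rapid_decay_mult_poly[OF schwartz_rapid_decay[OF prod(2)], of f C 0]) (simp add: C)
  qed (rule rapid_decay_add)
  from \<open>h \<in> schwartz_products\<close>
  show "\<exists>g'. (\<forall>x. (h has_derivative g' x) (at x)) \<and> (\<forall>v\<in>Basis. (\<lambda>x. g' x v) \<in> schwartz_products)"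
  proof induction
    case (prod f g)
    show ?case
    proof (intro exI conjI allI ballI)
      show "((\<lambda>x. f x * g x) has_derivative
         (\<lambda>v. f x * frechet_derivative g (at x) v + frechet_derivative f (at x) v * g x)) (at x)" for x
        by (intro has_derivative_mult schwartz_has_derivative prod)
      show "(\<lambda>x. f x * frechet_derivative g (at x) v + frechet_derivative f (at x) v * g x) \<in> schwartz_products"
        if "v \<in> Basis" for v
        by (intro schwartz_products.intros prod schwartz_partial that)
    qed
  next
    case (add f g)
    then obtain f' g' where "\<forall>x. (f has_derivative f' x) (at x)" "\<forall>v\<in>Basis. (\<lambda>x. f' x v) \<in> schwartz_products"
      "\<forall>x. (g has_derivative g' x) (at x)" "\<forall>v\<in>Basis. (\<lambda>x. g' x v) \<in> schwartz_products" by blast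
    then show ?case
      by (intro exI[of _ "\<lambda>x v. f' x v + g' x v"])
        (auto intro!: has_derivative_add schwartz_products.add)
  qed
qed (intro schwartz_products.prod assms)

lemma schwartz_bounded_linear:
  fixes L :: "complex \<Rightarrow> complex"
  assumes f: "f \<in> schwartz" and L: "bounded_linear L"
  shows "(\<lambda>x. L (f x)) \<in> schwartz"
proof (rule schwartz_coinduct[where S = "{(\<lambda>x. L (f x)) | f. f \<in> schwartz}"])
  let ?S = "{(\<lambda>x. L (f x)) | f. f \<in> schwartz}"
  fix h :: "'a \<Rightarrow> complex" assume "h \<in> ?S"
  then obtain f where f: "h = (\<lambda>x. L (f x))" "f \<in> schwartz" by blast
  show "rapid_decay h"
    unfolding rapid_decay_def
  proof
    fix k
    obtain C where C: "0 < C" "\<And>x. norm (f x) \<le> C / jb x ^ k"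
      using rapid_decayD[OF schwartz_rapid_decay[OF f(2)]] by blast
    obtain K where K: "0 \<le> K" "\<And>y. norm (L y) \<le> norm y * K"
      using bounded_linear.nonneg_bounded[OF L] by metis
    have "norm (h x) \<le> C * K / jb x ^ k" for x
      using order_trans[OF K(2) mult_right_mono[OF C(2) K(1)]] by (simp add: f)
    then show "\<exists>C. \<forall>x. norm (h x) \<le> C / jb x ^ k" by blast
  qed
  show "\<exists>g'. (\<forall>x. (h has_derivative g' x) (at x)) \<and> (\<forall>v\<in>Basis. (\<lambda>x. g' x v) \<in> ?S)"
  proof (intro exI conjI allI ballI)
    show "(h has_derivative (\<lambda>v. L (frechet_derivative f (at x) v))) (at x)" for x
      unfolding f(1) by (intro bounded_linear.has_derivative[OF L] schwartz_has_derivative f)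
    show "(\<lambda>x. L (frechet_derivative f (at x) v)) \<in> ?S"
      if "v \<in> Basis" for v
      by (intro CollectI exI[of _ "partial v f"] conjI refl schwartz_partial f(2) that)
  qed
qed (use assms in blast)

lemma schwartz_cnj: "f \<in> schwartz \<Longrightarrow> (\<lambda>x. cnj (f x)) \<in> schwartz"
  by (rule schwartz_bounded_linear[OF _ bounded_linear_cnj])

lemma schwartz_cmult: "f \<in> schwartz \<Longrightarrow> (\<lambda>x. c * f x) \<in> schwartz"
  by (rule schwartz_bounded_linear[OF _ bounded_linear_mult_right])

lemma schwartz_translate:
  assumes "f \<in> schwartz"
  shows "(\<lambda>x. f (x - a)) \<in> schwartz"
proof (rule schwartz_coinduct[where S = "{(\<lambda>x. f (x - a)) | f. f \<in> schwartz}"])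
  let ?S = "{(\<lambda>x. f (x - a)) | f. f \<in> schwartz}"
  fix h :: "'a \<Rightarrow> complex" assume "h \<in> ?S"
  then obtain f where f: "h = (\<lambda>x. f (x - a))" "f \<in> schwartz" by blast
  show "rapid_decay h"
    unfolding rapid_decay_def
  proof
    fix k
    obtain C where C: "0 < C" "\<And>x. norm (f x) \<le> C / jb x ^ k"
      using rapid_decayD[OF schwartz_rapid_decay[OF f(2)]] by metis
    have "norm (h x) \<le> C * (2 * jb a) ^ k / jb x ^ k" for x
    proof -
      have "jb x ^ k \<le> (2 * jb (x - a) * jb a) ^ k" using jb_add[of "x - a" a] by (intro power_mono) auto
      then have "C / jb (x - a) ^ k \<le> C * (2 * jb a) ^ k / jb x ^ k"
        using C by (simp add: field_simps power_mult_distrib)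
      with C(2)[of "x - a"] show ?thesis by (simp add: f)
    qed
    then show "\<exists>C. \<forall>x. norm (h x) \<le> C / jb x ^ k" by blast
  qed
  show "\<exists>g'. (\<forall>x. (h has_derivative g' x) (at x)) \<and> (\<forall>v\<in>Basis. (\<lambda>x. g' x v) \<in> ?S)"
  proof (intro exI conjI allI ballI)
    show "(h has_derivative (\<lambda>v. frechet_derivative f (at (x - a)) v)) (at x)" for x
    proof -
      have "((\<lambda>x. x - a) has_derivative (\<lambda>v. v)) (at x)" by (auto intro!: derivative_eq_intros)
      from has_derivative_compose[OF this schwartz_has_derivative[OF f(2)]] show ?thesis
        by (simp add: f(1))
    qed
    show "(\<lambda>x. frechet_derivative f (at (x - a)) v) \<in> ?S"
      if "v \<in> Basis" for v
      by (intro CollectI exI[of _ "partial v f"] conjI refl schwartz_partial f(2) that)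
  qed
qed (use assms in blast)

lemma has_derivative_cexp:
  fixes g :: "'a::real_normed_vector \<Rightarrow> complex"
  assumes "(g has_derivative g') (at x)"
  shows "((\<lambda>x. exp (g x)) has_derivative (\<lambda>v. exp (g x) * g' v)) (at x)"
  using has_derivative_compose[OF assms, of exp "(*) (exp (g x))"] DERIV_exp[of "g x"]
  by (simp add: has_field_derivative_def)

lemma character_mult_has_derivative:
  assumes "f \<in> schwartz"
  shows "((\<lambda>x. iexp (a \<bullet> x) * f x) has_derivative
     (\<lambda>v. iexp (a \<bullet> x) * (\<i> * complex_of_real (a \<bullet> v) * f x + frechet_derivative f (at x) v))) (at x)"
proof -
  have "((\<lambda>x. \<i> * complex_of_real (a \<bullet> x)) has_derivative (\<lambda>v. \<i> * complex_of_real (a \<bullet> v))) (at x)"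
    by (auto intro!: derivative_eq_intros)
  from has_derivative_mult[OF has_derivative_cexp[OF this] schwartz_has_derivative[OF assms]]
  show ?thesis by (simp add: algebra_simps)
qed

lemma schwartz_character_mult:
  assumes "f \<in> schwartz"
  shows "(\<lambda>x. iexp (a \<bullet> x) * f x) \<in> schwartz"
proof (rule schwartz_coinduct[where S = "{(\<lambda>x. iexp (a \<bullet> x) * f x) | f. f \<in> schwartz}"])
  let ?S = "{(\<lambda>x. iexp (a \<bullet> x) * f x) | f. f \<in> schwartz}"
  fix h :: "'a \<Rightarrow> complex" assume "h \<in> ?S"
  then obtain f where f: "h = (\<lambda>x. iexp (a \<bullet> x) * f x)" "f \<in> schwartz" by blast
  show "rapid_decay h"
    unfolding f(1) by (rule rapid_decay_mult_poly[OF schwartz_rapid_decay[OF f(2)], of _ 1 0]) simp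
  show "\<exists>g'. (\<forall>x. (h has_derivative g' x) (at x)) \<and> (\<forall>v\<in>Basis. (\<lambda>x. g' x v) \<in> ?S)"
  proof (intro exI conjI allI ballI)
    show "(h has_derivative (\<lambda>v. iexp (a \<bullet> x) * (\<i> * complex_of_real (a \<bullet> v) * f x + frechet_derivative f (at x) v))) (at x)" for x
      unfolding f(1) by (rule character_mult_has_derivative[OF f(2)])
    show "(\<lambda>x. iexp (a \<bullet> x) * (\<i> * complex_of_real (a \<bullet> v) * f x + frechet_derivative f (at x) v))
        \<in> ?S" if "v \<in> Basis" for v
      by (intro CollectI exI[of _ "\<lambda>x. \<i> * complex_of_real (a \<bullet> v) * f x + frechet_derivative f (at x) v"]
          conjI refl schwartz_add schwartz_cmult schwartz_partial f(2) that)
  qed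
qed (use assms in blast)

lemma abs_inner_le_jb: "norm v \<le> 1 \<Longrightarrow> \<bar>x \<bullet> v\<bar> \<le> jb x"
proof -
  assume "norm v \<le> 1"
  then have "norm x * norm v \<le> norm x * 1" by (intro mult_left_mono) auto
  with Cauchy_Schwarz_ineq2[of x v] norm_le_jb[of x] show ?thesis by linarith
qed

lemma schwartz_coordinate_mult:
  assumes "f \<in> schwartz" "b \<in> Basis"
  shows "(\<lambda>x. complex_of_real (x \<bullet> b) * f x) \<in> schwartz"
proof -
  let ?S = "{(\<lambda>x. complex_of_real (x \<bullet> b) * f x + g x) | f g. f \<in> schwartz \<and> g \<in> schwartz}"
  have zero: "(\<lambda>x::'a. 0) \<in> schwartz" using schwartz_cmult[OF assms(1), of 0] by simp
  show ?thesis
  proof (rule schwartz_coinduct[where S = ?S])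
    fix h :: "'a \<Rightarrow> complex" assume "h \<in> ?S"
    then obtain f g where fg: "h = (\<lambda>x. complex_of_real (x \<bullet> b) * f x + g x)" "f \<in> schwartz" "g \<in> schwartz" by blast
    show "rapid_decay h"
      unfolding fg(1) using assms(2)
      by (intro rapid_decay_add rapid_decay_mult_poly[of _ _ 1 1] schwartz_rapid_decay fg)
         (auto intro!: abs_inner_le_jb)
    show "\<exists>g'. (\<forall>x. (h has_derivative g' x) (at x)) \<and> (\<forall>v\<in>Basis. (\<lambda>x. g' x v) \<in> ?S)"
    proof (intro exI conjI allI ballI)
      show "(h has_derivative (\<lambda>v. complex_of_real (x \<bullet> b) * frechet_derivative f (at x) v
          + (complex_of_real (v \<bullet> b) * f x + frechet_derivative g (at x) v))) (at x)" for x
      proof -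
        have "((\<lambda>x. complex_of_real (x \<bullet> b)) has_derivative (\<lambda>v. complex_of_real (v \<bullet> b))) (at x)"
          by (auto intro!: derivative_eq_intros)
        from has_derivative_add[OF has_derivative_mult[OF this schwartz_has_derivative[OF fg(2)]] schwartz_has_derivative[OF fg(3)]]
        show ?thesis by (simp add: fg(1) algebra_simps)
      qed
      show "(\<lambda>x. complex_of_real (x \<bullet> b) * frechet_derivative f (at x) v
          + (complex_of_real (v \<bullet> b) * f x + frechet_derivative g (at x) v)) \<in> ?S"
        if "v \<in> Basis" for v
        by (intro CollectI exI[of _ "partial v f"]
            exI[of _ "\<lambda>x. complex_of_real (v \<bullet> b) * f x + frechet_derivative g (at x) v"]
            conjI refl schwartz_add schwartz_cmult schwartz_partial fg that)
    qed
  next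
    show "(\<lambda>x. complex_of_real (x \<bullet> b) * f x) \<in> ?S"
      by (rule CollectI, rule exI[of _ f], rule exI[of _ "\<lambda>_. 0"]) (use assms zero in simp)
  qed
qed

text \<open>Polynomials times a fixed Gaussian, generated in the form in which the product rule
  produces them.\<close>

inductive_set poly_gaussians :: "real \<Rightarrow> ('a::euclidean_space \<Rightarrow> complex) set" for c where
  gauss: "(\<lambda>x. complex_of_real (exp (- (c * (norm x)\<^sup>2)))) \<in> poly_gaussians c"
| cmult: "f \<in> poly_gaussians c \<Longrightarrow> (\<lambda>x. r * f x) \<in> poly_gaussians c"
| add: "f \<in> poly_gaussians c \<Longrightarrow> g \<in> poly_gaussians c \<Longrightarrow> (\<lambda>x. f x + g x) \<in> poly_gaussians c"
| coord: "f \<in> poly_gaussians c \<Longrightarrow> b \<in> Basis \<Longrightarrow> (\<lambda>x. complex_of_real (x \<bullet> b) * f x) \<in> poly_gaussians c"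

text \<open>A single term of the exponential series suffices: \<open>y\<^sup>k \<le> k! e\<^sup>y\<close>, applied to
  \<open>c (1 + |x|\<^sup>2)\<close>.\<close>

lemma gaussian_rapid_decay:
  assumes "0 < c"
  shows "rapid_decay (\<lambda>x. complex_of_real (exp (- (c * (norm x)\<^sup>2))))"
  unfolding rapid_decay_def
proof
  fix k
  define C where "C = exp c * (fact k / c ^ k)"
  have "norm (complex_of_real (exp (- (c * (norm x)\<^sup>2)))) \<le> C / jb x ^ k" for x :: 'a
  proof -
    define y where "y = (jb x)\<^sup>2"
    have y: "1 \<le> y" "0 \<le> c * y" using jb_ge_1[of x] assms by (auto simp: y_def)
    have "(c * y) ^ k / fact k \<le> exp (c * y)"
    proof -
      have "(\<Sum>n\<in>{k}. (c * y) ^ n /\<^sub>R fact n) \<le> exp (c * y)"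
        unfolding exp_def using y(2) by (intro sum_le_suminf summable_exp_generic) auto
      then show ?thesis by (simp add: field_simps)
    qed
    then have "y ^ k * exp (- (c * y)) \<le> fact k / c ^ k"
      using assms by (simp add: exp_minus field_simps power_mult_distrib)
    moreover have "jb x ^ k \<le> y ^ k"
      unfolding y_def power2_eq_square using jb_ge_1[of x] by (intro power_mono) auto
    ultimately have "jb x ^ k * exp (- (c * y)) \<le> fact k / c ^ k"
      by (meson exp_ge_zero mult_right_mono order_trans)
    moreover have "exp (- (c * (norm x)\<^sup>2)) = exp c * exp (- (c * y))"
      by (simp add: y_def jb_sq exp_add[symmetric] algebra_simps)
    ultimately have "jb x ^ k * exp (- (c * (norm x)\<^sup>2)) \<le> C"
      using mult_left_mono[of "jb x ^ k * exp (- (c * y))" "fact k / c ^ k" "exp c"]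
      unfolding C_def by (simp add: mult.left_commute[of "jb x ^ k"])
    then show ?thesis by (simp add: field_simps)
  qed
  then show "\<exists>C. \<forall>x. norm (complex_of_real (exp (- (c * (norm (x::'a))\<^sup>2)))) \<le> C / jb x ^ k" by blast
qed

lemma schwartz_gaussian:
  assumes "0 < c"
  shows "(\<lambda>x. complex_of_real (exp (- (c * (norm x)\<^sup>2)))) \<in> schwartz"
proof (rule schwartz_coinduct[where S = "poly_gaussians c"])
  fix h :: "'a \<Rightarrow> complex" assume "h \<in> poly_gaussians c"
  then show "rapid_decay h"
  proof induction
    case gauss
    then show ?case by (rule gaussian_rapid_decay[OF assms])
  next
    case (cmult f r)
    then show ?case by (intro rapid_decay_mult_poly[of _ _ "norm r" 0]) auto
  next
    case (coord f b)
    then show ?case by (intro rapid_decay_mult_poly[of _ _ 1 1]) (auto intro!: abs_inner_le_jb)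
  qed (rule rapid_decay_add)
  from \<open>h \<in> poly_gaussians c\<close>
  show "\<exists>g'. (\<forall>x. (h has_derivative g' x) (at x)) \<and> (\<forall>v\<in>Basis. (\<lambda>x. g' x v) \<in> poly_gaussians c)"
  proof induction
    case gauss
    let ?g = "\<lambda>x::'a. complex_of_real (exp (- (c * (norm x)\<^sup>2)))"
    show ?case
    proof (intro exI conjI allI ballI)
      show "(?g has_derivative (\<lambda>v. complex_of_real (- 2 * c) * (complex_of_real (x \<bullet> v) * ?g x))) (at x)" for x
        unfolding power2_norm_eq_inner
        by (auto intro!: derivative_eq_intros simp: inner_commute algebra_simps)
      show "(\<lambda>x. complex_of_real (- 2 * c) * (complex_of_real (x \<bullet> v) * ?g x)) \<in> poly_gaussians c"
        if "v \<in> Basis" for v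
        by (intro poly_gaussians.intros that)
    qed
  next
    case (cmult f r)
    then obtain f' where "\<forall>x. (f has_derivative f' x) (at x)" "\<forall>v\<in>Basis. (\<lambda>x. f' x v) \<in> poly_gaussians c" by blast
    then show ?case
      by (intro exI[of _ "\<lambda>x v. r * f' x v"]) (auto intro!: derivative_eq_intros poly_gaussians.intros)
  next
    case (add f g)
    then obtain f' g' where "\<forall>x. (f has_derivative f' x) (at x)" "\<forall>v\<in>Basis. (\<lambda>x. f' x v) \<in> poly_gaussians c"
      "\<forall>x. (g has_derivative g' x) (at x)" "\<forall>v\<in>Basis. (\<lambda>x. g' x v) \<in> poly_gaussians c" by blast
    then show ?case
      by (intro exI[of _ "\<lambda>x v. f' x v + g' x v"]) (auto intro!: derivative_eq_intros poly_gaussians.intros)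
  next
    case (coord f b)
    then obtain f' where f': "\<And>x. (f has_derivative f' x) (at x)" "\<forall>v\<in>Basis. (\<lambda>x. f' x v) \<in> poly_gaussians c" by blast
    show ?case
    proof (intro exI conjI allI ballI)
      show "((\<lambda>x. complex_of_real (x \<bullet> b) * f x) has_derivative
        (\<lambda>v. complex_of_real (x \<bullet> b) * f' x v + complex_of_real (v \<bullet> b) * f x)) (at x)" for x
        by (intro has_derivative_mult f'(1)) (auto intro!: derivative_eq_intros)
      show "(\<lambda>x. complex_of_real (x \<bullet> b) * f' x v + complex_of_real (v \<bullet> b) * f x) \<in> poly_gaussians c"
        if "v \<in> Basis" for v
        using coord f'(2) that by (intro poly_gaussians.intros) auto
    qed
  qed
qed (rule poly_gaussians.gauss)

lemma schwartz_continuous: "f \<in> schwartz \<Longrightarrow> continuous_on UNIV f"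
  by (meson has_derivative_continuous_on has_derivative_at_withinI schwartz_has_derivative)

lemma schwartz_measurable: "f \<in> schwartz \<Longrightarrow> f \<in> borel_measurable borel"
  by (intro borel_measurable_continuous_onI schwartz_continuous)

lemma rapid_decay_integrable:
  assumes "rapid_decay f" "f \<in> borel_measurable borel"
  shows "integrable lborel f"
proof -
  obtain C where "\<And>x. norm (f x) \<le> C / jb x ^ (2 * DIM('a))" using rapid_decayD[OF assms(1)] by metis
  with assms(2) show ?thesis by (rule integrable_jb_decay)
qed

lemma schwartz_integrable: "f \<in> schwartz \<Longrightarrow> integrable lborel f"
  by (intro rapid_decay_integrable schwartz_rapid_decay schwartz_measurable)


section \<open>The Fourier transform on Schwartz functions\<close>

abbreviation fourier_factor :: "nat \<Rightarrow> real" where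
  "fourier_factor d \<equiv> (2 * pi) powr (- real d / 2)"

abbreviation character :: "real \<Rightarrow> complex" where
  "character r \<equiv> exp (- (\<i> * complex_of_real r))"

lemma norm_character [simp]: "norm (character r) = 1"
  by simp

lemma character_measurable [measurable]:
  "(\<lambda>x. character (x \<bullet> \<xi>)) \<in> borel_measurable borel"
  by (intro borel_measurable_continuous_onI continuous_intros)

lemma integrable_character_mult:
  fixes f :: "'a::euclidean_space \<Rightarrow> complex"
  assumes "integrable lborel f"
  shows "integrable lborel (\<lambda>x. f x * character (x \<bullet> \<xi>))"
proof (rule Bochner_Integration.integrable_bound[OF assms])
  have [measurable]: "f \<in> borel_measurable borel" using assms by auto
  show "(\<lambda>x. f x * character (x \<bullet> \<xi>)) \<in> borel_measurable lborel"
    by measurable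
qed (simp add: norm_mult)

lemma norm_fourier_le:
  fixes f :: "'a::euclidean_space \<Rightarrow> complex"
  shows "norm (fourier f \<xi>) \<le> fourier_factor DIM('a) * (LINT x|lborel. norm (f x))"
proof -
  have "norm (LINT x|lborel. f x * exp (- \<i> * complex_of_real (x \<bullet> \<xi>))) \<le> (LINT x|lborel. norm (f x))"
    using integral_norm_bound[of lborel "\<lambda>x. f x * exp (- \<i> * complex_of_real (x \<bullet> \<xi>))"]
    by (simp add: norm_mult)
  then show ?thesis unfolding fourier_def by (simp add: mult_left_mono)
qed

lemma fourier_cmult: "fourier (\<lambda>x. c * f x) \<xi> = c * fourier f \<xi>"
  by (simp add: fourier_def mult.assoc)

lemma fourier_add:
  assumes "integrable lborel f" "integrable lborel g"
  shows "fourier (\<lambda>x. f x + g x) \<xi> = fourier f \<xi> + fourier g \<xi>"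
  using integrable_character_mult[OF assms(1), of \<xi>] integrable_character_mult[OF assms(2), of \<xi>]
  by (simp add: fourier_def distrib_right scaleR_add_right)

lemma character_second_order:
  "norm (character t - 1 + \<i> * complex_of_real t) \<le> t\<^sup>2"
proof -
  have "cmod (iexp (- t) - (\<Sum>k \<le> 1. (\<i> * complex_of_real (- t))^k / fact k)) \<le> \<bar>- t\<bar>^(Suc 1) / fact (Suc 1)"
    by (rule iexp_approx1)
  then have "2 * norm (character t - 1 + \<i> * complex_of_real t) \<le> t\<^sup>2"
    by (simp add: algebra_simps power2_eq_square)
  then show ?thesis using norm_ge_zero[of "character t - 1 + \<i> * complex_of_real t"]
    by linarith
qed

lemma rapid_decay_mult_integrable:
  fixes f g :: "'a::euclidean_space \<Rightarrow> complex"
  assumes "rapid_decay f" "f \<in> borel_measurable borel" "g \<in> borel_measurable borel"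
    and "\<And>x. norm (g x) \<le> D * jb x ^ m"
  shows "integrable lborel (\<lambda>x. g x * f x)"
  using assms by (intro rapid_decay_integrable rapid_decay_mult_poly[of f g D m]) auto

lemma norm_fourier_mult_le:
  fixes f :: "'a::euclidean_space \<Rightarrow> complex"
  assumes f: "rapid_decay f" and [measurable]: "f \<in> borel_measurable borel"
  obtains K where "\<And>(g :: 'a \<Rightarrow> complex) D \<xi>. g \<in> borel_measurable borel \<Longrightarrow> (\<And>x. norm (g x) \<le> D * jb x ^ 2) \<Longrightarrow>
    norm (fourier (\<lambda>x. g x * f x) \<xi>) \<le> D * K"
proof (rule that)
  fix g :: "'a \<Rightarrow> complex" and D \<xi> assume g: "g \<in> borel_measurable borel" and le: "\<And>x. norm (g x) \<le> D * jb x ^ 2"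
  have "integrable lborel (\<lambda>x. complex_of_real (jb x ^ 2) * f x)"
    by (rule rapid_decay_mult_integrable[OF f, of _ 1 2]) (auto simp: norm_power)
  from integrable_norm[OF this] have int: "integrable lborel (\<lambda>x. jb x ^ 2 * norm (f x))"
    by (simp add: norm_mult norm_power)
  have "(LINT x|lborel. norm (g x * f x)) \<le> (LINT x|lborel. D * (jb x ^ 2 * norm (f x)))"
  proof (rule integral_mono)
    show "integrable lborel (\<lambda>x. norm (g x * f x))"
      using rapid_decay_mult_integrable[OF f _ g le] by simp
    show "norm (g x * f x) \<le> D * (jb x ^ 2 * norm (f x))" for x
      using mult_right_mono[OF le[of x], of "norm (f x)"] by (simp add: norm_mult)
  qed (intro integrable_mult_right int)
  then have "(LINT x|lborel. norm (g x * f x)) \<le> D * (LINT x|lborel. jb x ^ 2 * norm (f x))"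
    by (simp only: integral_mult_right_zero)
  from order_trans[OF norm_fourier_le mult_left_mono[OF this powr_ge_zero]]
  show "norm (fourier (\<lambda>x. g x * f x) \<xi>)
      \<le> D * (fourier_factor DIM('a) * (LINT x|lborel. jb x ^ 2 * norm (f x)))"
    by (simp only: mult.left_commute[of D])
qed

text \<open>Differentiation under the integral sign. The second-order Taylor remainder of the character
  bounds the error by \<open>|h|\<^sup>2\<close> times the second moment of \<open>f\<close>.\<close>

lemma fourier_has_derivative:
  fixes f :: "'a::euclidean_space \<Rightarrow> complex"
  assumes f: "rapid_decay f" and [measurable]: "f \<in> borel_measurable borel"
  shows "(fourier f has_derivative (\<lambda>h. fourier (\<lambda>x. - \<i> * complex_of_real (x \<bullet> h) * f x) \<xi>)) (at \<xi>)"
proof -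
  let ?g = "\<lambda>h x. - \<i> * complex_of_real (x \<bullet> h)"
  let ?q = "\<lambda>h x. character (x \<bullet> h) - 1 + \<i> * complex_of_real (x \<bullet> h)"
  let ?D = "\<lambda>h. fourier (\<lambda>x. ?g h x * f x) \<xi>"
  obtain K where K: "\<And>(g :: 'a \<Rightarrow> complex) D \<xi>. g \<in> borel_measurable borel \<Longrightarrow> (\<And>x. norm (g x) \<le> D * jb x ^ 2) \<Longrightarrow>
    norm (fourier (\<lambda>x. g x * f x) \<xi>) \<le> D * K"
    using norm_fourier_mult_le[OF assms] by blast
  have g_le: "norm (?g h x) \<le> norm h * jb x ^ 2" for h x
  proof -
    have "\<bar>x \<bullet> h\<bar> \<le> norm h * norm x" using Cauchy_Schwarz_ineq2[of x h] by (simp add: mult.commute)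
    also have "\<dots> \<le> norm h * jb x" by (intro mult_left_mono norm_le_jb) auto
    also have "\<dots> \<le> norm h * jb x ^ 2"
      using jb_ge_1[of x] by (intro mult_left_mono) (auto simp: power2_eq_square)
    finally show ?thesis by (simp add: norm_mult)
  qed
  have q_le: "norm (?q h x) \<le> (norm h)\<^sup>2 * jb x ^ 2" for h x
  proof -
    have "norm (?q h x) \<le> (x \<bullet> h)\<^sup>2" by (rule character_second_order)
    also have "\<dots> \<le> (norm x * norm h)\<^sup>2"
      using Cauchy_Schwarz_ineq2[of x h] by (simp add: abs_le_square_iff[symmetric] abs_mult)
    also have "\<dots> \<le> (jb x * norm h)\<^sup>2" by (intro power_mono mult_right_mono norm_le_jb) auto
    finally show ?thesis by (simp add: power_mult_distrib mult.commute)
  qed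
  have g_meas: "?g h \<in> borel_measurable borel" and q_meas: "?q h \<in> borel_measurable borel" for h
    by (intro borel_measurable_continuous_onI continuous_intros)+
  have f_int: "integrable lborel f" using assms by (rule rapid_decay_integrable)
  have g_int: "integrable lborel (\<lambda>x. ?g h x * f x)" for h
    by (rule rapid_decay_mult_integrable[OF assms g_meas g_le])
  have q_int: "integrable lborel (\<lambda>x. ?q h x * f x)" for h
    by (rule rapid_decay_mult_integrable[OF assms q_meas q_le])
  have "bounded_linear ?D"
  proof (rule bounded_linear_intro)
    show "?D (h + k) = ?D h + ?D k" for h k
      unfolding fourier_add[OF g_int g_int, symmetric] by (simp add: inner_add_right algebra_simps)
    show "?D (r *\<^sub>R h) = r *\<^sub>R ?D h" for r h
      unfolding scaleR_conv_of_real fourier_cmult[symmetric] by (simp add: mult_ac)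
    show "norm (?D h) \<le> norm h * K" for h by (rule K[OF g_meas g_le])
  qed
  moreover have "((\<lambda>h. norm (fourier f (\<xi> + h) - fourier f \<xi> - ?D h) / norm h) \<longlongrightarrow> 0) (at 0)"
  proof (rule Lim_null_comparison)
    have bound: "norm (fourier f (\<xi> + h) - fourier f \<xi> - ?D h) \<le> (norm h)\<^sup>2 * K" for h
    proof -
      have "fourier f (\<xi> + h) = fourier (\<lambda>x. character (x \<bullet> h) * f x) \<xi>"
        by (simp add: fourier_def inner_add_right exp_diff exp_minus field_simps)
      also have "(\<lambda>x. character (x \<bullet> h) * f x) = (\<lambda>x. f x + (?g h x * f x + ?q h x * f x))"
        by (simp add: fun_eq_iff algebra_simps)
      also have "fourier \<dots> \<xi> = fourier f \<xi> + (?D h + fourier (\<lambda>x. ?q h x * f x) \<xi>)"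
        by (subst fourier_add[OF f_int Bochner_Integration.integrable_add[OF g_int q_int]],
            subst fourier_add[OF g_int q_int]) (rule refl)
      finally show ?thesis using K[OF q_meas q_le, of h \<xi>] by simp
    qed
    show "eventually (\<lambda>h. norm (norm (fourier f (\<xi> + h) - fourier f \<xi> - ?D h) / norm h) \<le> norm h * K) (at 0)"
    proof (rule always_eventually, rule allI)
      fix h
      show "norm (norm (fourier f (\<xi> + h) - fourier f \<xi> - ?D h) / norm h) \<le> norm h * K"
        using bound[of h] by (cases "h = 0") (auto simp: field_simps power2_eq_square)
    qed
    show "((\<lambda>h. norm h * K) \<longlongrightarrow> 0) (at (0::'a))"
      by (auto intro!: tendsto_eq_intros)
  qed
  ultimately show ?thesis unfolding has_derivative_at by blast
qed

lemma jb_unit_shift: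
  assumes "norm v \<le> 1"
  shows "jb x \<le> 4 * jb (x + v)"
proof -
  have "jb (- v) \<le> 2" using jb_le[of "- v"] assms by simp
  then have "2 * jb (x + v) * jb (- v) \<le> 2 * jb (x + v) * 2" by (intro mult_left_mono) auto
  moreover have "jb x \<le> 2 * jb (x + v) * jb (- v)" using jb_add[of "x + v" "- v"] by simp
  ultimately show ?thesis by linarith
qed

lemma has_vector_derivative_quotient:
  assumes "(f has_vector_derivative D) (at 0)"
  shows "((\<lambda>h. (f h - f 0) /\<^sub>R h) \<longlongrightarrow> D) (at 0)"
proof -
  have "((\<lambda>h. norm (f (0 + h) - f 0 - h *\<^sub>R D) / norm h) \<longlongrightarrow> 0) (at 0)"
    using assms unfolding has_vector_derivative_def has_derivative_at by blast
  then have "((\<lambda>h. norm ((f h - f 0) /\<^sub>R h - D)) \<longlongrightarrow> 0) (at 0)"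
  proof (rule Lim_transform_eventually)
    show "\<forall>\<^sub>F h in at 0. norm (f (0 + h) - f 0 - h *\<^sub>R D) / norm h = norm ((f h - f 0) /\<^sub>R h - D)"
      unfolding eventually_at_filter
    proof (intro always_eventually allI impI)
      fix h :: real assume h: "h \<noteq> 0"
      then have "(f h - f 0) /\<^sub>R h - D = (f h - f 0 - h *\<^sub>R D) /\<^sub>R h" by (simp add: scaleR_diff_right)
      then show "norm (f (0 + h) - f 0 - h *\<^sub>R D) / norm h = norm ((f h - f 0) /\<^sub>R h - D)"
        by (simp add: divide_inverse)
    qed
  qed
  then show ?thesis by (subst Lim_null) (simp add: tendsto_norm_zero_iff)
qed

text \<open>By translation invariance of Lebesgue measure the difference quotients of \<open>f\<close> along \<open>b\<close> have
  integral \<open>0\<close>, and dominated convergence passes to the derivative. The mean value inequality on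
  segments of length at most \<open>1\<close> gives the dominating function.\<close>

lemma integral_partial_eq_0:
  fixes f :: "'a::euclidean_space \<Rightarrow> complex"
  assumes f: "f \<in> schwartz" and b: "b \<in> Basis"
  shows "(LINT x|lborel. partial b f x) = 0"
proof -
  define \<epsilon> where "\<epsilon> n = 1 / real (Suc n)" for n
  have eps: "0 < \<epsilon> n" "\<epsilon> n \<le> 1" for n by (auto simp: \<epsilon>_def)
  have "(\<lambda>n. inverse (real (Suc n))) \<longlonglongrightarrow> 0" by (rule LIMSEQ_inverse_real_of_nat)
  then have "\<epsilon> \<longlonglongrightarrow> 0" by (simp add: \<epsilon>_def[abs_def] inverse_eq_divide)
  then have epsat: "filterlim \<epsilon> (at 0) sequentially"
    using eps by (auto simp: filterlim_at less_imp_neq[THEN not_sym])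
  note [measurable] = schwartz_measurable[OF f] schwartz_measurable[OF schwartz_partial[OF f b]]
  define g where "g n x = (f (\<epsilon> n *\<^sub>R b + x) - f x) /\<^sub>R \<epsilon> n" for n x
  obtain C where C: "0 < C" "\<And>x. norm (partial b f x) \<le> C / jb x ^ (2 * DIM('a))"
    using rapid_decayD[OF schwartz_rapid_decay[OF schwartz_partial[OF f b]]] by metis
  define w where "w x = (C * 4 ^ (2 * DIM('a))) * (1 / jb x ^ (2 * DIM('a)))" for x :: 'a
  have line: "((\<lambda>t. f (t *\<^sub>R b + x)) has_vector_derivative partial b f (t *\<^sub>R b + x)) (at t)" for x t
  proof -
    have "((\<lambda>t. t *\<^sub>R b + x) has_derivative (\<lambda>h. h *\<^sub>R b)) (at t)" by (auto intro!: derivative_eq_intros)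
    from has_derivative_compose[OF this schwartz_has_derivative[OF f]]
    show ?thesis
      unfolding has_vector_derivative_def
      by (simp add: linear_cmul[OF has_derivative_linear[OF schwartz_has_derivative[OF f]]])
  qed
  have g_le: "norm (g n x) \<le> w x" for x n
  proof -
    have "norm (f (\<epsilon> n *\<^sub>R b + x) - f (0 *\<^sub>R b + x)) \<le> w x * norm (\<epsilon> n - 0)"
    proof (rule differentiable_bound[of "{0..1}"])
      fix t :: real assume t: "t \<in> {0..1}"
      show "((\<lambda>t. f (t *\<^sub>R b + x)) has_derivative (\<lambda>h. h *\<^sub>R partial b f (t *\<^sub>R b + x))) (at t within {0..1})"
        using line[of x t] by (auto simp: has_vector_derivative_def intro: has_derivative_at_withinI)
      have "jb x \<le> 4 * jb (x + t *\<^sub>R b)" using t b by (intro jb_unit_shift) auto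
      then have "jb x ^ (2 * DIM('a)) \<le> (4 * jb (t *\<^sub>R b + x)) ^ (2 * DIM('a))"
        by (intro power_mono) (auto simp: add.commute)
      then have "C / jb (t *\<^sub>R b + x) ^ (2 * DIM('a)) \<le> w x"
        using C(1) by (simp add: w_def field_simps power_mult_distrib)
      with C(2)[of "t *\<^sub>R b + x"] have "norm (partial b f (t *\<^sub>R b + x)) \<le> w x" by linarith
      then show "onorm (\<lambda>h. h *\<^sub>R partial b f (t *\<^sub>R b + x)) \<le> w x"
        by (intro onorm_le) (simp add: mult.commute mult_left_mono)
    qed (use eps[of n] in auto)
    then show ?thesis using eps[of n] by (simp add: g_def pos_divide_le_eq flip: divide_inverse_commute)
  qed
  have "(\<lambda>n. LINT x|lborel. g n x) \<longlonglongrightarrow> (LINT x|lborel. partial b f x)"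
  proof (rule integral_dominated_convergence[where w = w])
    show "integrable lborel w"
      unfolding w_def by (intro integrable_mult_right integrable_inverse_jb)
    show "AE x in lborel. (\<lambda>n. g n x) \<longlonglongrightarrow> partial b f x"
    proof (rule AE_I2)
      fix x
      have "((\<lambda>h. (f (h *\<^sub>R b + x) - f x) /\<^sub>R h) \<longlongrightarrow> partial b f x) (at 0)"
        using has_vector_derivative_quotient[OF line[of x 0, simplified]] by simp
      from filterlim_compose[OF this epsat] show "(\<lambda>n. g n x) \<longlonglongrightarrow> partial b f x" by (simp add: g_def)
    qed
    show "AE x in lborel. norm (g n x) \<le> w x" for n by (intro AE_I2 g_le)
    show "g n \<in> borel_measurable lborel" for n unfolding g_def by measurable
  qed measurable
  moreover have "(LINT x|lborel. g n x) = 0" for n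
  proof -
    have "integrable (distr lborel borel ((+) (\<epsilon> n *\<^sub>R b))) f"
      using schwartz_integrable[OF f] by (simp add: lborel_distr_plus)
    then have "integrable lborel (\<lambda>x. f (\<epsilon> n *\<^sub>R b + x))" by (subst (asm) integrable_distr_eq) auto
    then show ?thesis
      using schwartz_integrable[OF f] integral_lborel_translate[OF schwartz_measurable[OF f], of "\<epsilon> n *\<^sub>R b"]
      by (simp add: g_def)
  qed
  ultimately show ?thesis by (simp add: LIMSEQ_const_iff)
qed

text \<open>Integration by parts: the product of \<open>f\<close> and the character is a Schwartz function, so the
  integral of its partial derivative vanishes.\<close>

lemma fourier_partial:
  fixes f :: "'a::euclidean_space \<Rightarrow> complex"
  assumes f: "f \<in> schwartz" and b: "b \<in> Basis"
  shows "fourier (partial b f) \<xi> = \<i> * complex_of_real (\<xi> \<bullet> b) * fourier f \<xi>"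
proof -
  let ?h = "\<lambda>x. iexp ((- \<xi>) \<bullet> x) * f x"
  have char: "iexp ((- \<xi>) \<bullet> x) = character (x \<bullet> \<xi>)" for x by (simp add: inner_commute)
  have "frechet_derivative ?h (at x) =
     (\<lambda>v. iexp ((- \<xi>) \<bullet> x) * (\<i> * complex_of_real ((- \<xi>) \<bullet> v) * f x + frechet_derivative f (at x) v))" for x
    by (rule frechet_derivative_at[OF character_mult_has_derivative[OF f], symmetric])
  then have pd: "partial b ?h x = partial b f x * character (x \<bullet> \<xi>) - \<i> * complex_of_real (\<xi> \<bullet> b) * (f x * character (x \<bullet> \<xi>))" for x
    unfolding char by (simp add: algebra_simps)
  have "(LINT x|lborel. partial b f x * character (x \<bullet> \<xi>) - \<i> * complex_of_real (\<xi> \<bullet> b) * (f x * character (x \<bullet> \<xi>))) = 0"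
    using integral_partial_eq_0[OF schwartz_character_mult[OF f, of "- \<xi>"] b] by (simp only: pd)
  moreover have "integrable lborel (\<lambda>x. partial b f x * character (x \<bullet> \<xi>))" "integrable lborel (\<lambda>x. f x * character (x \<bullet> \<xi>))"
    by (intro integrable_character_mult schwartz_integrable schwartz_partial f b)+
  ultimately show ?thesis by (simp add: fourier_def scaleR_conv_of_real)
qed

text \<open>Since \<open>|\<xi>|\<close> is at most the sum of the \<open>|\<xi>\<^sub>b|\<close>, one more power of the bracket costs one partial
  derivative of \<open>f\<close>, which is again a Schwartz function.\<close>

lemma fourier_rapid_decay:
  fixes f :: "'a::euclidean_space \<Rightarrow> complex"
  assumes "f \<in> schwartz"
  shows "rapid_decay (fourier f)"
  unfolding rapid_decay_def
proof
  fix k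
  have "\<exists>C. \<forall>\<xi>. jb \<xi> ^ k * norm (fourier f \<xi>) \<le> C"
    using assms
  proof (induction k arbitrary: f)
    case 0
    show ?case using norm_fourier_le[of f] by auto
  next
    case (Suc k)
    obtain C where C: "\<And>\<xi>. jb \<xi> ^ k * norm (fourier f \<xi>) \<le> C" using Suc by blast
    have "\<forall>b\<in>Basis. \<exists>D. \<forall>\<xi>. jb \<xi> ^ k * norm (fourier (partial b f) \<xi>) \<le> D"
      using Suc schwartz_partial by blast
    then obtain D where D: "\<And>b \<xi>. b \<in> Basis \<Longrightarrow> jb \<xi> ^ k * norm (fourier (partial b f) \<xi>) \<le> D b"
      by metis
    have "jb \<xi> ^ Suc k * norm (fourier f \<xi>) \<le> C + sum D Basis" for \<xi>
    proof -
      have "jb \<xi> \<le> 1 + (\<Sum>b\<in>Basis. \<bar>\<xi> \<bullet> b\<bar>)" using jb_le[of \<xi>] norm_le_l1[of \<xi>] by linarith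
      then have "jb \<xi> * (jb \<xi> ^ k * norm (fourier f \<xi>)) \<le>
          (1 + (\<Sum>b\<in>Basis. \<bar>\<xi> \<bullet> b\<bar>)) * (jb \<xi> ^ k * norm (fourier f \<xi>))"
        by (intro mult_right_mono) auto
      also have "\<dots> = jb \<xi> ^ k * norm (fourier f \<xi>) + (\<Sum>b\<in>Basis. jb \<xi> ^ k * norm (fourier (partial b f) \<xi>))"
        by (simp add: fourier_partial[OF Suc.prems] norm_mult algebra_simps sum_distrib_left)
      also have "\<dots> \<le> C + sum D Basis" by (intro add_mono C sum_mono D)
      finally show ?thesis by (simp add: mult_ac)
    qed
    then show ?case by blast
  qed
  then obtain C where "\<And>\<xi>. jb \<xi> ^ k * norm (fourier f \<xi>) \<le> C" by blast
  then have "norm (fourier f \<xi>) \<le> C / jb \<xi> ^ k" for \<xi> by (simp add: field_simps)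
  then show "\<exists>C. \<forall>\<xi>. norm (fourier f \<xi>) \<le> C / jb \<xi> ^ k" by blast
qed

lemma schwartz_fourier:
  fixes f :: "'a::euclidean_space \<Rightarrow> complex"
  assumes "f \<in> schwartz"
  shows "fourier f \<in> schwartz"
proof (rule schwartz_coinduct[where S = "fourier ` schwartz"])
  fix h :: "'a \<Rightarrow> complex" assume "h \<in> fourier ` schwartz"
  then obtain f where f: "h = fourier f" "f \<in> schwartz" by blast
  show "rapid_decay h" unfolding f(1) by (rule fourier_rapid_decay[OF f(2)])
  show "\<exists>g'. (\<forall>\<xi>. (h has_derivative g' \<xi>) (at \<xi>)) \<and> (\<forall>v\<in>Basis. (\<lambda>\<xi>. g' \<xi> v) \<in> fourier ` schwartz)"
  proof (intro exI conjI allI ballI)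
    show "(h has_derivative (\<lambda>v. fourier (\<lambda>x. - \<i> * complex_of_real (x \<bullet> v) * f x) \<xi>)) (at \<xi>)" for \<xi>
      unfolding f(1) by (intro fourier_has_derivative schwartz_rapid_decay schwartz_measurable f)
    show "(\<lambda>\<xi>. fourier (\<lambda>x. - \<i> * complex_of_real (x \<bullet> v) * f x) \<xi>) \<in> fourier ` schwartz" if "v \<in> Basis" for v
      using schwartz_cmult[OF schwartz_coordinate_mult[OF f(2) that], of "- \<i>"] by (auto simp: mult.assoc)
  qed
qed (use assms in blast)

text \<open>Fubini's theorem for \<open>f x g y e\<^bsup>-i x \<cdot> y\<^esup>\<close>. It defines the transform of a
  distribution consistently with that of a function, and it moves the transform from a Gaussian to
  the other factor of a pairing.\<close>

lemma fourier_multiplication_formula: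
  fixes f g :: "'a::euclidean_space \<Rightarrow> complex"
  assumes f: "integrable lborel f" and g: "integrable lborel g"
  shows "(LINT x|lborel. fourier f x * g x) = (LINT x|lborel. f x * fourier g x)"
proof -
  have [measurable]: "f \<in> borel_measurable borel" "g \<in> borel_measurable borel" using f g by auto
  let ?k = "\<lambda>x y. f x * g y * character (x \<bullet> y)"
  have [measurable]: "(\<lambda>p. character (fst p \<bullet> snd p)) \<in> borel_measurable (lborel \<Otimes>\<^sub>M (lborel :: 'a measure))"
    unfolding lborel_prod by (simp, intro borel_measurable_continuous_onI continuous_intros)
  have "integrable (lborel \<Otimes>\<^sub>M lborel) (\<lambda>p. ?k (fst p) (snd p))"
  proof (rule lborel_pair.Fubini_integrable)
    show "(\<lambda>p. ?k (fst p) (snd p)) \<in> borel_measurable (lborel \<Otimes>\<^sub>M lborel)" by measurable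
    show "integrable lborel (\<lambda>x. LINT y|lborel. norm (?k (fst (x, y)) (snd (x, y))))"
      using f g by (simp add: norm_mult)
    show "AE x in lborel. integrable lborel (\<lambda>y. ?k (fst (x, y)) (snd (x, y)))"
    proof (rule AE_I2)
      fix x
      have "integrable lborel (\<lambda>y. f x * (g y * character (y \<bullet> x)))"
        by (intro integrable_mult_right integrable_character_mult g)
      then show "integrable lborel (\<lambda>y. ?k (fst (x, y)) (snd (x, y)))"
        by (simp add: mult.assoc inner_commute[of x])
    qed
  qed
  then have "integrable (lborel \<Otimes>\<^sub>M lborel) (case_prod ?k)" by (simp add: case_prod_beta')
  from lborel_pair.Fubini_integral[OF this]
  have "(LINT y|lborel. LINT x|lborel. ?k x y) = (LINT x|lborel. LINT y|lborel. ?k x y)" .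
  moreover have "(LINT x|lborel. ?k x y) = (LINT x|lborel. f x * character (x \<bullet> y)) * g y" for y
    by (subst integral_mult_left_zero[symmetric]) (simp add: mult_ac)
  moreover have "(LINT y|lborel. ?k x y) = f x * (LINT y|lborel. g y * character (y \<bullet> x))" for x
    by (subst integral_mult_right_zero[symmetric]) (simp add: mult_ac inner_commute)
  ultimately show ?thesis by (simp add: fourier_def)
qed


section \<open>Gaussian wave packets\<close>

lemma integral_lborel_prod:
  fixes f :: "'a::euclidean_space \<Rightarrow> real \<Rightarrow> complex"
  assumes f: "\<And>b. b \<in> Basis \<Longrightarrow> integrable lborel (f b)"
  shows "(LINT x|(lborel :: 'a measure). (\<Prod>b\<in>Basis. f b (x \<bullet> b))) = (\<Prod>b\<in>Basis. (LINT y|lborel. f b y))"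
proof -
  interpret product_sigma_finite "\<lambda>_::'a. lborel :: real measure" ..
  have [measurable]: "f b \<in> borel_measurable borel" if "b \<in> Basis" for b
    using f[OF that] by auto
  have meas: "(\<lambda>x::'a. \<Prod>b\<in>Basis. f b (x \<bullet> b)) \<in> borel_measurable borel" by measurable
  have "(LINT x|(lborel :: 'a measure). (\<Prod>b\<in>Basis. f b (x \<bullet> b)))
      = (LINT z|(\<Pi>\<^sub>M b\<in>Basis. lborel). (\<Prod>b\<in>Basis. f b ((\<Sum>c\<in>Basis. z c *\<^sub>R c) \<bullet> b)))"
    by (subst lborel_eq, subst integral_distr[OF _ meas]) auto
  also have "\<dots> = (LINT z|(\<Pi>\<^sub>M b\<in>(Basis::'a set). lborel). (\<Prod>b\<in>Basis. f b (z b)))"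
    by (intro Bochner_Integration.integral_cong prod.cong refl) (simp add: inner_sum_left_Basis)
  also have "\<dots> = (\<Prod>b\<in>Basis. (LINT y|lborel. f b y))"
    by (rule product_integral_prod) (auto intro: f)
  finally show ?thesis .
qed

text \<open>This is the characteristic function of the standard normal distribution, without the
  normalising factor.\<close>

lemma gaussian_character_integral_real:
  shows "integrable lborel (\<lambda>y. complex_of_real (exp (- (y\<^sup>2 / 2))) * character (y * t))" (is ?int)
    and "(LINT y|lborel. complex_of_real (exp (- (y\<^sup>2 / 2))) * character (y * t))
       = complex_of_real (sqrt (2 * pi) * exp (- (t\<^sup>2 / 2)))" (is ?eq)
proof -
  have std: "std_normal_density y = exp (- (y\<^sup>2 / 2)) / sqrt (2 * pi)" for y
    by (simp add: std_normal_density_def)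
  have "integrable lborel (\<lambda>y. sqrt (2 * pi) * std_normal_density y)"
    by (intro integrable_mult_right integrable_normal_density) simp
  then have int: "integrable lborel (\<lambda>y::real. exp (- (y\<^sup>2 / 2)))" by (simp add: std)
  show ?int
    by (rule Bochner_Integration.integrable_bound[OF int]) (auto simp: norm_mult)
  have "char std_normal_distribution (- t) =
      (LINT y|lborel. std_normal_density y *\<^sub>R iexp (- t * y))"
    unfolding char_def by (subst integral_density) auto
  also have "\<dots> = (LINT y|lborel. complex_of_real (1 / sqrt (2 * pi)) * (complex_of_real (exp (- (y\<^sup>2 / 2))) * character (y * t)))"
    by (intro Bochner_Integration.integral_cong) (simp_all add: std scaleR_conv_of_real mult_ac)
  also have "\<dots> = complex_of_real (1 / sqrt (2 * pi)) * (LINT y|lborel. complex_of_real (exp (- (y\<^sup>2 / 2))) * character (y * t))"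
    by (rule integral_mult_right_zero)
  finally have *: "complex_of_real (exp (- (t\<^sup>2 / 2))) = complex_of_real (1 / sqrt (2 * pi)) * (LINT y|lborel. complex_of_real (exp (- (y\<^sup>2 / 2))) * character (y * t))"
    by (simp add: char_std_normal_distribution)
  have "complex_of_real (sqrt (2 * pi)) * complex_of_real (1 / sqrt (2 * pi)) = complex_of_real (sqrt (2 * pi) * (1 / sqrt (2 * pi)))"
    by (rule of_real_mult[symmetric])
  also have "\<dots> = 1" by simp
  finally show ?eq
    using arg_cong[OF *, of "\<lambda>z. complex_of_real (sqrt (2 * pi)) * z"] by (simp only: of_real_mult mult.assoc[symmetric] mult_1_left)
qed

abbreviation gauss :: "'a::euclidean_space \<Rightarrow> real" where
  "gauss z \<equiv> exp (- ((norm z)\<^sup>2 / 2))"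

lemma gaussian_character_integral:
  fixes \<eta> :: "'a::euclidean_space"
  shows "(LINT z|lborel. complex_of_real (gauss z) * character (z \<bullet> \<eta>))
     = complex_of_real ((2 * pi) powr (real DIM('a) / 2) * gauss \<eta>)"
proof -
  have sq: "(norm x)\<^sup>2 = (\<Sum>b\<in>Basis. (x \<bullet> b)\<^sup>2)" for x :: 'a
    unfolding power2_norm_eq_inner by (subst euclidean_inner) (simp add: power2_eq_square)
  have expsq: "gauss x = (\<Prod>b\<in>Basis. exp (- ((x \<bullet> b)\<^sup>2 / 2)))" for x :: 'a
    by (simp add: sq sum_divide_distrib sum_negf[symmetric] exp_sum)
  have "complex_of_real (gauss z) * character (z \<bullet> \<eta>)
      = (\<Prod>b\<in>Basis. complex_of_real (exp (- ((z \<bullet> b)\<^sup>2 / 2))) * character ((z \<bullet> b) * (\<eta> \<bullet> b)))" for z :: 'a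
  proof -
    have "character (z \<bullet> \<eta>) = exp (\<Sum>b\<in>Basis. - (\<i> * complex_of_real ((z \<bullet> b) * (\<eta> \<bullet> b))))"
      by (subst euclidean_inner) (simp add: sum_distrib_left sum_negf)
    then show ?thesis by (simp add: expsq prod.distrib exp_sum)
  qed
  then have "(LINT z|lborel. complex_of_real (gauss z) * character (z \<bullet> \<eta>))
     = (\<Prod>b\<in>Basis. (LINT y|lborel. complex_of_real (exp (- (y\<^sup>2 / 2))) * character (y * (\<eta> \<bullet> b))))"
    by (simp only:) (intro integral_lborel_prod gaussian_character_integral_real)
  also have "\<dots> = complex_of_real (sqrt (2 * pi) ^ DIM('a) * gauss \<eta>)"
    by (simp only: gaussian_character_integral_real of_real_prod[symmetric] prod.distrib expsq prod_constant)
  also have "sqrt (2 * pi) ^ DIM('a) = (2 * pi) powr (real DIM('a) / 2)"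
    by (simp add: powr_half_sqrt[symmetric] powr_realpow[symmetric] powr_powr)
  finally show ?thesis .
qed

definition gaussian_bump :: "'a::euclidean_space \<Rightarrow> real \<Rightarrow> 'a \<Rightarrow> real" where
  "gaussian_bump a l \<xi> = exp (- ((norm ((1 / l) *\<^sub>R (\<xi> - a)))\<^sup>2 / 2))"

text \<open>A Gaussian of width \<open>1 / l\<close> around the origin, modulated to the frequency \<open>a\<close>. The normalisation
  makes its Fourier transform \<open>c\<close> times the bump of height \<open>1\<close> and width \<open>l\<close> around \<open>a\<close>.\<close>

definition wave_packet :: "real \<Rightarrow> 'a::euclidean_space \<Rightarrow> real \<Rightarrow> 'a \<Rightarrow> complex" where
  "wave_packet c a l y =
     complex_of_real (c * l ^ DIM('a) * gauss (l *\<^sub>R y)) * iexp (a \<bullet> y)"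

lemma gaussian_bump_pos [simp]: "0 < gaussian_bump a l \<xi>" "0 \<le> gaussian_bump a l \<xi>"
  by (simp_all add: gaussian_bump_def)

lemma schwartz_gaussian_bump:
  assumes "0 < l"
  shows "(\<lambda>\<xi>. complex_of_real (gaussian_bump a l \<xi>)) \<in> schwartz"
proof -
  have "(\<lambda>x. complex_of_real (exp (- ((1 / (2 * l\<^sup>2)) * (norm (x - a))\<^sup>2)))) \<in> schwartz"
    using assms by (intro schwartz_translate[of "\<lambda>x. complex_of_real (exp (- ((1 / (2 * l\<^sup>2)) * (norm x)\<^sup>2)))"] schwartz_gaussian) simp
  then show ?thesis
    using assms by (simp add: gaussian_bump_def power_mult_distrib power_divide mult.commute)
qed

lemma schwartz_wave_packet:
  assumes "0 < l"
  shows "wave_packet c (a :: 'a::euclidean_space) l \<in> schwartz"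
proof -
  have "(\<lambda>y::'a. complex_of_real (c * l ^ DIM('a)) * (iexp (a \<bullet> y) * complex_of_real (exp (- ((l\<^sup>2 / 2) * (norm y)\<^sup>2))))) \<in> schwartz"
    using assms by (intro schwartz_cmult schwartz_character_mult schwartz_gaussian) simp
  also have "(\<lambda>y::'a. complex_of_real (c * l ^ DIM('a)) * (iexp (a \<bullet> y) * complex_of_real (exp (- ((l\<^sup>2 / 2) * (norm y)\<^sup>2)))))
      = wave_packet c a l"
    by (simp add: wave_packet_def fun_eq_iff power_mult_distrib mult_ac)
  finally show ?thesis .
qed

lemma fourier_wave_packet_mult:
  fixes w :: "'a::euclidean_space \<Rightarrow> complex"
  assumes l: "0 < l" and [measurable]: "w \<in> borel_measurable borel"
  shows "fourier (\<lambda>y. wave_packet c a l y * w y) \<xi> = complex_of_real (fourier_factor DIM('a) * c) *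
     (LINT z|lborel. complex_of_real (gauss z) * w ((1 / l) *\<^sub>R z) * character (z \<bullet> ((1 / l) *\<^sub>R (\<xi> - a))))"
proof -
  let ?h = "\<lambda>y. wave_packet c a l y * w y"
  let ?k = "\<lambda>z. complex_of_real (gauss z) * w ((1 / l) *\<^sub>R z) * character (z \<bullet> ((1 / l) *\<^sub>R (\<xi> - a)))"
  have [measurable]: "wave_packet c a l \<in> borel_measurable borel"
    using l by (intro schwartz_measurable schwartz_wave_packet)
  have "(LINT y|lborel. ?h y * character (y \<bullet> \<xi>))
    = (1 / l) ^ DIM('a) *\<^sub>R (LINT z|lborel. ?h (0 + (1 / l) *\<^sub>R z) * character ((0 + (1 / l) *\<^sub>R z) \<bullet> \<xi>))"
    using l by (intro integral_lborel_affine) auto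
  also have "(\<lambda>z. ?h (0 + (1 / l) *\<^sub>R z) * character ((0 + (1 / l) *\<^sub>R z) \<bullet> \<xi>)) = (\<lambda>z. complex_of_real (c * l ^ DIM('a)) * ?k z)"
  proof
    fix z :: 'a
    have e: "iexp (a \<bullet> (1 / l) *\<^sub>R z) * character ((1 / l) *\<^sub>R z \<bullet> \<xi>) = character (z \<bullet> ((1 / l) *\<^sub>R (\<xi> - a)))"
      unfolding exp_add[symmetric] by (simp add: inner_diff_right inner_commute[of a] diff_divide_distrib algebra_simps)
    have n: "l *\<^sub>R (1 / l) *\<^sub>R z = z" using l by simp
    show "?h (0 + (1 / l) *\<^sub>R z) * character ((0 + (1 / l) *\<^sub>R z) \<bullet> \<xi>) = complex_of_real (c * l ^ DIM('a)) * ?k z"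
      unfolding e[symmetric] wave_packet_def add_0_left n of_real_mult by (simp only: mult_ac)
  qed
  also have "(1 / l) ^ DIM('a) *\<^sub>R (LINT z|lborel. complex_of_real (c * l ^ DIM('a)) * ?k z)
     = complex_of_real ((1 / l) ^ DIM('a) * l ^ DIM('a)) * (complex_of_real c * (LINT z|lborel. ?k z))"
    unfolding scaleR_conv_of_real of_real_mult integral_mult_right_zero by (simp only: mult_ac)
  also have "(1 / l) ^ DIM('a) * l ^ DIM('a) = 1" using l by (simp add: power_divide)
  finally have *: "(LINT y|lborel. ?h y * character (y \<bullet> \<xi>)) = complex_of_real c * (LINT z|lborel. ?k z)" by simp
  show ?thesis unfolding fourier_def mult_minus_left * by (simp add: scaleR_conv_of_real mult.assoc)
qed

lemma fourier_wave_packet: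
  assumes "0 < l"
  shows "fourier (wave_packet c a l) \<xi> = complex_of_real (c * gaussian_bump a l (\<xi> :: 'a::euclidean_space))"
proof -
  have "fourier (wave_packet c a l) \<xi> = complex_of_real (fourier_factor DIM('a) * c *
      ((2 * pi) powr (real DIM('a) / 2) * gaussian_bump a l \<xi>))"
    using fourier_wave_packet_mult[OF assms, of "\<lambda>_. 1" c a \<xi>]
    by (simp only: mult_1_right gaussian_character_integral gaussian_bump_def of_real_mult[symmetric] borel_measurable_const simp_thms)
  also have "fourier_factor DIM('a) * c * ((2 * pi) powr (real DIM('a) / 2) * gaussian_bump a l \<xi>) = c * gaussian_bump a l \<xi>"
    by (simp add: powr_minus)
  finally show ?thesis .
qed

lemma fourier_translate:
  fixes f :: "'a::euclidean_space \<Rightarrow> complex"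
  assumes [measurable]: "f \<in> borel_measurable borel"
  shows "fourier (\<lambda>y. f (y - x)) \<zeta> = character (x \<bullet> \<zeta>) * fourier f \<zeta>"
proof -
  have "(LINT y|lborel. f (y - x) * character (y \<bullet> \<zeta>)) = (LINT y|lborel. f (x + y - x) * character ((x + y) \<bullet> \<zeta>))"
    by (rule integral_lborel_translate[symmetric]) measurable
  also have "(\<lambda>y. f (x + y - x) * character ((x + y) \<bullet> \<zeta>)) = (\<lambda>y. character (x \<bullet> \<zeta>) * (f y * character (y \<bullet> \<zeta>)))"
    by (simp add: fun_eq_iff inner_add_left exp_add[symmetric] algebra_simps)
  finally show ?thesis by (simp add: fourier_def)
qed

lemma wave_packet_eq_fourier:
  assumes l: "0 < l"
  shows "wave_packet c a l y = fourier (\<lambda>\<eta>. complex_of_real (c * gaussian_bump (- a) l \<eta>)) (y :: 'a::euclidean_space)"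
proof -
  have bump: "complex_of_real (c * gaussian_bump (- a) l \<eta>) = complex_of_real c * wave_packet (l ^ DIM('a)) 0 (1 / l) (\<eta> - - a)" for \<eta>
    using l by (simp add: gaussian_bump_def wave_packet_def power_divide)
  have meas: "wave_packet (l ^ DIM('a)) (0 :: 'a) (1 / l) \<in> borel_measurable borel"
    using l by (intro schwartz_measurable schwartz_wave_packet) simp
  have l': "0 < 1 / l" using l by simp
  show ?thesis
    unfolding bump fourier_cmult fourier_translate[OF meas] fourier_wave_packet[OF l']
    by (simp add: wave_packet_def gaussian_bump_def)
qed

text \<open>Frequencies add up under multiplication. The amplitude gains the factor \<open>l\<^sup>d\<close>, as it must,
  since on the Fourier side two bumps of width \<open>l\<close> are convolved. This gain is the source of the
  dimension in the final inequality.\<close>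

lemma wave_packet_mult:
  assumes "0 < l"
  shows "wave_packet c1 a1 l (y :: 'a::euclidean_space) * wave_packet c2 a2 l y
    = wave_packet (c1 * c2 * l ^ DIM('a) / sqrt 2 ^ DIM('a)) (a1 + a2) (sqrt 2 * l) y"
proof -
  have e1: "gauss (l *\<^sub>R y) * gauss (l *\<^sub>R y) = gauss ((sqrt 2 * l) *\<^sub>R y)"
    unfolding exp_add[symmetric] by (simp add: power_mult_distrib)
  have e2: "iexp (a1 \<bullet> y) * iexp (a2 \<bullet> y) = iexp ((a1 + a2) \<bullet> y)"
    unfolding exp_add[symmetric] by (simp add: inner_add_left algebra_simps)
  have e3: "(c1 * c2 * l ^ DIM('a) / sqrt 2 ^ DIM('a)) * (sqrt 2 * l) ^ DIM('a) = (c1 * l ^ DIM('a)) * (c2 * l ^ DIM('a))"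
    by (simp add: power_mult_distrib)
  have "wave_packet c1 a1 l y * wave_packet c2 a2 l y
    = complex_of_real ((c1 * l ^ DIM('a)) * (c2 * l ^ DIM('a))
        * (gauss (l *\<^sub>R y) * gauss (l *\<^sub>R y)))
      * (iexp (a1 \<bullet> y) * iexp (a2 \<bullet> y))"
    unfolding wave_packet_def of_real_mult by (simp only: mult_ac)
  then show ?thesis unfolding e1 e2 e3[symmetric] wave_packet_def .
qed

lemma gaussian_bump_decay:
  obtains C where "0 < C" and "\<And>(a::'a::euclidean_space) l \<xi>. gaussian_bump a l \<xi> \<le> C / jb ((1 / l) *\<^sub>R (\<xi> - a)) ^ k"
proof -
  have "rapid_decay (\<lambda>x::'a. complex_of_real (exp (- ((1 / 2) * (norm x)\<^sup>2))))"
    by (rule gaussian_rapid_decay) simp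
  then obtain C where C: "0 < C" "\<And>x::'a. norm (complex_of_real (exp (- ((1 / 2) * (norm x)\<^sup>2)))) \<le> C / jb x ^ k"
    using rapid_decayD by blast
  show ?thesis
  proof (rule that[OF C(1)])
    fix a \<xi> :: 'a and l :: real
    show "gaussian_bump a l \<xi> \<le> C / jb ((1 / l) *\<^sub>R (\<xi> - a)) ^ k"
      using C(2)[of "(1 / l) *\<^sub>R (\<xi> - a)"] by (simp add: gaussian_bump_def)
  qed
qed

section \<open>Distributions\<close>

abbreviation packet_distr :: "real \<Rightarrow> 'a::euclidean_space \<Rightarrow> real \<Rightarrow> 'a distribution" where
  "packet_distr c a l \<equiv> distr_of_fun (wave_packet c a l)"

lemma distr_of_fun_schwartz_tempered:
  fixes f :: "'a::euclidean_space \<Rightarrow> complex"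
  assumes f: "f \<in> schwartz"
  shows "distr_of_fun f \<in> tempered_distributions"
proof -
  have int: "integrable lborel (\<lambda>x. f x * \<psi> x)" if "\<psi> \<in> schwartz" for \<psi>
    by (intro schwartz_integrable schwartz_mult f that)
  have bound: "norm (distr_of_fun f \<psi>) \<le> (LINT x|lborel. norm (f x)) * schwartz_seminorm 0 \<psi>" if \<psi>: "\<psi> \<in> schwartz" for \<psi>
  proof -
    have "{vs :: 'a list. set vs \<subseteq> Basis \<and> length vs \<le> 0} = {[]}" by auto
    then have semi: "schwartz_seminorm 0 \<psi> = (SUP x. norm (\<psi> x))" by (simp add: schwartz_seminorm_def)
    obtain C where "\<And>x. norm (\<psi> x) \<le> C" using schwartz_bounded[OF \<psi>] by blast
    then have "bdd_above (range (\<lambda>x. norm (\<psi> x)))" by (intro bdd_aboveI[of _ C]) auto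
    then have le: "norm (\<psi> x) \<le> schwartz_seminorm 0 \<psi>" for x unfolding semi by (intro cSUP_upper) auto
    have "norm (LINT x|lborel. f x * \<psi> x) \<le> (LINT x|lborel. norm (f x) * schwartz_seminorm 0 \<psi>)"
      by (intro Bochner_Integration.integral_norm_bound_integral int \<psi> integrable_mult_left integrable_norm schwartz_integrable f)
         (simp add: norm_mult mult_left_mono le)
    then show ?thesis using \<psi> by (simp add: distr_of_fun_def)
  qed
  show ?thesis
    unfolding tempered_distributions_def
  proof (intro CollectI conjI ballI allI impI)
    show "\<psi> \<notin> schwartz \<Longrightarrow> distr_of_fun f \<psi> = 0" for \<psi> by (simp add: distr_of_fun_def)
    show "distr_of_fun f (\<lambda>x. \<psi> x + \<eta> x) = distr_of_fun f \<psi> + distr_of_fun f \<eta>"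
      if "\<psi> \<in> schwartz" "\<eta> \<in> schwartz" for \<psi> \<eta>
      using that int[of \<psi>] int[of \<eta>] by (simp add: distr_of_fun_def schwartz_add distrib_left)
    show "distr_of_fun f (\<lambda>x. c * \<psi> x) = c * distr_of_fun f \<psi>" if "\<psi> \<in> schwartz" for c \<psi>
      using that schwartz_cmult[OF that, of c]
      by (simp add: distr_of_fun_def mult.left_commute[of _ c])
    show "\<exists>C N. \<forall>\<psi>\<in>schwartz. norm (distr_of_fun f \<psi>) \<le> C * schwartz_seminorm N \<psi>"
      using bound by blast
  qed
qed

lemma represents_fourier:
  fixes f :: "'a::euclidean_space \<Rightarrow> complex"
  assumes f: "f \<in> schwartz"
  shows "represents (fourier f) (distr_fourier (distr_of_fun f))"
  unfolding represents_def
proof (intro conjI ballI)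
  show "fourier f \<in> borel_measurable borel" by (intro schwartz_measurable schwartz_fourier f)
  show "integrable lborel (\<lambda>x. fourier f x * \<psi> x)" if "\<psi> \<in> schwartz" for \<psi>
    by (intro schwartz_integrable schwartz_mult schwartz_fourier f that)
  show "distr_fourier (distr_of_fun f) = distr_of_fun (fourier f)"
    by (rule ext) (auto simp: distr_fourier_def distr_of_fun_def schwartz_fourier
        fourier_multiplication_formula[OF schwartz_integrable[OF f] schwartz_integrable])
qed

lemma distr_mult_distr_of_fun:
  assumes "h \<in> schwartz"
  shows "distr_mult (distr_of_fun f) h = distr_of_fun (\<lambda>y. f y * h y)"
  by (rule ext) (auto simp: distr_mult_def distr_of_fun_def schwartz_mult[OF assms] mult.assoc)

text \<open>This makes the definite description in the definition of the short-time Fourier transform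
  meaningful. If the difference \<open>D\<close> of the two functions does not vanish at \<open>z\<close>, then the Gaussians
  \<open>exp (- n |y - z|\<^sup>2)\<close> eventually concentrate on a ball around \<open>z\<close> on which \<open>D\<close> stays close to \<open>D z\<close>, so
  that the pairing with \<open>D\<close> is nonzero.\<close>

lemma represents_unique_continuous:
  fixes g1 g2 :: "'a::euclidean_space \<Rightarrow> complex"
  assumes g: "continuous_on UNIV g1" "represents g1 u" "continuous_on UNIV g2" "represents g2 u"
  shows "g1 = g2"
proof (rule ccontr)
  assume "g1 \<noteq> g2"
  then obtain z where z: "g1 z \<noteq> g2 z" by blast
  define D where "D y = g1 y - g2 y" for y
  define K where "K y = Re (cnj (D z) * D y)" for y
  define e where "e n y = exp (- (real n * (norm (y - z))\<^sup>2))" for n y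
  have [measurable]: "g1 \<in> borel_measurable borel" "g2 \<in> borel_measurable borel"
    using g by (auto simp: represents_def)
  have [measurable]: "K \<in> borel_measurable borel" unfolding K_def D_def by measurable
  have [measurable]: "e n \<in> borel_measurable borel" for n unfolding e_def by measurable
  have es: "(\<lambda>y. complex_of_real (e (Suc n) y)) \<in> schwartz" for n
    using schwartz_translate[OF schwartz_gaussian[of "real (Suc n)"], of z] by (simp add: e_def)
  have intg: "integrable lborel (\<lambda>y. g1 y * complex_of_real (e (Suc n) y))"
    "integrable lborel (\<lambda>y. g2 y * complex_of_real (e (Suc n) y))" for n
    using g(2,4) es[of n] by (auto simp: represents_def)
  then have intD: "integrable lborel (\<lambda>y. D y * complex_of_real (e (Suc n) y))" for n
    unfolding D_def left_diff_distrib by (intro Bochner_Integration.integrable_diff)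
  have "distr_of_fun g1 = distr_of_fun g2" using g by (simp add: represents_def)
  then have "distr_of_fun g1 (\<lambda>y. complex_of_real (e (Suc n) y)) = distr_of_fun g2 (\<lambda>y. complex_of_real (e (Suc n) y))" for n
    by simp
  then have zeroD: "(LINT y|lborel. D y * complex_of_real (e (Suc n) y)) = 0" for n
    using intg es by (simp add: distr_of_fun_def D_def left_diff_distrib)
  have K_eq: "K y * e (Suc n) y = Re (cnj (D z) * (D y * complex_of_real (e (Suc n) y)))" for y n
    by (simp add: K_def algebra_simps)
  have intK: "integrable lborel (\<lambda>y. K y * e (Suc n) y)" for n
    unfolding K_eq by (intro integrable_Re integrable_mult_right intD)
  have zeroK: "(LINT y|lborel. K y * e (Suc n) y) = 0" for n
  proof -
    have "(LINT y|lborel. K y * e (Suc n) y) = Re (LINT y|lborel. cnj (D z) * (D y * complex_of_real (e (Suc n) y)))"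
      unfolding K_eq by (intro integral_Re integrable_mult_right intD)
    then show ?thesis by (simp add: zeroD)
  qed
  have "D z \<noteq> 0" using z by (simp add: D_def)
  then have "0 < K z"
    by (simp add: K_def complex_eq_iff sum_power2_gt_zero_iff flip: power2_eq_square)
  have "continuous_on UNIV K" unfolding K_def D_def by (intro continuous_intros g)
  then have "isCont K z" by (simp add: continuous_on_eq_continuous_at)
  with \<open>0 < K z\<close> obtain r where r: "0 < r" "\<And>y. dist y z < r \<Longrightarrow> K z / 2 < K y"
  proof -
    have "eventually (\<lambda>y. K z / 2 < K y) (nhds z)"
      using \<open>isCont K z\<close> \<open>0 < K z\<close> by (intro order_tendstoD(1)[of K "K z"]) (auto simp: isCont_def tendsto_at_iff_tendsto_nhds)
    then show ?thesis using that unfolding eventually_nhds_metric by auto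
  qed
  define \<rho> where "\<rho> = r / 2"
  have rho: "0 < \<rho>" "\<rho> < r" using r by (auto simp: \<rho>_def)
  define B where "B = cball z \<rho>"
  have inB: "y \<in> B \<longleftrightarrow> norm (y - z) \<le> \<rho>" for y by (simp add: B_def dist_norm norm_minus_commute)
  have KB: "K z / 2 < K y" if "y \<in> B" for y using r(2)[of y] that rho by (simp add: B_def dist_commute)
  have [measurable]: "B \<in> sets borel" by (simp add: B_def)
  define d where "d = K z / 2 * exp (- \<rho>\<^sup>2)"
  have d: "0 < d" using \<open>0 < K z\<close> by (simp add: d_def)
  have finB: "emeasure lborel B < \<infinity>" unfolding B_def by (rule emeasure_lborel_cball_finite)
  have intB: "integrable lborel (\<lambda>y. indicator B y * d)"
    using finB by (intro integrable_mult_left) (simp add: integrable_indicator_iff)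
  have int1: "integrable lborel (\<lambda>y. norm (K y * e 1 y))" using intK[of 0] by (intro integrable_norm) simp
  \<comment> \<open>relative to \<open>exp (- n \<rho>\<^sup>2)\<close> the Gaussians stay large inside the ball and vanish outside\<close>
  define w where "w n y = exp (real n * (\<rho>\<^sup>2 - (norm (y - z))\<^sup>2))" for n y
  have [measurable]: "w n \<in> borel_measurable borel" for n unfolding w_def by measurable
  have Kw: "K y * e 1 y * w n y = exp (real n * \<rho>\<^sup>2) * (K y * e (Suc n) y)" for n y
    by (simp add: e_def w_def exp_add[symmetric] algebra_simps)
  define G where "G n y = indicator B y * d - indicator (- B) y * (norm (K y * e 1 y) * w n y)" for n y
  have [measurable]: "G n \<in> borel_measurable borel" for n unfolding G_def by measurable
  have G_bound: "norm (G n y) \<le> indicator B y * d + norm (K y * e 1 y)" for n y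
  proof (cases "y \<in> B")
    case False
    then have "\<rho>\<^sup>2 \<le> (norm (y - z))\<^sup>2" using rho by (intro power_mono) (auto simp: inB)
    then have "w n y \<le> 1" by (simp add: w_def mult_nonneg_nonpos)
    then have "norm (K y * e 1 y) * w n y \<le> norm (K y * e 1 y)" by (intro mult_left_le) auto
    with False show ?thesis by (simp add: G_def w_def)
  qed (use d in \<open>simp add: G_def\<close>)
  have intG: "integrable lborel (G n)" for n
    by (rule Bochner_Integration.integrable_bound[OF Bochner_Integration.integrable_add[OF intB int1]])
       (use order_trans[OF G_bound abs_ge_self] in auto)
  have "(LINT y|lborel. G n y) \<le> (LINT y|lborel. K y * e 1 y * w n y)" for n
  proof (rule integral_mono[OF intG])
    show "integrable lborel (\<lambda>y. K y * e 1 y * w n y)" unfolding Kw by (intro integrable_mult_right intK)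
    show "G n y \<le> K y * e 1 y * w n y" for y
    proof (cases "y \<in> B")
      case True
      then have le: "(norm (y - z))\<^sup>2 \<le> \<rho>\<^sup>2" by (auto simp: inB intro: power_mono)
      have "K z / 2 * exp (- \<rho>\<^sup>2) * 1 \<le> K y * e 1 y * w n y"
        using KB[OF True] \<open>0 < K z\<close> le by (intro mult_mono) (auto simp: e_def w_def)
      with True show ?thesis by (simp add: G_def d_def)
    next
      case False
      have "(- norm (K y * e 1 y)) * w n y \<le> K y * e 1 y * w n y"
        by (intro mult_right_mono) (auto simp: w_def)
      with False show ?thesis by (simp add: G_def)
    qed
  qed
  then have G_le: "(LINT y|lborel. G n y) \<le> 0" for n unfolding Kw by (simp add: zeroK)
  have "(\<lambda>n. LINT y|lborel. G n y) \<longlonglongrightarrow> (LINT y|lborel. indicator B y * d)"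
  proof (rule integral_dominated_convergence[where w = "\<lambda>y. indicator B y * d + norm (K y * e 1 y)"])
    show "AE y in lborel. (\<lambda>n. G n y) \<longlonglongrightarrow> indicator B y * d"
    proof (rule AE_I2)
      fix y :: 'a
      show "(\<lambda>n. G n y) \<longlonglongrightarrow> indicator B y * d"
      proof (cases "y \<in> B")
        case False
        then have "\<rho>\<^sup>2 < (norm (y - z))\<^sup>2" using rho by (intro power_strict_mono) (auto simp: inB)
        then have "(\<lambda>n. exp (\<rho>\<^sup>2 - (norm (y - z))\<^sup>2) ^ n) \<longlonglongrightarrow> 0" by (intro LIMSEQ_realpow_zero) auto
        then have "(\<lambda>n. w n y) \<longlonglongrightarrow> 0" by (simp add: w_def exp_of_nat_mult)
        then show ?thesis unfolding G_def using False by (auto intro!: tendsto_eq_intros)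
      qed (simp add: G_def)
    qed
    show "integrable lborel (\<lambda>y. indicator B y * d + norm (K y * e 1 y))"
      by (rule Bochner_Integration.integrable_add[OF intB int1])
    show "AE y in lborel. norm (G n y) \<le> indicator B y * d + norm (K y * e 1 y)" for n
      by (intro AE_I2 G_bound)
  qed auto
  then have "(LINT y|lborel. indicator B y * d) \<le> 0"
    by (rule LIMSEQ_le_const2) (use G_le in blast)
  moreover have "0 < measure lborel B" using rho by (simp add: B_def content_cball)
  ultimately show False using d finB by (simp add: mult_le_0_iff)
qed

section \<open>Weights and Fourier Lebesgue norms of wave packets\<close>

text \<open>Two scales govern the packets: frequencies are \<open>0\<close> or comparable to \<open>N\<close>, and the width of the
  bumps on the Fourier side is comparable to \<open>N\<^sup>\<theta>\<close>. For \<open>\<theta> < 1\<close> a bump with nonzero centre stays away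
  from the origin. The factors \<open>2\<close> leave room for the product of two packets, which has width
  \<open>\<surd>2 l\<close> and possibly doubled frequency.\<close>

definition admissible :: "real \<Rightarrow> real \<Rightarrow> real \<Rightarrow> 'a::euclidean_space \<Rightarrow> bool" where
  "admissible \<theta> N l a \<longleftrightarrow> 1 \<le> N \<and> N powr \<theta> \<le> l \<and> l \<le> 2 * N powr \<theta> \<and> (a = 0 \<or> N \<le> norm a \<and> norm a \<le> 2 * N)"

text \<open>The order of growth in \<open>N\<close> of the weight with exponent \<open>s\<close> on the bump around \<open>a\<close>. At the origin
  the weight is only controlled by a power of the width; this loss disappears as \<open>\<theta> \<rightarrow> 0\<close>.\<close>

definition weight_order :: "real \<Rightarrow> real \<Rightarrow> 'a::euclidean_space \<Rightarrow> real" where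
  "weight_order \<theta> s a = (if a = 0 then \<theta> * \<bar>s\<bar> else s)"

lemma admissible_l_ge_1: "admissible \<theta> N l a \<Longrightarrow> 0 < \<theta> \<Longrightarrow> 1 \<le> l"
  unfolding admissible_def using ge_one_powr_ge_zero[of N \<theta>] by linarith

text \<open>The point is the case \<open>s < 0\<close>, \<open>a \<noteq> 0\<close>, where the weight is large near the origin although the
  bump lives at distance \<open>N\<close>. Either \<open>|\<xi>| \<ge> N / 2\<close> and the weight has the right size, or \<open>\<xi>\<close> is so far from
  \<open>a\<close> that its distance in units of \<open>l\<close> is at least of order \<open>N\<^bsup>1-\<theta>\<^esup>\<close>; then a power of this distance
  makes up for any power of \<open>N\<close>. The power \<open>M\<close> degenerates as \<open>\<theta> \<rightarrow> 1\<close>, which is why the width \<open>N\<close> itself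
  is only reached in the limit.\<close>

lemma weight_bound:
  assumes \<theta>: "0 < \<theta>" "\<theta> < 1"
  obtains C M where "0 < C" "\<And>N l (a::'a::euclidean_space) \<xi>. admissible \<theta> N l a \<Longrightarrow>
     jb \<xi> powr s \<le> C * N powr weight_order \<theta> s a * jb ((1 / l) *\<^sub>R (\<xi> - a)) ^ M"
proof -
  \<comment> \<open>\<open>r\<close> turns the relative distance \<open>N\<^bsup>1-\<theta>\<^esup>\<close> back into \<open>N\<close>\<close>
  define r where "r = 1 / (1 - \<theta>)"
  have r: "1 \<le> r" using \<theta> by (simp add: r_def field_simps)
  define M where "M = nat \<lceil>r * \<bar>s\<bar>\<rceil>"
  have M: "r * \<bar>s\<bar> \<le> real M" unfolding M_def by linarith
  have s_le: "\<bar>s\<bar> \<le> r * \<bar>s\<bar>" using r by (simp add: mult_right_mono[of 1 r "\<bar>s\<bar>", simplified])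
  have main: "jb \<xi> powr s \<le> N powr weight_order \<theta> s a * (5 * jb ((1 / l) *\<^sub>R (\<xi> - a))) powr (r * \<bar>s\<bar>)"
    if adm: "admissible \<theta> N l a" for N l and a \<xi> :: 'a
  proof -
    define u where "u = (1 / l) *\<^sub>R (\<xi> - a)"
    have l: "1 \<le> l" using adm \<theta> by (intro admissible_l_ge_1)
    have \<xi>: "\<xi> = a + l *\<^sub>R u" using l by (simp add: u_def)
    have N: "1 \<le> N" "l \<le> 2 * N powr \<theta>" using adm by (auto simp: admissible_def)
    have u1: "1 \<le> jb u" by (rule jb_ge_1)
    have pos_case: "jb \<xi> powr s \<le> P powr s * (5 * jb u) powr (r * \<bar>s\<bar>)"
      if "0 \<le> s" "jb \<xi> \<le> P * (5 * jb u)" "1 \<le> P" for P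
    proof -
      have "jb \<xi> powr s \<le> (P * (5 * jb u)) powr s" using that by (intro powr_mono2) auto
      also have "\<dots> = P powr s * (5 * jb u) powr s" using that by (simp add: powr_mult)
      also have "\<dots> \<le> P powr s * (5 * jb u) powr (r * \<bar>s\<bar>)"
        using that s_le u1 by (intro mult_left_mono powr_mono) auto
      finally show ?thesis .
    qed
    show ?thesis
    proof (cases "a = 0")
      case True
      show ?thesis
      proof (cases "0 \<le> s")
        case s: True
        have "jb \<xi> \<le> l * jb u" using jb_scale_ge[OF l, of u] \<xi> True by simp
        also have "\<dots> \<le> (2 * N powr \<theta>) * jb u" using N by (intro mult_right_mono) auto
        also have "\<dots> \<le> N powr \<theta> * (5 * jb u)" by simp
        finally have "jb \<xi> powr s \<le> (N powr \<theta>) powr s * (5 * jb u) powr (r * \<bar>s\<bar>)"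
          using s N \<theta> by (intro pos_case) (auto intro: ge_one_powr_ge_zero)
        then show ?thesis using True s by (simp add: weight_order_def u_def powr_powr)
      next
        case False
        have "jb \<xi> powr s \<le> jb \<xi> powr 0" using False jb_ge_1[of \<xi>] by (intro powr_mono) auto
        also have "\<dots> \<le> 1 * 1" by simp
        also have "\<dots> \<le> N powr (\<theta> * \<bar>s\<bar>) * (5 * jb u) powr (r * \<bar>s\<bar>)"
          using N \<theta> r u1 by (intro mult_mono ge_one_powr_ge_zero) auto
        finally show ?thesis using True by (simp add: weight_order_def u_def)
      qed
    next
      case False
      then have a: "N \<le> norm a" "norm a \<le> 2 * N" using adm by (auto simp: admissible_def)
      have "N powr \<theta> \<le> N powr 1" using N \<theta> by (intro powr_mono) auto
      then have lN: "l \<le> 2 * N" using N by simp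
      have lu: "l * norm u \<le> l * jb u" using l norm_le_jb[of u] by (intro mult_left_mono) auto
      show ?thesis
      proof (cases "0 \<le> s")
        case s: True
        have "jb \<xi> \<le> 1 + (norm a + l * norm u)"
          using jb_le[of \<xi>] norm_triangle_ineq[of a "l *\<^sub>R u"] l \<xi> by simp
        also have "\<dots> \<le> N + 2 * N + 2 * N * jb u"
        proof -
          have "l * jb u \<le> 2 * N * jb u" using lN by (intro mult_right_mono) auto
          with lu a N show ?thesis by linarith
        qed
        also have "\<dots> \<le> N * (5 * jb u)"
        proof -
          have "3 * N * 1 \<le> 3 * N * jb u" using N u1 by (intro mult_left_mono) auto
          then show ?thesis by (simp add: algebra_simps)
        qed
        finally have "jb \<xi> powr s \<le> N powr s * (5 * jb u) powr (r * \<bar>s\<bar>)"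
          using s N by (intro pos_case)
        then show ?thesis using False by (simp add: weight_order_def u_def)
      next
        case s: False
        have "N \<le> jb \<xi> * (5 * jb u) powr r"
        proof (cases "N / 2 \<le> norm \<xi>")
          case True
          have "N \<le> jb \<xi> * 2" using True norm_le_jb[of \<xi>] by linarith
          also have "\<dots> \<le> jb \<xi> * (5 * jb u) powr r"
          proof (rule mult_left_mono)
            have "2 \<le> (5 * jb u) powr 1" using u1 by simp
            also have "\<dots> \<le> (5 * jb u) powr r" using r u1 by (intro powr_mono) auto
            finally show "2 \<le> (5 * jb u) powr r" .
          qed simp
          finally show ?thesis .
        next
          case far: False
          have "norm a \<le> norm \<xi> + l * norm u"
            using norm_triangle_ineq4[of \<xi> "l *\<^sub>R u"] l \<xi> by simp
          then have "N / 2 \<le> l * jb u" using far a lu by linarith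
          also have "\<dots> \<le> 2 * N powr \<theta> * jb u" using N by (intro mult_right_mono) auto
          finally have "N \<le> N powr \<theta> * (5 * jb u)" using u1 N by (simp add: algebra_simps)
          then have "N powr 1 / N powr \<theta> \<le> 5 * jb u" using N by (simp add: field_simps)
          then have "N powr (1 - \<theta>) \<le> 5 * jb u" by (simp add: powr_diff)
          then have "(N powr (1 - \<theta>)) powr r \<le> (5 * jb u) powr r" using r by (intro powr_mono2) auto
          then have "N \<le> (5 * jb u) powr r" using \<theta> N by (simp add: powr_powr r_def)
          also have "\<dots> \<le> jb \<xi> * (5 * jb u) powr r"
            using mult_right_mono[OF jb_ge_1[of \<xi>], of "(5 * jb u) powr r"] by simp
          finally show ?thesis .
        qed
        then have "(jb \<xi> * (5 * jb u) powr r) powr s \<le> N powr s"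
          using s N by (intro powr_mono2') auto
        then have "jb \<xi> powr s * (5 * jb u) powr (r * s) \<le> N powr s"
          by (simp add: powr_mult powr_powr)
        then have "jb \<xi> powr s * (5 * jb u) powr (r * s) * (5 * jb u) powr (r * \<bar>s\<bar>) \<le> N powr s * (5 * jb u) powr (r * \<bar>s\<bar>)"
          by (intro mult_right_mono) auto
        moreover have "(5 * jb u) powr (r * s) * (5 * jb u) powr (r * \<bar>s\<bar>) = 1"
          using s by (simp add: powr_add[symmetric])
        ultimately have "jb \<xi> powr s \<le> N powr s * (5 * jb u) powr (r * \<bar>s\<bar>)" by (simp add: mult.assoc)
        then show ?thesis using False by (simp add: weight_order_def u_def)
      qed
    qed
  qed
  show ?thesis
  proof (rule that[of "5 powr (r * \<bar>s\<bar>)" M])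
    fix N l and a \<xi> :: 'a assume adm: "admissible \<theta> N l a"
    let ?J = "jb ((1 / l) *\<^sub>R (\<xi> - a))"
    have J: "1 \<le> ?J" by (rule jb_ge_1)
    have "(5 * ?J) powr (r * \<bar>s\<bar>) = 5 powr (r * \<bar>s\<bar>) * ?J powr (r * \<bar>s\<bar>)" by (simp add: powr_mult)
    also have "\<dots> \<le> 5 powr (r * \<bar>s\<bar>) * ?J powr (real M)" using J M by (intro mult_left_mono powr_mono) auto
    finally have "N powr weight_order \<theta> s a * (5 * ?J) powr (r * \<bar>s\<bar>) \<le> N powr weight_order \<theta> s a * (5 powr (r * \<bar>s\<bar>) * ?J ^ M)"
      by (intro mult_left_mono) (simp_all add: powr_realpow)
    with main[OF adm, of \<xi>]
    show "jb \<xi> powr s \<le> 5 powr (r * \<bar>s\<bar>) * N powr weight_order \<theta> s a * ?J ^ M"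
      by (simp add: mult_ac)
  qed simp
qed

abbreviation packet_size :: "real \<Rightarrow> real \<Rightarrow> real \<Rightarrow> real \<Rightarrow> real \<Rightarrow> real \<Rightarrow> 'a::euclidean_space \<Rightarrow> real" where
  "packet_size c r s \<theta> N l a \<equiv> c * l powr (real DIM('a) * r) * N powr weight_order \<theta> s a"

text \<open>The two properties of a norm that the argument uses: on packets it behaves at most, or at
  least, like a weighted Lebesgue norm of the Fourier transform, where \<open>r\<close> is the reciprocal of the
  exponent. The lower bound refers to the exponent \<open>s\<close> of the dual weight, as it is meant for norms
  with the weight exponent \<open>-s\<close>.\<close>

definition packet_upper :: "('a::euclidean_space distribution \<Rightarrow> ennreal) \<Rightarrow> real \<Rightarrow> real \<Rightarrow> bool" where
  "packet_upper n r s \<longleftrightarrow> (\<forall>\<theta>. 0 < \<theta> \<longrightarrow> \<theta> < 1 \<longrightarrow> (\<exists>C>0. \<forall>N l a c. admissible \<theta> N l a \<longrightarrow> 0 \<le> c \<longrightarrow>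
     n (packet_distr c a l) \<le> ennreal (packet_size (C * c) r s \<theta> N l a)))"

definition packet_lower :: "('a::euclidean_space distribution \<Rightarrow> ennreal) \<Rightarrow> real \<Rightarrow> real \<Rightarrow> bool" where
  "packet_lower n r s \<longleftrightarrow> (\<forall>\<theta>. 0 < \<theta> \<longrightarrow> \<theta> < 1 \<longrightarrow> (\<exists>C>0. \<exists>N0. \<forall>N l a c. N0 \<le> N \<longrightarrow> admissible \<theta> N l a \<longrightarrow> 0 \<le> c \<longrightarrow>
     ennreal (C * c * l powr (real DIM('a) * r) * N powr (- weight_order \<theta> s a)) \<le> n (packet_distr c a l)))"

lemma Lebesgue_norm_weighted_bump_le:
  assumes q: "1 \<le> q" and \<theta>: "0 < \<theta>" "\<theta> < 1"
  obtains C where "0 < C" "\<And>N l (a::'a::euclidean_space) c. admissible \<theta> N l a \<Longrightarrow> 0 \<le> c \<Longrightarrow>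
     Lebesgue_norm q (\<lambda>\<xi>. ennreal (c * gaussian_bump a l \<xi> * jb \<xi> powr s))
       \<le> ennreal (packet_size (C * c) (recip q) s \<theta> N l a)"
proof -
  obtain W M where W: "0 < W" "\<And>N l (a::'a) \<xi>. admissible \<theta> N l a \<Longrightarrow>
     jb \<xi> powr s \<le> W * N powr weight_order \<theta> s a * jb ((1 / l) *\<^sub>R (\<xi> - a)) ^ M"
    using weight_bound[OF \<theta>, where s = s and 'a = 'a] by blast
  obtain G where G: "0 < G" "\<And>(a::'a) l \<xi>. gaussian_bump a l \<xi> \<le> G / jb ((1 / l) *\<^sub>R (\<xi> - a)) ^ (M + 2 * DIM('a))"
    using gaussian_bump_decay by blast
  define B where "B = bump_constant TYPE('a)"
  note B = bump_constant_pos[where 'a = 'a, folded B_def] Lebesgue_norm_bump_le[where 'a = 'a, folded B_def]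
  show ?thesis
  proof (rule that[of "B * (G * W)"])
    fix N l c :: real and a :: 'a assume adm: "admissible \<theta> N l a" and c: "0 \<le> c"
    have l: "1 \<le> l" using adm \<theta> by (intro admissible_l_ge_1)
    have [measurable]: "gaussian_bump a l \<in> borel_measurable borel"
      unfolding gaussian_bump_def by measurable
    have "c * gaussian_bump a l \<xi> * jb \<xi> powr s \<le> (c * (G * W) * N powr weight_order \<theta> s a) / jb ((1 / l) *\<^sub>R (\<xi> - a)) ^ (2 * DIM('a))" for \<xi>
    proof -
      let ?J = "jb ((1 / l) *\<^sub>R (\<xi> - a))"
      have "c * gaussian_bump a l \<xi> * jb \<xi> powr s \<le> c * (G / ?J ^ (M + 2 * DIM('a))) * (W * N powr weight_order \<theta> s a * ?J ^ M)"
        using c G(1) by (intro mult_mono mult_left_mono G(2) W(2)[OF adm]) auto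
      also have "\<dots> = (c * (G * W) * N powr weight_order \<theta> s a) / ?J ^ (2 * DIM('a))"
        by (simp add: power_add)
      finally show ?thesis .
    qed
    then have "Lebesgue_norm q (\<lambda>\<xi>. ennreal (c * gaussian_bump a l \<xi> * jb \<xi> powr s))
      \<le> ennreal (B * (c * (G * W) * N powr weight_order \<theta> s a) * l powr (real DIM('a) * recip q))"
      using c G(1) W(1) l by (intro B(2)[OF q]) (auto intro: ennreal_leI)
    then show "Lebesgue_norm q (\<lambda>\<xi>. ennreal (c * gaussian_bump a l \<xi> * jb \<xi> powr s))
       \<le> ennreal (packet_size (B * (G * W) * c) (recip q) s \<theta> N l a)"
      by (simp add: mult_ac)
  qed (use B G W in simp)
qed

lemma fourier_lebesgue_packet_upper:
  assumes q: "1 \<le> q"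
  shows "packet_upper (fourier_lebesgue_norm q s :: 'a::euclidean_space distribution \<Rightarrow> ennreal) (recip q) s"
  unfolding packet_upper_def
proof (intro allI impI)
  fix \<theta> :: real assume \<theta>: "0 < \<theta>" "\<theta> < 1"
  obtain C where C: "0 < C" "\<And>N l (a::'a) c. admissible \<theta> N l a \<Longrightarrow> 0 \<le> c \<Longrightarrow>
     Lebesgue_norm q (\<lambda>\<xi>. ennreal (c * gaussian_bump a l \<xi> * jb \<xi> powr s))
       \<le> ennreal (packet_size (C * c) (recip q) s \<theta> N l a)"
    using Lebesgue_norm_weighted_bump_le[OF q \<theta>, where s = s and 'a = 'a] by blast
  have "fourier_lebesgue_norm q s (packet_distr c a l) \<le> ennreal (packet_size (C * c) (recip q) s \<theta> N l a)"
    if adm: "admissible \<theta> N l a" and c: "0 \<le> c" for N l c :: real and a :: 'a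
  proof -
    have l: "0 < l" using admissible_l_ge_1[OF adm] \<theta> by simp
    have "fourier_lebesgue_norm q s (packet_distr c a l)
      \<le> Lebesgue_norm q (\<lambda>\<xi>. ennreal (norm (fourier (wave_packet c a l) \<xi>) * jb \<xi> powr s))"
      unfolding fourier_lebesgue_norm_def
      by (intro INF_lower) (simp add: represents_fourier schwartz_wave_packet l)
    also have "(\<lambda>\<xi>. ennreal (norm (fourier (wave_packet c a l) \<xi>) * jb \<xi> powr s)) = (\<lambda>\<xi>. ennreal (c * gaussian_bump a l \<xi> * jb \<xi> powr s))"
      using c by (simp add: fourier_wave_packet[OF l] norm_mult)
    finally show ?thesis using C(2)[OF adm c] by (rule order_trans)
  qed
  with C(1) show "\<exists>C>0. \<forall>N l (a::'a) c. admissible \<theta> N l a \<longrightarrow> 0 \<le> c \<longrightarrow>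
     fourier_lebesgue_norm q s (packet_distr c a l) \<le> ennreal (packet_size (C * c) (recip q) s \<theta> N l a)"
    by blast
qed

lemma integral_gaussian_bump:
  assumes "0 < l"
  shows "(LINT \<xi>|lborel. gaussian_bump a l (\<xi> :: 'a::euclidean_space)) = l ^ DIM('a) * (2 * pi) powr (real DIM('a) / 2)"
proof -
  have "(\<lambda>\<xi>. complex_of_real (gaussian_bump a l \<xi>)) \<in> borel_measurable borel"
    using assms by (intro schwartz_measurable schwartz_gaussian_bump)
  then have "(LINT \<xi>|lborel. complex_of_real (gaussian_bump a l \<xi>)) = l ^ DIM('a) *\<^sub>R (LINT z|lborel. complex_of_real (gaussian_bump a l (a + l *\<^sub>R z)))"
    using assms by (rule integral_lborel_affine)
  also have "(\<lambda>z. complex_of_real (gaussian_bump a l (a + l *\<^sub>R z))) = (\<lambda>z. complex_of_real (gauss z))"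
    using assms by (simp add: gaussian_bump_def)
  also have "(LINT z|lborel. complex_of_real (gauss (z::'a))) = complex_of_real ((2 * pi) powr (real DIM('a) / 2))"
    using gaussian_character_integral[of "0 :: 'a"] by simp
  finally have "complex_of_real (LINT \<xi>|lborel. gaussian_bump a l \<xi>) = complex_of_real (l ^ DIM('a) * (2 * pi) powr (real DIM('a) / 2))"
    by (simp add: scaleR_conv_of_real)
  then show ?thesis unfolding of_real_eq_iff .
qed

text \<open>Any representing function has a known pairing with the bump that the packet's transform is a
  multiple of. Its dual norm is bounded by the upper estimate with the exponents \<open>q\<close> and \<open>s\<close>.\<close>

lemma fourier_lebesgue_packet_lower:
  assumes q: "1 \<le> q"
  shows "packet_lower (fourier_lebesgue_norm (conj_exponent q) (- s) :: 'a::euclidean_space distribution \<Rightarrow> ennreal) (1 - recip q) s"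
  unfolding packet_lower_def
proof (intro allI impI)
  fix \<theta> :: real assume \<theta>: "0 < \<theta>" "\<theta> < 1"
  obtain C where C: "0 < C" "\<And>N l (a::'a) c. admissible \<theta> N l a \<Longrightarrow> 0 \<le> c \<Longrightarrow>
     Lebesgue_norm q (\<lambda>\<xi>. ennreal (c * gaussian_bump a l \<xi> * jb \<xi> powr s))
       \<le> ennreal (packet_size (C * c) (recip q) s \<theta> N l a)"
    using Lebesgue_norm_weighted_bump_le[OF q \<theta>, where s = s and 'a = 'a] by blast
  define D where "D = (1 / sqrt 2) ^ DIM('a) * (2 * pi) powr (real DIM('a) / 2)"
  have D: "0 < D" by (simp add: D_def)
  have "ennreal (D / C * c * l powr (real DIM('a) * (1 - recip q)) * N powr (- weight_order \<theta> s a))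
     \<le> fourier_lebesgue_norm (conj_exponent q) (- s) (packet_distr c a l)"
    if adm: "admissible \<theta> N l a" and c: "0 \<le> c" for N l c :: real and a :: 'a
    unfolding fourier_lebesgue_norm_def
  proof (rule INF_greatest)
    have l: "0 < l" using admissible_l_ge_1[OF adm] \<theta> by simp
    have N: "0 < N" using adm by (simp add: admissible_def)
    fix g assume "g \<in> {g. represents g (distr_fourier (packet_distr c a l))}"
    then have g: "represents g (distr_fourier (packet_distr c a l))" by simp
    then have [measurable]: "g \<in> borel_measurable borel" by (simp add: represents_def)
    have [measurable]: "gaussian_bump a l \<in> borel_measurable borel"
      unfolding gaussian_bump_def by measurable
    let ?\<psi> = "\<lambda>\<xi>. complex_of_real (gaussian_bump a l \<xi>)"
    have \<psi>: "?\<psi> \<in> schwartz" by (rule schwartz_gaussian_bump[OF l])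
    define V where "V = C * 1 * l powr (real DIM('a) * recip q) * N powr weight_order \<theta> s a"
    have V: "0 < V" using C(1) l N by (simp add: V_def)
    have pair: "(LINT \<xi>|lborel. g \<xi> * ?\<psi> \<xi>) = complex_of_real (c * (D * l ^ DIM('a)))"
    proof -
      have "(LINT \<xi>|lborel. g \<xi> * ?\<psi> \<xi>) = distr_fourier (packet_distr c a l) ?\<psi>"
        using g \<psi> by (simp add: represents_def distr_of_fun_def)
      also have "\<dots> = (LINT \<xi>|lborel. fourier (wave_packet c a l) \<xi> * ?\<psi> \<xi>)"
        using \<psi> fourier_multiplication_formula[OF schwartz_integrable[OF schwartz_wave_packet[OF l]] schwartz_integrable[OF \<psi>]]
        by (simp add: distr_fourier_def distr_of_fun_def schwartz_fourier)
      \<comment> \<open>the square of a bump is a bump whose width is smaller by the factor \<open>\<surd>2\<close>\<close>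
      also have "\<dots> = (LINT \<xi>|lborel. complex_of_real c * complex_of_real (gaussian_bump a (l / sqrt 2) \<xi>))"
      proof (intro Bochner_Integration.integral_cong refl)
        fix \<xi>
        have "gaussian_bump a l \<xi> * gaussian_bump a l \<xi> = gaussian_bump a (l / sqrt 2) \<xi>"
          unfolding gaussian_bump_def exp_add[symmetric] by (simp add: power_mult_distrib power_divide)
        then show "fourier (wave_packet c a l) \<xi> * ?\<psi> \<xi> = complex_of_real c * complex_of_real (gaussian_bump a (l / sqrt 2) \<xi>)"
          unfolding fourier_wave_packet[OF l] of_real_mult[symmetric] by (simp add: mult.assoc)
      qed
      also have "\<dots> = complex_of_real (c * (D * l ^ DIM('a)))"
        using l by (simp add: integral_gaussian_bump D_def power_divide)
      finally show ?thesis .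
    qed
    have "ennreal (c * (D * l ^ DIM('a)) / V) \<le> Lebesgue_norm (conj_exponent q) (\<lambda>\<xi>. ennreal (norm (g \<xi>) * jb \<xi> powr - s))"
    proof (rule Lebesgue_norm_ge_dual[OF q])
      show "Lebesgue_norm q (\<lambda>\<xi>. ennreal (gaussian_bump a l \<xi> * jb \<xi> powr s)) \<le> ennreal V"
        using C(2)[OF adm, of 1] by (simp add: V_def)
      have "ennreal (c * (D * l ^ DIM('a))) = ennreal (norm (LINT \<xi>|lborel. g \<xi> * ?\<psi> \<xi>))"
        unfolding pair norm_of_real using c D l by simp
      also have "\<dots> \<le> (\<integral>\<^sup>+\<xi>. ennreal (norm (g \<xi> * ?\<psi> \<xi>)) \<partial>lborel)"
        using g \<psi> by (intro integral_norm_bound_ennreal) (simp add: represents_def)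
      also have "\<dots> = (\<integral>\<^sup>+\<xi>. ennreal (norm (g \<xi>) * jb \<xi> powr - s * (gaussian_bump a l \<xi> * jb \<xi> powr s)) \<partial>lborel)"
        by (intro nn_integral_cong) (simp add: norm_mult powr_minus)
      finally show "ennreal (c * (D * l ^ DIM('a))) \<le> \<dots>" .
    qed (use V in auto)
    also have "c * (D * l ^ DIM('a)) / V = D / C * c * l powr (real DIM('a) * (1 - recip q)) * N powr (- weight_order \<theta> s a)"
      using C(1) l N by (simp add: V_def powr_realpow[symmetric] right_diff_distrib powr_diff powr_minus field_simps)
    finally show "ennreal (D / C * c * l powr (real DIM('a) * (1 - recip q)) * N powr (- weight_order \<theta> s a))
      \<le> Lebesgue_norm (conj_exponent q) (\<lambda>\<xi>. ennreal (norm (g \<xi>) * jb \<xi> powr - s))" .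
  qed
  with C(1) D show "\<exists>C>0. \<exists>N0. \<forall>N l (a::'a) c. N0 \<le> N \<longrightarrow> admissible \<theta> N l a \<longrightarrow> 0 \<le> c \<longrightarrow>
     ennreal (C * c * l powr (real DIM('a) * (1 - recip q)) * N powr (- weight_order \<theta> s a))
      \<le> fourier_lebesgue_norm (conj_exponent q) (- s) (packet_distr c a l)"
    by (intro exI[of _ "D / C"]) auto
qed


section \<open>Short-time Fourier transforms of wave packets\<close>

lemma stft_schwartz:
  assumes \<phi>: "\<phi> \<in> schwartz" and f: "f \<in> schwartz"
  shows "stft \<phi> (distr_of_fun f) x = fourier (\<lambda>y. f y * cnj (\<phi> (y - x)))"
proof -
  have w: "(\<lambda>y. cnj (\<phi> (y - x))) \<in> schwartz" by (intro schwartz_cnj schwartz_translate \<phi>)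
  let ?h = "\<lambda>y. f y * cnj (\<phi> (y - x))"
  have h: "?h \<in> schwartz" by (intro schwartz_mult f w)
  have "continuous_on UNIV (fourier ?h)" by (intro schwartz_continuous schwartz_fourier h)
  moreover have "represents (fourier ?h) (distr_fourier (distr_mult (distr_of_fun f) (\<lambda>y. cnj (\<phi> (y - x)))))"
    unfolding distr_mult_distr_of_fun[OF w] by (rule represents_fourier[OF h])
  ultimately show ?thesis
    unfolding stft_def by (intro the_equality) (auto intro: represents_unique_continuous)
qed

text \<open>The short-time Fourier transform of a packet in the rescaled variables \<open>\<tau> = 1 / l\<close> and
  \<open>\<eta> = (\<xi> - a) / l\<close>. The value \<open>\<tau> = 0\<close> is included as the limit of concentrated packets, for which the
  window acts as the constant \<open>cnj (\<phi> (- x))\<close>.\<close>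

definition packet_profile :: "('a::euclidean_space \<Rightarrow> complex) \<Rightarrow> real \<times> 'a \<times> 'a \<Rightarrow> complex" where
  "packet_profile \<phi> = (\<lambda>(\<tau>, x, \<eta>). LINT z|lborel.
     complex_of_real (gauss z) * cnj (\<phi> (\<tau> *\<^sub>R z - x)) * character (z \<bullet> \<eta>))"

lemma integrable_gaussian: "integrable lborel (\<lambda>z::'a::euclidean_space. gauss z)"
proof -
  have "integrable lborel (\<lambda>z::'a. complex_of_real (exp (- ((1 / 2) * (norm z)\<^sup>2))))"
    by (intro schwartz_integrable schwartz_gaussian) simp
  then show ?thesis unfolding complex_of_real_integrable_eq by simp
qed

lemma stft_wave_packet:
  fixes \<phi> :: "'a::euclidean_space \<Rightarrow> complex"
  assumes \<phi>: "\<phi> \<in> schwartz" and l: "0 < l"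
  shows "stft \<phi> (packet_distr c a l) x \<xi>
     = complex_of_real (fourier_factor DIM('a) * c) * packet_profile \<phi> (1 / l, x, (1 / l) *\<^sub>R (\<xi> - a))"
proof -
  have "(\<lambda>y. cnj (\<phi> (y - x))) \<in> borel_measurable borel"
    by (intro schwartz_measurable schwartz_cnj schwartz_translate \<phi>)
  then show ?thesis
    unfolding stft_schwartz[OF \<phi> schwartz_wave_packet[OF l]] packet_profile_def prod.case
    by (rule fourier_wave_packet_mult[OF l])
qed

lemma continuous_packet_profile:
  fixes \<phi> :: "'a::euclidean_space \<Rightarrow> complex"
  assumes \<phi>: "\<phi> \<in> schwartz"
  shows "continuous_on UNIV (packet_profile \<phi>)"
proof (rule continuous_at_imp_continuous_on, intro ballI)
  fix p :: "real \<times> 'a \<times> 'a"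
  have cont: "continuous_on UNIV \<phi>" by (rule schwartz_continuous[OF \<phi>])
  obtain C where C: "\<And>x. norm (\<phi> x) \<le> C" using schwartz_bounded[OF \<phi>] by blast
  define k where "k = (\<lambda>(\<tau>, x, \<eta>) z. complex_of_real (gauss z) * cnj (\<phi> (\<tau> *\<^sub>R z - x)) * character (z \<bullet> (\<eta>::'a)))"
  have prof: "packet_profile \<phi> p = (LINT z|lborel. k p z)" for p
    by (simp add: packet_profile_def k_def split_beta)
  have kmeas: "k p \<in> borel_measurable borel" for p
  proof (rule borel_measurable_continuous_onI)
    show "continuous_on UNIV (k p)"
      unfolding k_def split_beta
      by (intro continuous_intros continuous_on_compose2[OF cont]) auto
  qed
  have "(\<lambda>n. LINT z|lborel. k (q n) z) \<longlonglongrightarrow> (LINT z|lborel. k p z)" if q: "q \<longlonglongrightarrow> p" for q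
  proof (rule integral_dominated_convergence[where w = "\<lambda>z. gauss z * C"])
    show "integrable lborel (\<lambda>z::'a. gauss z * C)" by (intro integrable_mult_left integrable_gaussian)
    show "k p \<in> borel_measurable lborel" "k (q n) \<in> borel_measurable lborel" for n
      using kmeas by simp_all
    show "AE z in lborel. norm (k (q n) z) \<le> gauss z * C" for n
      unfolding k_def split_beta by (intro AE_I2) (simp add: norm_mult C mult_left_mono)
    show "AE z in lborel. (\<lambda>n. k (q n) z) \<longlonglongrightarrow> k p z"
    proof (rule AE_I2)
      fix z :: 'a
      have lims: "(\<lambda>n. fst (q n)) \<longlonglongrightarrow> fst p" "(\<lambda>n. fst (snd (q n))) \<longlonglongrightarrow> fst (snd p)"
        "(\<lambda>n. snd (snd (q n))) \<longlonglongrightarrow> snd (snd p)"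
        using q by (auto intro: tendsto_fst tendsto_snd)
      have "(\<lambda>n. \<phi> (fst (q n) *\<^sub>R z - fst (snd (q n)))) \<longlonglongrightarrow> \<phi> (fst p *\<^sub>R z - fst (snd p))"
        by (rule continuous_on_tendsto_compose[OF cont]) (auto intro!: tendsto_intros lims)
      then show "(\<lambda>n. k (q n) z) \<longlonglongrightarrow> k p z"
        unfolding k_def split_beta by (intro tendsto_intros lims)
    qed
  qed
  then show "isCont (packet_profile \<phi>) p"
    by (auto simp: continuous_at_sequentially o_def prof)
qed

text \<open>The packet is concentrated near the origin on a scale of at most \<open>1\<close>, so that the decay of
  the window in \<open>x\<close> is inherited uniformly in \<open>\<tau>\<close>.\<close>

lemma packet_profile_decay_space:
  fixes \<phi> :: "'a::euclidean_space \<Rightarrow> complex"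
  assumes \<phi>: "\<phi> \<in> schwartz"
  obtains C where "0 < C" "\<And>\<tau> x \<eta>. \<bar>\<tau>\<bar> \<le> 1 \<Longrightarrow> norm (packet_profile \<phi> (\<tau>, x, \<eta>)) \<le> C / jb x ^ k"
proof -
  obtain A where A: "0 < A" "\<And>x. norm (\<phi> x) \<le> A / jb x ^ k"
    using rapid_decayD[OF schwartz_rapid_decay[OF \<phi>]] by blast
  have [measurable]: "\<phi> \<in> borel_measurable borel" by (rule schwartz_measurable[OF \<phi>])
  let ?g = "\<lambda>z::'a. gauss z"
  have "rapid_decay (\<lambda>z::'a. complex_of_real (jb z ^ k) * complex_of_real (exp (- ((1 / 2) * (norm z)\<^sup>2))))"
    by (intro rapid_decay_mult_poly[of _ _ 1 k] gaussian_rapid_decay) (auto simp: norm_power)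
  then have "integrable lborel (\<lambda>z::'a. complex_of_real (jb z ^ k) * complex_of_real (exp (- ((1 / 2) * (norm z)\<^sup>2))))"
    by (rule rapid_decay_integrable) measurable
  then have intg: "integrable lborel (\<lambda>z::'a. ?g z * jb z ^ k)"
    unfolding of_real_mult[symmetric] complex_of_real_integrable_eq by (simp add: mult.commute)
  define I where "I = (LINT z|(lborel :: 'a measure). ?g z * jb z ^ k)"
  have I: "0 \<le> I" unfolding I_def by (intro integral_nonneg_AE AE_I2) auto
  have "norm (packet_profile \<phi> (\<tau>, x, \<eta>)) \<le> (A * 2 ^ k * (I + 1)) / jb x ^ k" if \<tau>: "\<bar>\<tau>\<bar> \<le> 1" for \<tau> x \<eta>
  proof -
    have le: "norm (\<phi> (\<tau> *\<^sub>R z - x)) \<le> A * 2 ^ k / jb x ^ k * jb z ^ k" for z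
    proof -
      have "jb x = jb ((\<tau> *\<^sub>R z - x) + - (\<tau> *\<^sub>R z))" by simp
      also have "\<dots> \<le> 2 * jb (\<tau> *\<^sub>R z - x) * jb (- (\<tau> *\<^sub>R z))" by (rule jb_add)
      also have "\<dots> \<le> 2 * jb (\<tau> *\<^sub>R z - x) * jb z" using jb_scale_le[OF \<tau>, of z] by (intro mult_left_mono) auto
      finally have "jb x ^ k \<le> (2 * jb (\<tau> *\<^sub>R z - x) * jb z) ^ k" by (intro power_mono) auto
      then have "A / jb (\<tau> *\<^sub>R z - x) ^ k \<le> A * 2 ^ k / jb x ^ k * jb z ^ k"
        using A(1) by (simp add: field_simps power_mult_distrib)
      with A(2) show ?thesis by (rule order_trans)
    qed
    have "norm (packet_profile \<phi> (\<tau>, x, \<eta>)) \<le> (LINT z|lborel. norm (complex_of_real (?g z) * cnj (\<phi> (\<tau> *\<^sub>R z - x)) * character (z \<bullet> \<eta>)))"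
      unfolding packet_profile_def prod.case by (rule integral_norm_bound)
    also have "\<dots> \<le> (LINT z|lborel. A * 2 ^ k / jb x ^ k * (?g z * jb z ^ k))"
    proof (rule integral_mono_AE')
      show "integrable lborel (\<lambda>z. A * 2 ^ k / jb x ^ k * (?g z * jb z ^ k))"
        by (intro integrable_mult_right intg)
      show "AE z in lborel. norm (complex_of_real (?g z) * cnj (\<phi> (\<tau> *\<^sub>R z - x)) * character (z \<bullet> \<eta>))
         \<le> A * 2 ^ k / jb x ^ k * (?g z * jb z ^ k)"
      proof (rule AE_I2)
        fix z
        show "norm (complex_of_real (?g z) * cnj (\<phi> (\<tau> *\<^sub>R z - x)) * character (z \<bullet> \<eta>))
         \<le> A * 2 ^ k / jb x ^ k * (?g z * jb z ^ k)"
          using mult_left_mono[OF le[of z], of "?g z"] by (simp add: norm_mult mult_ac)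
      qed
    qed (use A(1) in \<open>intro AE_I2, simp\<close>)
    also have "\<dots> = A * 2 ^ k / jb x ^ k * I" by (simp add: I_def)
    also have "\<dots> \<le> A * 2 ^ k / jb x ^ k * (I + 1)" using A(1) by (intro mult_left_mono) auto
    finally show ?thesis by simp
  qed
  then show ?thesis using A(1) I by (intro that[of "A * 2 ^ k * (I + 1)"]) auto
qed

text \<open>The multiplication formula moves the Fourier transform from the packet to the translated
  and modulated window. What remains is essentially the convolution of a bump of width \<open>l \<ge> 1\<close> with the
  rapidly decreasing transform of the window, which does not see the scale \<open>l\<close>.\<close>

lemma stft_wave_packet_decay_frequency:
  fixes \<phi> :: "'a::euclidean_space \<Rightarrow> complex"
  assumes \<phi>: "\<phi> \<in> schwartz"
  obtains C where "0 < C" "\<And>c l a x \<xi>. 0 \<le> c \<Longrightarrow> 1 \<le> l \<Longrightarrow>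
    norm (stft \<phi> (packet_distr c a l) x \<xi>) \<le> C * c / jb ((1 / l) *\<^sub>R (\<xi> - a)) ^ k"
proof -
  have c\<phi>: "(\<lambda>y. cnj (\<phi> y)) \<in> schwartz" by (rule schwartz_cnj[OF \<phi>])
  have [measurable]: "\<phi> \<in> borel_measurable borel" by (rule schwartz_measurable[OF \<phi>])
  obtain B where B: "0 < B" "\<And>\<zeta>. norm (fourier (\<lambda>y. cnj (\<phi> y)) \<zeta>) \<le> B / jb \<zeta> ^ (k + 2 * DIM('a))"
    using rapid_decayD[OF fourier_rapid_decay[OF c\<phi>]] by blast
  obtain G where G: "0 < G" "\<And>(a::'a) l \<xi>. gaussian_bump a l \<xi> \<le> G / jb ((1 / l) *\<^sub>R (\<xi> - a)) ^ k"
    using gaussian_bump_decay by blast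
  define I where "I = (LINT x|(lborel :: 'a measure). 1 / jb x ^ (2 * DIM('a)))"
  have I: "0 \<le> I" unfolding I_def by (intro integral_nonneg_AE AE_I2) auto
  let ?F = "fourier_factor DIM('a)"
  have "norm (stft \<phi> (packet_distr c a l) x \<xi>) \<le> (?F * (G * 2 ^ k * B * (I + 1))) * c / jb ((1 / l) *\<^sub>R (\<xi> - a)) ^ k"
    if c: "0 \<le> c" and l: "1 \<le> l" for c l a x \<xi>
  proof -
    let ?u = "(1 / l) *\<^sub>R (\<xi> - a)"
    let ?G = "\<lambda>\<eta>. complex_of_real (c * gaussian_bump (- a) l \<eta>)"
    let ?h = "\<lambda>y. cnj (\<phi> (y - x)) * character (y \<bullet> \<xi>)"
    have l0: "0 < l" using l by simp
    have w: "(\<lambda>y. cnj (\<phi> (y - x))) \<in> schwartz" by (intro schwartz_cnj schwartz_translate \<phi>)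
    have int_h: "integrable lborel ?h" by (intro integrable_character_mult schwartz_integrable w)
    have int_G: "integrable lborel ?G"
      unfolding of_real_mult by (intro integrable_mult_right schwartz_integrable schwartz_gaussian_bump l0)
    have "stft \<phi> (packet_distr c a l) x \<xi> = ?F *\<^sub>R (LINT y|lborel. wave_packet c a l y * ?h y)"
      unfolding stft_schwartz[OF \<phi> schwartz_wave_packet[OF l0]] fourier_def by (simp add: mult.assoc)
    also have "(LINT y|lborel. wave_packet c a l y * ?h y) = (LINT \<eta>|lborel. ?G \<eta> * fourier ?h \<eta>)"
      unfolding wave_packet_eq_fourier[OF l0] by (rule fourier_multiplication_formula[OF int_G int_h])
    finally have st: "norm (stft \<phi> (packet_distr c a l) x \<xi>) = ?F * norm (LINT \<eta>|lborel. ?G \<eta> * fourier ?h \<eta>)"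
      by simp
    have four_h: "norm (fourier ?h \<eta>) = norm (fourier (\<lambda>y. cnj (\<phi> y)) (\<eta> + \<xi>))" for \<eta>
    proof -
      have "fourier ?h \<eta> = fourier (\<lambda>y. cnj (\<phi> (y - x))) (\<eta> + \<xi>)"
        unfolding fourier_def
        by (simp add: mult.assoc exp_add[symmetric] inner_add_right algebra_simps)
      then show ?thesis using fourier_translate[OF schwartz_measurable[OF c\<phi>], of x "\<eta> + \<xi>"] by (simp add: norm_mult)
    qed
    let ?K = "c * (G * 2 ^ k * B) / jb ?u ^ k"
    have le: "norm (?G \<eta> * fourier ?h \<eta>) \<le> ?K * (1 / jb (\<xi> + \<eta>) ^ (2 * DIM('a)))" for \<eta>
    proof -
      let ?v = "(1 / l) *\<^sub>R (\<eta> - - a)"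
      \<comment> \<open>for \<open>\<xi>\<close> far from \<open>a\<close>, either \<open>\<eta>\<close> is far from the bump, or \<open>\<xi> + \<eta>\<close> is far from the origin\<close>
      have "jb ?u = jb ((1 / l) *\<^sub>R (\<xi> + \<eta>) + - ?v)" by (simp add: algebra_simps)
      also have "\<dots> \<le> 2 * jb ((1 / l) *\<^sub>R (\<xi> + \<eta>)) * jb (- ?v)" by (rule jb_add)
      also have "\<dots> \<le> 2 * jb (\<xi> + \<eta>) * jb (- ?v)"
        using l by (intro mult_right_mono mult_left_mono jb_scale_le) auto
      finally have "jb ?u \<le> 2 * jb (\<xi> + \<eta>) * jb ?v" unfolding jb_minus .
      then have "jb ?u ^ k \<le> (2 * jb (\<xi> + \<eta>) * jb ?v) ^ k" by (intro power_mono) auto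
      then have v: "G / jb ?v ^ k \<le> G * 2 ^ k * jb (\<xi> + \<eta>) ^ k / jb ?u ^ k"
        using G(1) by (simp add: field_simps power_mult_distrib)
      have "norm (?G \<eta> * fourier ?h \<eta>) = c * gaussian_bump (- a) l \<eta> * norm (fourier (\<lambda>y. cnj (\<phi> y)) (\<eta> + \<xi>))"
        using c by (simp add: norm_mult four_h)
      also have "\<dots> \<le> c * (G * 2 ^ k * jb (\<xi> + \<eta>) ^ k / jb ?u ^ k) * (B / jb (\<eta> + \<xi>) ^ (k + 2 * DIM('a)))"
        using c G(1) by (intro mult_mono mult_left_mono B(2) order_trans[OF G(2) v]) auto
      also have "\<dots> = ?K * (1 / jb (\<xi> + \<eta>) ^ (2 * DIM('a)))" by (simp add: power_add add.commute[of \<eta>])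
      finally show ?thesis .
    qed
    have "norm (LINT \<eta>|lborel. ?G \<eta> * fourier ?h \<eta>) \<le> (LINT \<eta>|lborel. norm (?G \<eta> * fourier ?h \<eta>))"
      by (rule integral_norm_bound)
    also have "\<dots> \<le> (LINT \<eta>|lborel. ?K * (1 / jb (\<xi> + \<eta>) ^ (2 * DIM('a))))"
    proof (rule integral_mono_AE')
      have "integrable (distr lborel borel ((+) \<xi>)) (\<lambda>\<eta>::'a. 1 / jb \<eta> ^ (2 * DIM('a)))"
        using integrable_inverse_jb by (simp add: lborel_distr_plus)
      then have "integrable lborel (\<lambda>\<eta>. 1 / jb (\<xi> + \<eta>) ^ (2 * DIM('a)))"
        by (subst (asm) integrable_distr_eq) auto
      then show "integrable lborel (\<lambda>\<eta>. ?K * (1 / jb (\<xi> + \<eta>) ^ (2 * DIM('a))))"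
        by (rule integrable_mult_right)
      show "AE \<eta> in lborel. norm (?G \<eta> * fourier ?h \<eta>) \<le> ?K * (1 / jb (\<xi> + \<eta>) ^ (2 * DIM('a)))"
        by (intro AE_I2 le)
    qed (use c G(1) B(1) in \<open>intro AE_I2, simp\<close>)
    also have "\<dots> = ?K * I"
      unfolding I_def
      by (subst integral_mult_right_zero, subst integral_lborel_translate[of "\<lambda>\<eta>. 1 / jb \<eta> ^ (2 * DIM('a))"]) auto
    also have "\<dots> \<le> ?K * (I + 1)" using c G(1) B(1) by (intro mult_left_mono) auto
    finally have "?F * norm (LINT \<eta>|lborel. ?G \<eta> * fourier ?h \<eta>) \<le> ?F * (?K * (I + 1))"
      by (intro mult_left_mono) auto
    then show ?thesis unfolding st by (simp add: mult_ac)
  qed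
  then show ?thesis using G(1) B(1) I by (intro that[of "?F * (G * 2 ^ k * B * (I + 1))"]) auto
qed

text \<open>The geometric mean of the decay in space and the decay in frequency.\<close>

lemma stft_wave_packet_decay:
  fixes \<phi> :: "'a::euclidean_space \<Rightarrow> complex"
  assumes \<phi>: "\<phi> \<in> schwartz"
  obtains C where "0 < C" "\<And>c l a x \<xi>. 0 \<le> c \<Longrightarrow> 1 \<le> l \<Longrightarrow>
    norm (stft \<phi> (packet_distr c a l) x \<xi>) \<le> C * c / (jb x ^ k * jb ((1 / l) *\<^sub>R (\<xi> - a)) ^ k)"
proof -
  let ?F = "fourier_factor DIM('a)"
  obtain A where A: "0 < A" "\<And>\<tau> x \<eta>. \<bar>\<tau>\<bar> \<le> 1 \<Longrightarrow> norm (packet_profile \<phi> (\<tau>, x, \<eta>)) \<le> A / jb x ^ (2 * k)"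
    using packet_profile_decay_space[OF \<phi>] by blast
  obtain B where B: "0 < B" "\<And>c l a x \<xi>. 0 \<le> c \<Longrightarrow> 1 \<le> l \<Longrightarrow>
    norm (stft \<phi> (packet_distr c a l) x \<xi>) \<le> B * c / jb ((1 / l) *\<^sub>R (\<xi> - a)) ^ (2 * k)"
    using stft_wave_packet_decay_frequency[OF \<phi>] by blast
  have "norm (stft \<phi> (packet_distr c a l) x \<xi>) \<le> sqrt (?F * A * B) * c / (jb x ^ k * jb ((1 / l) *\<^sub>R (\<xi> - a)) ^ k)"
    if c: "0 \<le> c" and l: "1 \<le> l" for c l a x \<xi>
  proof (rule power2_le_imp_le)
    let ?V = "norm (stft \<phi> (packet_distr c a l) x \<xi>)"
    let ?u = "jb ((1 / l) *\<^sub>R (\<xi> - a))"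
    have "?V \<le> ?F * c * (A / jb x ^ (2 * k))"
    proof -
      have "?V = ?F * c * norm (packet_profile \<phi> (1 / l, x, (1 / l) *\<^sub>R (\<xi> - a)))"
        using l c by (subst stft_wave_packet[OF \<phi>]) (auto simp: norm_mult)
      also have "\<dots> \<le> ?F * c * (A / jb x ^ (2 * k))"
        using l c by (intro mult_left_mono A(2)) auto
      finally show ?thesis .
    qed
    then have "?V * ?V \<le> (?F * c * (A / jb x ^ (2 * k))) * (B * c / ?u ^ (2 * k))"
      using c A(1) by (intro mult_mono B(2) l) auto
    also have "\<dots> = (sqrt (?F * A * B) * c / (jb x ^ k * ?u ^ k))\<^sup>2"
      using A(1) B(1) by (simp add: power_mult_distrib power_divide power_mult[symmetric] mult.commute[of 2 k] power2_eq_square[of c] mult_ac)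
    finally show "?V\<^sup>2 \<le> (sqrt (?F * A * B) * c / (jb x ^ k * ?u ^ k))\<^sup>2" by (simp add: power2_eq_square)
    show "0 \<le> sqrt (?F * A * B) * c / (jb x ^ k * ?u ^ k)" using c A(1) B(1) by simp
  qed
  then show ?thesis using A(1) B(1) by (intro that[of "sqrt (?F * A * B)"]) auto
qed

text \<open>At \<open>p = \<infinity>\<close> continuity turns the essential supremum into a supremum, so that the function is
  lower semicontinuous; otherwise this is part of Tonelli's theorem.\<close>

lemma borel_measurable_Lebesgue_norm:
  fixes h :: "'a::euclidean_space \<Rightarrow> 'b::euclidean_space \<Rightarrow> real"
  assumes p: "1 \<le> p" and h: "continuous_on UNIV (\<lambda>(\<xi>, x). h \<xi> x)"
  shows "(\<lambda>\<xi>. Lebesgue_norm p (\<lambda>x. ennreal (h \<xi> x))) \<in> borel_measurable borel"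
  using p
proof (cases rule: exponent_cases)
  case top
  have cx: "continuous_on UNIV (h \<xi>)" for \<xi>
  proof -
    have "continuous_on UNIV (\<lambda>x. (\<xi>, x))" by (intro continuous_on_Pair continuous_on_const continuous_on_id)
    from continuous_on_compose2[OF h this] show ?thesis by simp
  qed
  have c\<xi>: "continuous_on UNIV (\<lambda>\<xi>. h \<xi> x)" for x
  proof -
    have "continuous_on UNIV (\<lambda>\<xi>. (\<xi>, x))" by (intro continuous_on_Pair continuous_on_const continuous_on_id)
    from continuous_on_compose2[OF h this] show ?thesis by simp
  qed
  have eq: "{\<xi>. y < Lebesgue_norm p (\<lambda>x. ennreal (h \<xi> x))} = (\<Union>x. {\<xi>. y < ennreal (h \<xi> x)})" for y
  proof (intro set_eqI iffI)
    fix \<xi> assume "\<xi> \<in> {\<xi>. y < Lebesgue_norm p (\<lambda>x. ennreal (h \<xi> x))}"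
    then have y: "y < esssup lborel (\<lambda>x. ennreal (h \<xi> x))" using top by (simp add: Lebesgue_norm_def)
    show "\<xi> \<in> (\<Union>x. {\<xi>. y < ennreal (h \<xi> x)})"
    proof (rule ccontr)
      assume "\<xi> \<notin> (\<Union>x. {\<xi>. y < ennreal (h \<xi> x)})"
      then have "\<And>x. ennreal (h \<xi> x) \<le> y" by (auto simp: not_less)
      moreover have "(\<lambda>x. ennreal (h \<xi> x)) \<in> borel_measurable lborel"
        using borel_measurable_continuous_onI[OF cx[of \<xi>]] by measurable
      ultimately have "esssup lborel (\<lambda>x. ennreal (h \<xi> x)) \<le> y" by (intro esssup_I) auto
      with y show False by simp
    qed
  next
    fix \<xi> assume "\<xi> \<in> (\<Union>x. {\<xi>. y < ennreal (h \<xi> x)})"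
    then obtain x where "y < ennreal (h \<xi> x)" by blast
    then obtain m where m: "y < ennreal m" "ennreal m < ennreal (h \<xi> x)" "0 \<le> m"
      by (metis dense ennreal_cases less_top_ennreal order_less_imp_not_less top.not_eq_extremum)
    have "open {x. m < h \<xi> x}" by (intro open_Collect_less cx continuous_intros)
    moreover have "m < h \<xi> x" using m by (simp add: ennreal_less_iff)
    ultimately obtain r where r: "0 < r" "ball x r \<subseteq> {x. m < h \<xi> x}"
      by (auto simp: open_contains_ball)
    have pos: "0 < measure lborel (ball x r)" using r by (simp add: content_ball)
    have "ennreal (m * measure lborel (ball x r) powr recip p) \<le> Lebesgue_norm p (\<lambda>x. ennreal (h \<xi> x))"
    proof (rule Lebesgue_norm_ge[OF p _ _ m(3)])
      fix x' assume "x' \<in> ball x r"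
      then have "m < h \<xi> x'" using r(2) by blast
      then show "ennreal m \<le> ennreal (h \<xi> x')" by (intro ennreal_leI) simp
    qed (use pos in auto)
    then have "ennreal m \<le> Lebesgue_norm p (\<lambda>x. ennreal (h \<xi> x))"
      using top pos by simp
    with m show "\<xi> \<in> {\<xi>. y < Lebesgue_norm p (\<lambda>x. ennreal (h \<xi> x))}" by (auto intro: less_le_trans)
  qed
  have "open (\<Union>x. {\<xi>. y < ennreal (h \<xi> x)})" for y
    by (intro open_UN ballI open_Collect_less continuous_on_ennreal c\<xi> continuous_intros)
  then show ?thesis
    by (intro borel_measurableI_greater) (simp add: eq)
next
  case (real P)
  have "(\<lambda>(\<xi>, x). h \<xi> x) \<in> borel_measurable (borel \<Otimes>\<^sub>M borel)"
    unfolding borel_prod by (rule borel_measurable_continuous_onI[OF h])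
  then have [measurable]: "(\<lambda>(\<xi>, x). h \<xi> x) \<in> borel_measurable (borel \<Otimes>\<^sub>M lborel)"
    by (simp cong: measurable_cong_sets sets_pair_measure_cong)
  have "(\<lambda>\<xi>. \<integral>\<^sup>+ x. ennreal_powr (ennreal (h \<xi> x)) P \<partial>lborel) \<in> borel_measurable borel"
    by (intro lborel.borel_measurable_nn_integral) measurable
  then show ?thesis
    unfolding real(1) Lebesgue_norm_finite[OF real(2)] by measurable
qed


section \<open>Modulation and Wiener amalgam norms of wave packets\<close>

lemma powr_jb_le:
  fixes j t :: real
  assumes "1 \<le> j"
  shows "j powr t \<le> j ^ nat \<lceil>\<bar>t\<bar>\<rceil>"
proof -
  have "t \<le> real (nat \<lceil>\<bar>t\<bar>\<rceil>)" by linarith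
  then have "j powr t \<le> j powr real (nat \<lceil>\<bar>t\<bar>\<rceil>)" using assms by (intro powr_mono)
  also have "\<dots> = j ^ nat \<lceil>\<bar>t\<bar>\<rceil>" using assms by (intro powr_realpow) simp
  finally show ?thesis .
qed

text \<open>The bound is the product of a fixed integrable function of \<open>x\<close> and a bump in \<open>\<xi>\<close>. Hence the order
  of the two norms, the exponent \<open>p\<close> and the weight in \<open>x\<close> affect only constants.\<close>

lemma weighted_stft_upper:
  fixes \<phi> :: "'a::euclidean_space \<Rightarrow> complex"
  assumes \<phi>: "\<phi> \<in> schwartz" and \<theta>: "0 < \<theta>" "\<theta> < 1"
  obtains C where "0 < C" "\<And>N l a c x \<xi>. admissible \<theta> N l a \<Longrightarrow> 0 \<le> c \<Longrightarrow>
     weighted_stft \<phi> s t (packet_distr c a l) x \<xi>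
       \<le> ennreal (C * c * N powr weight_order \<theta> s a / (jb x ^ (2 * DIM('a)) * jb ((1 / l) *\<^sub>R (\<xi> - a)) ^ (2 * DIM('a))))"
proof -
  obtain W M where W: "0 < W" "\<And>N l (a::'a) \<xi>. admissible \<theta> N l a \<Longrightarrow>
     jb \<xi> powr s \<le> W * N powr weight_order \<theta> s a * jb ((1 / l) *\<^sub>R (\<xi> - a)) ^ M"
    using weight_bound[OF \<theta>, where s = s and 'a = 'a] by blast
  define m where "m = nat \<lceil>\<bar>t\<bar>\<rceil>"
  let ?d = "2 * DIM('a)"
  obtain A where A: "0 < A" "\<And>c l a x \<xi>. 0 \<le> c \<Longrightarrow> 1 \<le> l \<Longrightarrow>
    norm (stft \<phi> (packet_distr c a l) x \<xi>) \<le> A * c / (jb x ^ (m + M + ?d) * jb ((1 / l) *\<^sub>R (\<xi> - a)) ^ (m + M + ?d))"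
    using stft_wave_packet_decay[OF \<phi>, where k = "m + M + ?d"] by blast
  show ?thesis
  proof (rule that[of "A * W"])
    fix N l c :: real and a x \<xi> :: 'a assume adm: "admissible \<theta> N l a" and c: "0 \<le> c"
    have l: "1 \<le> l" using adm \<theta> by (intro admissible_l_ge_1)
    let ?X = "jb x" and ?U = "jb ((1 / l) *\<^sub>R (\<xi> - a))"
    let ?w = "W * N powr weight_order \<theta> s a"
    have ge: "1 \<le> ?X" "1 \<le> ?U" by (rule jb_ge_1)+
    have "norm (stft \<phi> (packet_distr c a l) x \<xi>) * ?X powr t * jb \<xi> powr s
       \<le> A * c / (?X ^ (m + M + ?d) * ?U ^ (m + M + ?d)) * ?X ^ m * (?w * ?U ^ M)"
    proof (intro mult_mono)
      show "norm (stft \<phi> (packet_distr c a l) x \<xi>) \<le> A * c / (?X ^ (m + M + ?d) * ?U ^ (m + M + ?d))"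
        using A(2)[OF c l] .
      show "?X powr t \<le> ?X ^ m" unfolding m_def by (rule powr_jb_le[OF ge(1)])
      show "jb \<xi> powr s \<le> ?w * ?U ^ M" by (rule W(2)[OF adm])
    qed (use A(1) c in auto)
    also have "\<dots> = (A * c * ?w) / (?X ^ (M + ?d) * ?U ^ (m + ?d))"
      by (simp add: power_add)
    also have "\<dots> \<le> (A * c * ?w) / (?X ^ ?d * ?U ^ ?d)"
      using A(1) c W(1) ge by (intro divide_left_mono mult_mono power_increasing) auto
    finally show "weighted_stft \<phi> s t (packet_distr c a l) x \<xi>
       \<le> ennreal (A * W * c * N powr weight_order \<theta> s a / (?X ^ ?d * ?U ^ ?d))"
      unfolding weighted_stft_def by (intro ennreal_leI) (simp add: mult_ac)
  qed (use A W in simp)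
qed

lemma continuous_stft_wave_packet:
  fixes \<phi> :: "'a::euclidean_space \<Rightarrow> complex"
  assumes \<phi>: "\<phi> \<in> schwartz" and l: "0 < l"
  shows "continuous_on UNIV (\<lambda>p. norm (stft \<phi> (packet_distr c a l) (fst p) (snd p)) * jb (fst p) powr t * jb (snd p) powr s)"
proof -
  have "continuous_on UNIV (\<lambda>p::'a \<times> 'a. packet_profile \<phi> (1 / l, fst p, (1 / l) *\<^sub>R (snd p - a)))"
    by (rule continuous_on_compose2[OF continuous_packet_profile[OF \<phi>]]) (intro continuous_intros, auto)
  then show ?thesis
    unfolding stft_wave_packet[OF \<phi> l] by (intro continuous_intros) auto
qed

lemma modulation_and_amalgam_packet_upper:
  fixes \<phi> :: "'a::euclidean_space \<Rightarrow> complex"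
  assumes \<phi>: "\<phi> \<in> schwartz" and p: "1 \<le> p" and q: "1 \<le> q"
  shows "packet_upper (modulation_norm \<phi> p q s t) (recip q) s"
    and "packet_upper (wiener_amalgam_norm \<phi> p q s t) (recip q) s"
proof -
  let ?M = "modulation_norm \<phi> p q s t" and ?W = "wiener_amalgam_norm \<phi> p q s t"
  let ?d = "2 * DIM('a)"
  define B where "B = bump_constant TYPE('a)"
  note B = bump_constant_pos[where 'a = 'a, folded B_def] Lebesgue_norm_bump_le[where 'a = 'a, folded B_def]
  have "\<exists>C>0. \<forall>N l a c. admissible \<theta> N l a \<longrightarrow> 0 \<le> c \<longrightarrow>
     ?M (packet_distr c a l) \<le> ennreal (packet_size (C * c) (recip q) s \<theta> N l a)
   \<and> ?W (packet_distr c a l) \<le> ennreal (packet_size (C * c) (recip q) s \<theta> N l a)"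
    if \<theta>: "0 < \<theta>" "\<theta> < 1" for \<theta>
  proof -
    obtain C where C: "0 < C" "\<And>N l a c x \<xi>. admissible \<theta> N l a \<Longrightarrow> 0 \<le> c \<Longrightarrow>
     weighted_stft \<phi> s t (packet_distr c a l) x \<xi>
       \<le> ennreal (C * c * N powr weight_order \<theta> s a / (jb x ^ ?d * jb ((1 / l) *\<^sub>R (\<xi> - a)) ^ ?d))"
      using weighted_stft_upper[OF \<phi> \<theta>, where s = s and t = t] by blast
    have "?M (packet_distr c a l) \<le> ennreal (packet_size (B * B * C * c) (recip q) s \<theta> N l a)
      \<and> ?W (packet_distr c a l) \<le> ennreal (packet_size (B * B * C * c) (recip q) s \<theta> N l a)"
      if adm: "admissible \<theta> N l a" and c: "0 \<le> c" for N l c :: real and a :: 'a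
    proof
      have l: "0 < l" using admissible_l_ge_1[OF adm] \<theta> by simp
      let ?w = "weighted_stft \<phi> s t (packet_distr c a l)"
      define K where "K = C * c * N powr weight_order \<theta> s a"
      have K: "0 \<le> K" using C(1) c by (simp add: K_def)
      have le: "?w x \<xi> \<le> ennreal (K / (jb x ^ ?d * jb ((1 / l) *\<^sub>R (\<xi> - a)) ^ ?d))" for x \<xi>
        using C(2)[OF adm c] by (simp add: K_def)
      define h where "h x \<xi> = norm (stft \<phi> (packet_distr c a l) x \<xi>) * jb x powr t * jb \<xi> powr s" for x \<xi>
      have w_h: "?w x \<xi> = ennreal (h x \<xi>)" for x \<xi> by (simp add: weighted_stft_def h_def)
      have h: "continuous_on UNIV (\<lambda>p. h (fst p) (snd p))"
        unfolding h_def by (rule continuous_stft_wave_packet[OF \<phi> l])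
      have h1: "continuous_on UNIV (\<lambda>(x, \<xi>). h x \<xi>)" using h by (simp add: split_beta)
      have "continuous_on UNIV (\<lambda>p. h (fst (prod.swap p)) (snd (prod.swap p)))"
        by (rule continuous_on_compose2[OF h, of UNIV prod.swap]) (auto simp: prod.swap_def[abs_def] intro!: continuous_intros)
      then have h2: "continuous_on UNIV (\<lambda>(\<xi>, x). h x \<xi>)" by (simp add: split_beta)
      have mx: "(\<lambda>x. ?w x \<xi>) \<in> borel_measurable borel" for \<xi>
      proof -
        have "continuous_on UNIV (\<lambda>x. (x, \<xi>))" by (intro continuous_on_Pair continuous_on_const continuous_on_id)
        from continuous_on_compose2[OF h this] have "continuous_on UNIV (\<lambda>x. h x \<xi>)" by simp
        from borel_measurable_continuous_onI[OF this] show ?thesis unfolding w_h by measurable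
      qed
      have m\<xi>: "(\<lambda>\<xi>. ?w x \<xi>) \<in> borel_measurable borel" for x
      proof -
        have "continuous_on UNIV (\<lambda>\<xi>. (x, \<xi>))" by (intro continuous_on_Pair continuous_on_const continuous_on_id)
        from continuous_on_compose2[OF h this] have "continuous_on UNIV (\<lambda>\<xi>. h x \<xi>)" by simp
        from borel_measurable_continuous_onI[OF this] show ?thesis unfolding w_h by measurable
      qed
      have "Lebesgue_norm p (\<lambda>x. ?w x \<xi>) \<le> ennreal (B * (K / jb ((1 / l) *\<^sub>R (\<xi> - a)) ^ ?d) * 1 powr (real DIM('a) * recip p))" for \<xi>
        using K le[of _ \<xi>] by (intro B(2)[where a = 0, OF p mx]) (auto simp: field_simps)
      then have "Lebesgue_norm q (\<lambda>\<xi>. Lebesgue_norm p (\<lambda>x. ?w x \<xi>)) \<le> ennreal (B * (B * K) * l powr (real DIM('a) * recip q))"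
        using K B(1) l by (intro B(2)[where a = a, OF q]) (auto simp: w_h intro!: borel_measurable_Lebesgue_norm[OF p h2])
      then show "?M (packet_distr c a l) \<le> ennreal (packet_size (B * B * C * c) (recip q) s \<theta> N l a)"
        by (simp add: modulation_norm_def K_def mult_ac)
      have "Lebesgue_norm q (\<lambda>\<xi>. ?w x \<xi>) \<le> ennreal (B * (K / jb x ^ ?d) * l powr (real DIM('a) * recip q))" for x
        using K le[of x] l by (intro B(2)[where a = a, OF q m\<xi>]) (auto simp: field_simps)
      then have "Lebesgue_norm p (\<lambda>x. Lebesgue_norm q (\<lambda>\<xi>. ?w x \<xi>)) \<le> ennreal (B * (B * K * l powr (real DIM('a) * recip q)) * 1 powr (real DIM('a) * recip p))"
        using K B(1) l by (intro B(2)[where a = 0, OF p]) (auto simp: w_h mult_ac intro!: borel_measurable_Lebesgue_norm[OF q h1])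
      then show "?W (packet_distr c a l) \<le> ennreal (packet_size (B * B * C * c) (recip q) s \<theta> N l a)"
        by (simp add: wiener_amalgam_norm_def K_def mult_ac)
    qed
    then show ?thesis using B(1) C(1) by (intro exI[of _ "B * B * C"]) auto
  qed
  note key = this
  show "packet_upper (modulation_norm \<phi> p q s t) (recip q) s"
    unfolding packet_upper_def by (intro allI impI) (drule (1) key, blast)
  show "packet_upper (wiener_amalgam_norm \<phi> p q s t) (recip q) s"
    unfolding packet_upper_def by (intro allI impI) (drule (1) key, blast)
qed

text \<open>At \<open>\<tau> = 0\<close>, \<open>x = - y\<close>, \<open>\<eta> = 0\<close> the profile is \<open>cnj (\<phi> y)\<close> times a Gaussian integral; continuity
  does the rest.\<close>

lemma packet_profile_nonzero:
  fixes \<phi> :: "'a::euclidean_space \<Rightarrow> complex"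
  assumes \<phi>: "\<phi> \<in> schwartz" "\<phi> \<noteq> (\<lambda>_. 0)"
  shows "\<exists>x0. \<exists>\<kappa>>0. \<exists>m>0. \<forall>\<tau> x \<eta>. \<bar>\<tau>\<bar> < \<kappa> \<longrightarrow> norm (x - x0) < \<kappa> \<longrightarrow> norm \<eta> < \<kappa> \<longrightarrow>
     m \<le> norm (packet_profile \<phi> (\<tau>, x, \<eta>))"
proof -
  obtain y where y: "\<phi> y \<noteq> 0" using \<phi>(2) by blast
  let ?p = "(0 :: real, - y, 0 :: 'a)"
  have "packet_profile \<phi> ?p = (LINT z|lborel. complex_of_real (gauss (z::'a))) * cnj (\<phi> y)"
    unfolding packet_profile_def by simp
  also have "(LINT z|lborel. complex_of_real (gauss (z::'a))) = complex_of_real ((2 * pi) powr (real DIM('a) / 2))"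
    using gaussian_character_integral[of "0 :: 'a"] by simp
  finally have nz: "0 < norm (packet_profile \<phi> ?p)" using y by (simp add: norm_mult)
  define m where "m = norm (packet_profile \<phi> ?p) / 2"
  have "open {p. m < norm (packet_profile \<phi> p)}"
    by (intro open_Collect_less continuous_intros continuous_packet_profile \<phi>)
  moreover have "?p \<in> {p. m < norm (packet_profile \<phi> p)}" using nz by (simp add: m_def)
  ultimately obtain r where r: "0 < r" "ball ?p r \<subseteq> {p. m < norm (packet_profile \<phi> p)}"
    by (rule openE)
  show ?thesis
  proof (rule exI[of _ "- y"], rule exI[of _ "r / 3"], rule conjI[rotated], rule exI[of _ m], intro conjI allI impI)
    fix \<tau> :: real and x \<eta> :: 'a assume *: "\<bar>\<tau>\<bar> < r / 3" "norm (x - - y) < r / 3" "norm (\<eta>::'a) < r / 3"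
    have "dist (\<tau>, x, \<eta>) ?p = norm (\<tau>, x - - y, \<eta>)" by (simp add: dist_norm)
    also have "\<dots> \<le> norm \<tau> + norm (x - - y, \<eta>)" by (rule norm_Pair_le)
    also have "\<dots> \<le> norm \<tau> + (norm (x - - y) + norm \<eta>)" by (intro add_left_mono norm_Pair_le)
    finally have "dist ?p (\<tau>, x, \<eta>) < r" using * by (simp add: dist_commute)
    then have "(\<tau>, x, \<eta>) \<in> ball ?p r" by simp
    with r(2) have "m < norm (packet_profile \<phi> (\<tau>, x, \<eta>))" by blast
    then show "m \<le> norm (packet_profile \<phi> (\<tau>, x, \<eta>))" by simp
  qed (use r nz in \<open>auto simp: m_def\<close>)
qed

text \<open>On the product of a fixed ball in \<open>x\<close> and a ball of radius \<open>\<kappa> l\<close> around \<open>a\<close> in \<open>\<xi>\<close> the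
  transform is bounded below pointwise, and the weight by the upper bound for the reciprocal
  weight.\<close>

lemma modulation_and_amalgam_packet_lower:
  fixes \<phi> :: "'a::euclidean_space \<Rightarrow> complex"
  assumes \<phi>: "\<phi> \<in> schwartz" "\<phi> \<noteq> (\<lambda>_. 0)" and p: "1 \<le> p" and q: "1 \<le> q"
  shows "packet_lower (modulation_norm \<phi> p q (- s) t) (recip q) s"
    and "packet_lower (wiener_amalgam_norm \<phi> p q (- s) t) (recip q) s"
proof -
  let ?M = "modulation_norm \<phi> p q (- s) t" and ?W = "wiener_amalgam_norm \<phi> p q (- s) t"
  obtain x0 \<kappa> m where km: "0 < \<kappa>" "0 < m" "\<And>\<tau> x \<eta>. \<bar>\<tau>\<bar> < \<kappa> \<Longrightarrow> norm (x - x0) < \<kappa> \<Longrightarrow> norm \<eta> < \<kappa> \<Longrightarrow>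
     m \<le> norm (packet_profile \<phi> (\<tau>, x, \<eta>))"
    using packet_profile_nonzero[OF \<phi>] by metis
  let ?F = "fourier_factor DIM('a)"
  let ?rp = "recip p" and ?rq = "recip q"
  define X where "X = ball x0 \<kappa>"
  have X: "X \<in> sets borel" "0 < measure lborel X" using km(1) by (auto simp: X_def content_ball)
  define T where "T = (1 + norm x0 + \<kappa>) ^ nat \<lceil>\<bar>- t\<bar>\<rceil>"
  have T: "0 < T" using km(1) by (auto simp: T_def intro!: zero_less_power add_pos_pos add_pos_nonneg)
  have jb_X: "1 / T \<le> jb x powr t" if "x \<in> X" for x
  proof -
    have "jb x \<le> 1 + norm x0 + \<kappa>"
      using jb_le[of x] norm_triangle_ineq[of x0 "x - x0"] that by (simp add: X_def dist_norm norm_minus_commute)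
    then have "jb x ^ nat \<lceil>\<bar>- t\<bar>\<rceil> \<le> T" unfolding T_def by (intro power_mono) auto
    with powr_jb_le[OF jb_ge_1[of x], of "- t"] have "jb x powr (- t) \<le> T" by linarith
    then show ?thesis using T by (simp add: powr_minus field_simps)
  qed
  have "\<exists>C>0. \<exists>N0. \<forall>N l a c. N0 \<le> N \<longrightarrow> admissible \<theta> N l a \<longrightarrow> 0 \<le> c \<longrightarrow>
     ennreal (C * c * l powr (real DIM('a) * ?rq) * N powr (- weight_order \<theta> s a)) \<le> ?M (packet_distr c a l)
   \<and> ennreal (C * c * l powr (real DIM('a) * ?rq) * N powr (- weight_order \<theta> s a)) \<le> ?W (packet_distr c a l)"
    if \<theta>: "0 < \<theta>" "\<theta> < 1" for \<theta>
  proof -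
    obtain W M where W: "0 < W" "\<And>N l (a::'a) \<xi>. admissible \<theta> N l a \<Longrightarrow>
      jb \<xi> powr s \<le> W * N powr weight_order \<theta> s a * jb ((1 / l) *\<^sub>R (\<xi> - a)) ^ M"
      using weight_bound[OF \<theta>, where s = s and 'a = 'a] by blast
    define W' where "W' = W * (1 + \<kappa>) ^ M"
    have W': "0 < W'" using W(1) km(1) by (simp add: W'_def)
    define v where "v = measure lborel (ball (0::'a) \<kappa>)"
    have v: "0 < v" using km(1) by (simp add: v_def content_ball)
    define k where "k = ?F * m / (T * W')"
    have k: "0 < k" using km(2) T W' by (simp add: k_def)
    define C where "C = k * measure lborel X powr ?rp * v powr ?rq"
    have C: "0 < C" using k X v by (simp add: C_def)
    \<comment> \<open>from here on \<open>1 / l \<le> N\<^bsup>-\<theta>\<^esup> < \<kappa>\<close>\<close>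
    define N0 where "N0 = (2 / \<kappa>) powr (1 / \<theta>)"
    have "ennreal (C * c * l powr (real DIM('a) * ?rq) * N powr (- weight_order \<theta> s a)) \<le> ?M (packet_distr c a l)
      \<and> ennreal (C * c * l powr (real DIM('a) * ?rq) * N powr (- weight_order \<theta> s a)) \<le> ?W (packet_distr c a l)"
      if N: "N0 \<le> N" and adm: "admissible \<theta> N l a" and c: "0 \<le> c" for N l c :: real and a :: 'a
    proof -
      have l: "1 \<le> l" using adm \<theta> by (intro admissible_l_ge_1)
      have N1: "0 < N" using adm by (simp add: admissible_def)
      have "N0 powr \<theta> \<le> N powr \<theta>" using N \<theta> by (intro powr_mono2) (auto simp: N0_def)
      then have "2 / \<kappa> \<le> N powr \<theta>" using \<theta> km(1) by (simp add: N0_def powr_powr)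
      then have "2 / \<kappa> \<le> l" using adm by (simp add: admissible_def)
      then have \<tau>: "\<bar>1 / l\<bar> < \<kappa>" using l km(1) by (simp add: field_simps)
      define B where "B = ball a (\<kappa> * l)"
      have measB: "measure lborel B = l ^ DIM('a) * v"
        using km(1) l by (simp add: B_def v_def content_ball power_mult_distrib)
      have B: "B \<in> sets borel" "0 < measure lborel B" using v l by (auto simp: measB) (simp add: B_def)
      let ?w = "weighted_stft \<phi> (- s) t (packet_distr c a l)"
      define K where "K = k * c * N powr (- weight_order \<theta> s a)"
      have K: "0 \<le> K" using k c by (simp add: K_def)
      have ge: "ennreal K \<le> ?w x \<xi>" if x: "x \<in> X" and \<xi>: "\<xi> \<in> B" for x \<xi>
      proof -
        let ?u = "(1 / l) *\<^sub>R (\<xi> - a)"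
        have "norm ?u = norm (\<xi> - a) / l" using l by (subst norm_scaleR) simp
        moreover have "norm (\<xi> - a) < \<kappa> * l" using \<xi> by (simp add: B_def dist_norm norm_minus_commute)
        ultimately have u: "norm ?u < \<kappa>" using l by (simp add: pos_divide_less_eq)
        have "jb ?u ^ M \<le> (1 + \<kappa>) ^ M" using jb_le[of ?u] u by (intro power_mono) auto
        then have "W * N powr weight_order \<theta> s a * jb ?u ^ M \<le> W * N powr weight_order \<theta> s a * (1 + \<kappa>) ^ M"
          using W(1) by (intro mult_left_mono) auto
        with W(2)[OF adm, of \<xi>] have "jb \<xi> powr s \<le> W' * N powr weight_order \<theta> s a" by (simp add: W'_def mult_ac)
        then have w\<xi>: "1 / W' * N powr (- weight_order \<theta> s a) \<le> jb \<xi> powr (- s)"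
          using W' N1 by (simp add: powr_minus field_simps)
        have "?F * c * m \<le> norm (stft \<phi> (packet_distr c a l) x \<xi>)"
          using l c x u \<tau> by (subst stft_wave_packet[OF \<phi>(1)])
            (auto simp: norm_mult X_def dist_norm norm_minus_commute intro!: mult_left_mono km(3))
        then have "?F * c * m * (1 / T) * (1 / W' * N powr (- weight_order \<theta> s a))
           \<le> norm (stft \<phi> (packet_distr c a l) x \<xi>) * jb x powr t * jb \<xi> powr (- s)"
          using c km(2) T W' by (intro mult_mono jb_X x w\<xi>) auto
        also have "?F * c * m * (1 / T) * (1 / W' * N powr (- weight_order \<theta> s a)) = K"
          by (simp add: K_def k_def)
        finally show ?thesis unfolding weighted_stft_def by (rule ennreal_leI)
      qed
      have CK: "C * c * l powr (real DIM('a) * ?rq) * N powr (- weight_order \<theta> s a)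
          = K * measure lborel X powr ?rp * measure lborel B powr ?rq"
        using l v by (simp add: measB C_def K_def powr_mult powr_powr powr_realpow[symmetric] mult_ac)
      have "ennreal (K * measure lborel X powr ?rp * measure lborel B powr ?rq) \<le> ?M (packet_distr c a l)"
        unfolding modulation_norm_def using K ge
        by (intro Lebesgue_norm_ge[OF q B] Lebesgue_norm_ge[OF p X]) auto
      moreover have "ennreal (K * measure lborel B powr ?rq * measure lborel X powr ?rp) \<le> ?W (packet_distr c a l)"
        unfolding wiener_amalgam_norm_def using K ge
        by (intro Lebesgue_norm_ge[OF p X] Lebesgue_norm_ge[OF q B]) auto
      ultimately show ?thesis unfolding CK by (simp add: mult_ac)
    qed
    then show ?thesis using C by (intro exI[of _ C] conjI exI[of _ N0]) auto
  qed
  note key = this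
  show "packet_lower (modulation_norm \<phi> p q (- s) t) (recip q) s"
    unfolding packet_lower_def by (intro allI impI) (drule (1) key, blast)
  show "packet_lower (wiener_amalgam_norm \<phi> p q (- s) t) (recip q) s"
    unfolding packet_lower_def by (intro allI impI) (drule (1) key, blast)
qed


section \<open>Necessary conditions for the extension of multiplication\<close>

lemma wave_packet_zero: "wave_packet 0 a l = (\<lambda>_. 0)"
  by (simp add: wave_packet_def fun_eq_iff)

text \<open>The extension maps the pair of zero distributions to zero because it extends the
  multiplication of functions. Continuity at this pair controls products of small packets.\<close>

lemma mult_extendable_packet_bound:
  fixes n1 n2 n :: "'a::euclidean_space distribution \<Rightarrow> ennreal"
  assumes ext: "mult_extendable n1 n2 n"
    and U1: "packet_upper n1 r1 s1" and U2: "packet_upper n2 r2 s2"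
  obtains \<delta> where "0 < \<delta>" "\<And>c1 c2 a1 a2 l. 0 < l \<Longrightarrow>
     n1 (packet_distr c1 a1 l) \<le> ennreal \<delta> \<Longrightarrow> n2 (packet_distr c2 a2 l) \<le> ennreal \<delta> \<Longrightarrow>
     n (distr_of_fun (\<lambda>x. wave_packet c1 a1 l x * wave_packet c2 a2 l x)) < 1"
proof -
  let ?z = "distr_of_fun (\<lambda>_::'a. 0)"
  have zero_schwartz: "(\<lambda>_::'a. 0) \<in> schwartz"
    using schwartz_wave_packet[of 1 0 "0::'a"] by (simp add: wave_packet_zero)
  have adm: "admissible (1 / 2) 1 1 (0 :: 'a)" by (simp add: admissible_def)
  have zero: "?z \<in> distr_space m" if U: "packet_upper m r s" for m r s
  proof -
    have "m ?z < \<infinity>"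
    proof -
      have "(0::real) < 1 / 2" "(1 / 2 :: real) < 1" by auto
      from U[unfolded packet_upper_def, rule_format, OF this] obtain C where
        "\<forall>N l (a::'a) c. admissible (1 / 2) N l a \<longrightarrow> 0 \<le> c \<longrightarrow>
          m (packet_distr c a l) \<le> ennreal (packet_size (C * c) r s (1 / 2) N l a)"
        by blast
      from this[rule_format, OF adm, of 0] show ?thesis
        by (simp add: wave_packet_zero)
    qed
    then show ?thesis using distr_of_fun_schwartz_tempered[OF zero_schwartz] by (simp add: distr_space_def)
  qed
  obtain T where
    T: "\<And>f1 f2. f1 \<in> schwartz \<Longrightarrow> f2 \<in> schwartz \<Longrightarrow> T (distr_of_fun f1) (distr_of_fun f2) = distr_of_fun (\<lambda>x. f1 x * f2 x)"
    and cont: "\<forall>u1\<in>distr_space n1. \<forall>u2\<in>distr_space n2. \<forall>\<epsilon>>0. \<exists>\<delta>>0.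
        \<forall>v1\<in>distr_space n1. \<forall>v2\<in>distr_space n2.
          n1 (distr_diff v1 u1) < \<delta> \<and> n2 (distr_diff v2 u2) < \<delta> \<longrightarrow>
          n (distr_diff (T v1 v2) (T u1 u2)) < \<epsilon>"
    using ext unfolding mult_extendable_def by blast
  have "\<exists>\<delta>>0. \<forall>v1\<in>distr_space n1. \<forall>v2\<in>distr_space n2.
          n1 (distr_diff v1 ?z) < \<delta> \<and> n2 (distr_diff v2 ?z) < \<delta> \<longrightarrow> n (distr_diff (T v1 v2) (T ?z ?z)) < 1"
    by (rule cont[rule_format, OF zero[OF U1] zero[OF U2]]) simp
  then obtain \<delta> where \<delta>: "0 < \<delta>" "\<And>v1 v2. v1 \<in> distr_space n1 \<Longrightarrow> v2 \<in> distr_space n2 \<Longrightarrow>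
          n1 (distr_diff v1 ?z) < \<delta> \<Longrightarrow> n2 (distr_diff v2 ?z) < \<delta> \<Longrightarrow> n (distr_diff (T v1 v2) (T ?z ?z)) < 1"
    by blast
  obtain \<delta>' where \<delta>': "0 < \<delta>'" "ennreal \<delta>' < \<delta>"
    using \<delta>(1) by (metis dense ennreal_cases ennreal_less_zero_iff less_top_ennreal order_less_imp_not_less top.not_eq_extremum)
  have diff: "distr_diff u ?z = u" for u :: "'a distribution"
    by (simp add: distr_diff_def distr_of_fun_def fun_eq_iff)
  show ?thesis
  proof (rule that[OF \<delta>'(1)])
    fix c1 c2 l and a1 a2 :: 'a
    assume l: "0 < l" and le: "n1 (packet_distr c1 a1 l) \<le> ennreal \<delta>'" "n2 (packet_distr c2 a2 l) \<le> ennreal \<delta>'"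
    have lt: "n1 (packet_distr c1 a1 l) < \<delta>" "n2 (packet_distr c2 a2 l) < \<delta>"
      using le_less_trans[OF le(1) \<delta>'(2)] le_less_trans[OF le(2) \<delta>'(2)] by auto
    have "packet_distr c1 a1 l \<in> distr_space n1" "packet_distr c2 a2 l \<in> distr_space n2"
      using le_less_trans[OF le(1) ennreal_less_top] le_less_trans[OF le(2) ennreal_less_top] l
      by (auto simp: distr_space_def distr_of_fun_schwartz_tempered schwartz_wave_packet)
    from \<delta>(2)[OF this] lt show "n (distr_of_fun (\<lambda>x. wave_packet c1 a1 l x * wave_packet c2 a2 l x)) < 1"
      by (simp add: diff T schwartz_wave_packet l zero_schwartz)
  qed
qed

lemma powr_bounded_imp_nonpos:
  fixes \<gamma> :: real
  assumes K: "0 < K" and bound: "\<And>N. N0 \<le> N \<Longrightarrow> 1 \<le> N \<Longrightarrow> K * N powr \<gamma> < 1"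
  shows "\<gamma> \<le> 0"
proof (rule ccontr)
  assume "\<not> \<gamma> \<le> 0"
  then have \<gamma>: "0 < \<gamma>" by simp
  define N where "N = max N0 (max 1 ((1 / K) powr (1 / \<gamma>)))"
  have "((1 / K) powr (1 / \<gamma>)) powr \<gamma> \<le> N powr \<gamma>" using \<gamma> by (intro powr_mono2) (auto simp: N_def)
  then have "1 / K \<le> N powr \<gamma>" using \<gamma> K by (simp add: powr_powr)
  then have "1 \<le> K * N powr \<gamma>" using K by (simp add: field_simps)
  moreover have "N0 \<le> N" "1 \<le> N" by (auto simp: N_def)
  ultimately show False using bound[of N] by linarith
qed

text \<open>The amplitudes are chosen such that both factors have norm at most \<open>\<delta>\<close>. The lower bound on the
  product then bounds a power of \<open>N\<close> for all large \<open>N\<close>, so that its exponent cannot be positive. Only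
  the vanishing of the frequencies matters in \<^const>\<open>weight_order\<close>, and therefore their positions
  on a line are recorded by real numbers.\<close>

lemma exponent_inequality:
  fixes n1 n2 n :: "'a::euclidean_space distribution \<Rightarrow> ennreal"
  assumes ext: "mult_extendable n1 n2 n"
    and U1: "packet_upper n1 r1 s1" and U2: "packet_upper n2 r2 s2" and L: "packet_lower n r0 s0"
    and \<theta>: "0 < \<theta>" "\<theta> < 1"
    and a: "\<epsilon>1 \<in> {-1, 0, 1}" "\<epsilon>2 \<in> {-1, 0, 1}"
  shows "\<theta> * (real DIM('a) * (1 + r0 - r1 - r2)) \<le>
     weight_order \<theta> s0 (\<epsilon>1 + \<epsilon>2) + weight_order \<theta> s1 \<epsilon>1 + weight_order \<theta> s2 (\<epsilon>2 :: real)"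
proof -
  obtain b :: 'a where "b \<in> Basis" using nonempty_Basis by blast
  then have b: "norm b = 1" "b \<noteq> 0" by auto
  let ?d = "real DIM('a)"
  obtain \<delta> where \<delta>: "0 < \<delta>" "\<And>c1 c2 a1 a2 l. 0 < l \<Longrightarrow>
     n1 (packet_distr c1 a1 l) \<le> ennreal \<delta> \<Longrightarrow> n2 (packet_distr c2 a2 l) \<le> ennreal \<delta> \<Longrightarrow>
     n (distr_of_fun (\<lambda>x. wave_packet c1 a1 l x * wave_packet c2 a2 l x)) < 1"
    using mult_extendable_packet_bound[OF ext U1 U2] by blast
  obtain C1 where C1: "0 < C1" "\<And>N l (a::'a) c. admissible \<theta> N l a \<Longrightarrow> 0 \<le> c \<Longrightarrow>
     n1 (packet_distr c a l) \<le> ennreal (packet_size (C1 * c) r1 s1 \<theta> N l a)"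
    using U1[unfolded packet_upper_def, rule_format, OF \<theta>] by blast
  obtain C2 where C2: "0 < C2" "\<And>N l (a::'a) c. admissible \<theta> N l a \<Longrightarrow> 0 \<le> c \<Longrightarrow>
     n2 (packet_distr c a l) \<le> ennreal (packet_size (C2 * c) r2 s2 \<theta> N l a)"
    using U2[unfolded packet_upper_def, rule_format, OF \<theta>] by blast
  obtain C0 N0 where C0: "0 < C0" "\<And>N l (a::'a) c. N0 \<le> N \<Longrightarrow> admissible \<theta> N l a \<Longrightarrow> 0 \<le> c \<Longrightarrow>
     ennreal (C0 * c * l powr (?d * r0) * N powr (- weight_order \<theta> s0 a)) \<le> n (packet_distr c a l)"
    using L[unfolded packet_lower_def, rule_format, OF \<theta>] by blast
  define w0 where "w0 = weight_order \<theta> s0 (\<epsilon>1 + \<epsilon>2)"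
  define w1 where "w1 = weight_order \<theta> s1 \<epsilon>1"
  define w2 where "w2 = weight_order \<theta> s2 \<epsilon>2"
  define \<beta>1 where "\<beta>1 = \<theta> * (?d * r1) + w1"
  define \<beta>2 where "\<beta>2 = \<theta> * (?d * r2) + w2"
  define K where "K = C0 * (\<delta> / C1 * (\<delta> / C2) / sqrt 2 ^ DIM('a)) * sqrt 2 powr (?d * r0)"
  have "\<theta> * ?d + \<theta> * (?d * r0) - w0 - \<beta>1 - \<beta>2 \<le> 0"
  proof (rule powr_bounded_imp_nonpos)
    show "0 < K" using C0(1) C1(1) C2(1) \<delta>(1) by (simp add: K_def)
    fix N assume N: "N0 \<le> N" "1 \<le> N"
    define l where "l = N powr \<theta>"
    have l: "0 < l" using N by (simp add: l_def)
    have adm: "admissible \<theta> N l' ((\<epsilon> * N) *\<^sub>R b)"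
      if "\<epsilon> \<in> {-2, -1, 0, 1, 2}" "l \<le> l'" "l' \<le> 2 * l" for \<epsilon> l'
      using that N b by (auto simp: admissible_def l_def)
    have w: "weight_order \<theta> s ((\<epsilon> * N) *\<^sub>R b) = weight_order \<theta> s \<epsilon>" for s \<epsilon> :: real
      using N b by (simp add: weight_order_def)
    \<comment> \<open>the amplitudes for which the upper bounds equal \<open>\<delta>\<close>\<close>
    define c1 where "c1 = \<delta> / (C1 * N powr \<beta>1)"
    define c2 where "c2 = \<delta> / (C2 * N powr \<beta>2)"
    have c: "0 \<le> c1" "0 \<le> c2" using \<delta> C1(1) C2(1) by (auto simp: c1_def c2_def)
    have l_powr: "l powr (?d * r) = N powr (\<theta> * (?d * r))" for r
      by (simp add: l_def powr_powr)
    have "n1 (packet_distr c1 ((\<epsilon>1 * N) *\<^sub>R b) l) \<le> ennreal (C1 * c1 * N powr \<beta>1)"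
      using C1(2)[OF adm c(1), of \<epsilon>1 l] a l by (auto simp: w w1_def \<beta>1_def powr_add l_powr mult.assoc)
    also have "C1 * c1 * N powr \<beta>1 = \<delta>" using C1(1) N by (simp add: c1_def)
    finally have n1: "n1 (packet_distr c1 ((\<epsilon>1 * N) *\<^sub>R b) l) \<le> ennreal \<delta>" .
    have "n2 (packet_distr c2 ((\<epsilon>2 * N) *\<^sub>R b) l) \<le> ennreal (C2 * c2 * N powr \<beta>2)"
      using C2(2)[OF adm c(2), of \<epsilon>2 l] a l by (auto simp: w w2_def \<beta>2_def powr_add l_powr mult.assoc)
    also have "C2 * c2 * N powr \<beta>2 = \<delta>" using C2(1) N by (simp add: c2_def)
    finally have n2: "n2 (packet_distr c2 ((\<epsilon>2 * N) *\<^sub>R b) l) \<le> ennreal \<delta>" .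
    define c0 where "c0 = c1 * c2 * l ^ DIM('a) / sqrt 2 ^ DIM('a)"
    have c0: "0 \<le> c0" using c l by (simp add: c0_def)
    have prod: "(\<lambda>x. wave_packet c1 ((\<epsilon>1 * N) *\<^sub>R b) l x * wave_packet c2 ((\<epsilon>2 * N) *\<^sub>R b) l x)
       = wave_packet c0 (((\<epsilon>1 + \<epsilon>2) * N) *\<^sub>R b) (sqrt 2 * l)"
      by (simp add: wave_packet_mult[OF l] c0_def scaleR_add_left[symmetric] distrib_right)
    have "sqrt 2 \<le> 2" by (rule real_le_lsqrt) auto
    then have "admissible \<theta> N (sqrt 2 * l) (((\<epsilon>1 + \<epsilon>2) * N) *\<^sub>R b)"
      using a l by (intro adm) auto
    from C0(2)[OF N(1) this c0]
    have "ennreal (C0 * c0 * (sqrt 2 * l) powr (?d * r0) * N powr (- w0)) \<le>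
       n (distr_of_fun (\<lambda>x. wave_packet c1 ((\<epsilon>1 * N) *\<^sub>R b) l x * wave_packet c2 ((\<epsilon>2 * N) *\<^sub>R b) l x))"
      unfolding prod w w0_def .
    also have "\<dots> < 1" by (rule \<delta>(2)[OF l n1 n2])
    finally have "C0 * c0 * (sqrt 2 * l) powr (?d * r0) * N powr (- w0) < 1"
      by (simp add: ennreal_less_one_iff)
    also have "C0 * c0 * (sqrt 2 * l) powr (?d * r0) * N powr (- w0) = K * N powr (\<theta> * ?d + \<theta> * (?d * r0) - w0 - \<beta>1 - \<beta>2)"
    proof -
      have "l ^ DIM('a) = N powr (\<theta> * ?d)" using l by (simp add: powr_realpow[symmetric] l_def powr_powr)
      moreover have "(sqrt 2 * l) powr (?d * r0) = sqrt 2 powr (?d * r0) * N powr (\<theta> * (?d * r0))"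
        using l by (simp add: powr_mult l_powr)
      ultimately show ?thesis
        using N by (simp add: K_def c0_def c1_def c2_def powr_add powr_diff powr_minus divide_inverse mult_ac)
    qed
    finally show "K * N powr (\<theta> * ?d + \<theta> * (?d * r0) - w0 - \<beta>1 - \<beta>2) < 1" .
  qed
  then show ?thesis
    unfolding \<beta>1_def \<beta>2_def w0_def w1_def w2_def by (simp add: algebra_simps)
qed

lemma nonneg_of_small_multiples_le:
  fixes x y :: real
  assumes "\<And>\<theta>. 0 < \<theta> \<Longrightarrow> \<theta> < 1 \<Longrightarrow> \<theta> * x \<le> y"
  shows "0 \<le> y"
proof (rule tendsto_upperbound)
  show "((\<lambda>\<theta>. \<theta> * x) \<longlongrightarrow> 0) (at_right 0)" by (auto intro!: tendsto_eq_intros)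
  show "\<forall>\<^sub>F \<theta> in at_right 0. \<theta> * x \<le> y"
    by (subst eventually_at_right[of 0 1]) (auto intro!: exI[of _ 1] assms)
qed simp

text \<open>If exactly one of \<open>\<epsilon>1\<close>, \<open>\<epsilon>2\<close> and \<open>\<epsilon>1 + \<epsilon>2\<close> vanishes, then \<open>\<theta> \<rightarrow> 0\<close> removes both the
  dimensional term and the weight at the origin, which leaves the sum of two exponents. For
  \<open>\<epsilon>1 = \<epsilon>2 = 1\<close> none vanishes, and \<open>\<theta> \<rightarrow> 1\<close> gives the full dimensional condition.\<close>

lemma necessary_conditions:
  fixes n1 n2 n :: "'a::euclidean_space distribution \<Rightarrow> ennreal"
  assumes ext: "mult_extendable n1 n2 n"
    and U1: "packet_upper n1 r1 s1" and U2: "packet_upper n2 r2 s2" and L: "packet_lower n r0 s0"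
  shows "0 \<le> s0 + s1" "0 \<le> s0 + s2" "0 \<le> s1 + s2"
    and "real DIM('a) * (1 + r0 - r1 - r2) \<le> s0 + s1 + s2"
proof -
  let ?R = "real DIM('a) * (1 + r0 - r1 - r2)"
  note ineq = exponent_inequality[OF ext U1 U2 L]
  show "0 \<le> s0 + s1"
  proof (rule nonneg_of_small_multiples_le[of "?R - \<bar>s2\<bar>"])
    show "\<theta> * (?R - \<bar>s2\<bar>) \<le> s0 + s1" if "0 < \<theta>" "\<theta> < 1" for \<theta>
      using ineq[OF that, of 1 0] by (simp add: weight_order_def right_diff_distrib)
  qed
  show "0 \<le> s0 + s2"
  proof (rule nonneg_of_small_multiples_le[of "?R - \<bar>s1\<bar>"])
    show "\<theta> * (?R - \<bar>s1\<bar>) \<le> s0 + s2" if "0 < \<theta>" "\<theta> < 1" for \<theta>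
      using ineq[OF that, of 0 1] by (simp add: weight_order_def right_diff_distrib)
  qed
  show "0 \<le> s1 + s2"
  proof (rule nonneg_of_small_multiples_le[of "?R - \<bar>s0\<bar>"])
    show "\<theta> * (?R - \<bar>s0\<bar>) \<le> s1 + s2" if "0 < \<theta>" "\<theta> < 1" for \<theta>
      using ineq[OF that, of 1 "-1"] by (simp add: weight_order_def right_diff_distrib)
  qed
  show "?R \<le> s0 + s1 + s2"
  proof (rule field_le_mult_one_interval)
    show "\<theta> * ?R \<le> s0 + s1 + s2" if "0 < \<theta>" "\<theta> < 1" for \<theta>
      using ineq[OF that, of 1 1] by (simp add: weight_order_def)
  qed
qed

theorem proposition3p7:
  fixes \<phi> :: "real ^ 'n \<Rightarrow> complex"
    and p q :: "nat \<Rightarrow> ennreal"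
    and s t :: "nat \<Rightarrow> real"
  assumes "\<phi> \<in> schwartz" and "\<phi> \<noteq> (\<lambda>_. 0)"
    and "\<forall>j\<in>{0,1,2}. 1 \<le> p j \<and> 1 \<le> q j"
    and "mult_extendable
           (fourier_lebesgue_norm (q 1) (s 1) :: (real ^ 'n) distribution \<Rightarrow> ennreal)
           (fourier_lebesgue_norm (q 2) (s 2))
           (fourier_lebesgue_norm (conj_exponent (q 0)) (- s 0))
       \<or> mult_extendable
           (modulation_norm \<phi> (p 1) (q 1) (s 1) (t 1))
           (modulation_norm \<phi> (p 2) (q 2) (s 2) (t 2))
           (modulation_norm \<phi> (conj_exponent (p 0)) (conj_exponent (q 0)) (- s 0) (- t 0))
       \<or> mult_extendable
           (wiener_amalgam_norm \<phi> (p 1) (q 1) (s 1) (t 1))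
           (wiener_amalgam_norm \<phi> (p 2) (q 2) (s 2) (t 2))
           (wiener_amalgam_norm \<phi> (conj_exponent (p 0)) (conj_exponent (q 0)) (- s 0) (- t 0))"
  shows "(\<forall>j\<in>{0,1,2}. \<forall>k\<in>{0,1,2}. j \<noteq> k \<longrightarrow> 0 \<le> s j + s k) \<and>
         0 \<le> s 0 + s 1 + s 2 - real CARD('n) * R_functional q"
proof -
  have pq: "1 \<le> p 0" "1 \<le> p 1" "1 \<le> p 2" "1 \<le> q 0" "1 \<le> q 1" "1 \<le> q 2" using assms(3) by auto
  have pq': "1 \<le> conj_exponent (p 0)" "1 \<le> conj_exponent (q 0)" using pq conj_exponent by auto
  let ?r = "\<lambda>j. enn2real (1 / q j)"
  have q0': "enn2real (1 / conj_exponent (q 0)) = 1 - ?r 0" by (rule recip_conj_exponent[OF pq(4)])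
  obtain n1 n2 n :: "(real ^ 'n) distribution \<Rightarrow> ennreal" where
    n: "mult_extendable n1 n2 n" "packet_upper n1 (?r 1) (s 1)" "packet_upper n2 (?r 2) (s 2)" "packet_lower n (1 - ?r 0) (s 0)"
    using assms(4)
  proof (elim disjE, goal_cases)
    case 1
    show thesis
      by (rule that[OF 1(2) fourier_lebesgue_packet_upper[OF pq(5)] fourier_lebesgue_packet_upper[OF pq(6)]
            fourier_lebesgue_packet_lower[OF pq(4)]])
  next
    case 2
    show thesis
      by (rule that[OF 2(2) modulation_and_amalgam_packet_upper(1)[OF assms(1) pq(2) pq(5)]
            modulation_and_amalgam_packet_upper(1)[OF assms(1) pq(3) pq(6)]
            modulation_and_amalgam_packet_lower(1)[OF assms(1,2) pq', where s = "s 0" and t = "- t 0", unfolded q0']])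
  next
    case 3
    show thesis
      by (rule that[OF 3(2) modulation_and_amalgam_packet_upper(2)[OF assms(1) pq(2) pq(5)]
            modulation_and_amalgam_packet_upper(2)[OF assms(1) pq(3) pq(6)]
            modulation_and_amalgam_packet_lower(2)[OF assms(1,2) pq', where s = "s 0" and t = "- t 0", unfolded q0']])
  qed
  note conds = necessary_conditions[OF n]
  have "real CARD('n) * R_functional q = real DIM(real ^ 'n) * (1 + (1 - ?r 0) - ?r 1 - ?r 2)"
    by (simp add: R_functional_def)
  with conds show ?thesis by (auto simp: add.commute)
qed

end
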